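(* Let $k$ be a field and $P$ a poset equipped with a height-difference function $\rho$. (1) If $M,N\in\mathrm{Rep}_k(P)$ are $r$-height-interleaved with respect to $\rho$ (for some $r\ge0$), then there exists $Q\in\mathrm{EN}_r(M)\cap\mathrm{EN}_r(N)$. In particular, $d_{\rho\text{-EN}}(M,N)\le d_\rho(M,N)$ for all $M,N\in\mathrm{Rep}_k(P)$. (2) Assume that $(P,\rho)$ has the connected intersections property (CIP). Then $d_{\rho\text{-EN}}$ satisfies a $c(\rho)$-relaxed triangle inequality, i.e. $d_{\rho\text{-EN}}(M,N)\le d_{\rho\text{-EN}}(M,X)+d_{\rho\text{-EN}}(X,N)+c(\rho)$ for all $M,X,N\in\mathrm{Rep}_k(P)$, and for all $M,N\in\mathrm{Rep}_k(P)$, $$d_{\rho\text{-EN}}(M,N)\le d_\rho(M,N)\le 2\,d_{\rho\text{-EN}}(M,N)+c(\rho).$$ In particular, if $c(\rho)=0$, then $d_{\rho\text{-EN}}$ is an extended pseudo-distance and $d_{\rho\text{-EN}}(M,N)\le d_\rho(M,N)\le 2\,d_{\rho\text{-EN}}(M,N)$.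
   Context: A poset $P$ is regarded as a category (a unique morphism $a\to b$ iff $a\le b$). $\mathrm{Rep}_k(P)=\mathrm{Fun}(P,\mathrm{Vect}_k)$ is the abelian category of functors from $P$ to $k$-vector spaces (of arbitrary dimension); kernels, cokernels and images are pointwise. All infima of empty sets are $\infty$. A height-difference function on $P$ is a function $\rho:\{(a,b)\in P\times P: a\le b\}\to[0,\infty]$ with $\rho(a,a)=0$ for all $a$ and $\rho(a,c)\ge\rho(a,b)+\rho(b,c)$ whenever $a\le b\le c$. For $a\in P$ and real $r\ge 0$ put $a^{\downarrow_r}=\{x\in P: x\le a,\ \rho(x,a)\ge r\}$ and $a^{\uparrow_r}=\{x\in P: x\ge a,\ \rho(a,x)\ge r\}$ (full subposets). Endofunctors $\mathsf L_r=\mathsf L_r^\rho$ and $\mathsf R_r=\mathsf R_r^\rho$ of $\mathrm{Rep}_k(P)$: $(\mathsf L_rM)(a)=\operatorname{colim} M|_{a^{\downarrow_r}}$ and $(\mathsf R_rM)(a)=\lim M|_{a^{\uparrow_r}}$, with structure morphisms for $a\le b$ (using $a^{\downarrow_r}\subseteq b^{\downarrow_r}$, $b^{\uparrow_r}\subseteq a^{\uparrow_r}$) and the action on morphisms induced by the universal properties. Write $\alpha_{a,M}(x):M(x)\to(\mathsf L_rM)(a)$ ($x\in a^{\downarrow_r}$) and $\beta_{a,M}(y):(\mathsf R_rM)(a)\to M(y)$ ($y\in a^{\uparrow_r}$) for the canonical maps. The functor $\mathsf L_r$ is left adjoint to $\mathsf R_r$; for $p:M\to\mathsf R_rN$, its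 adjoint $p^\sharp:\mathsf L_rM\to N$ is the unique morphism with $p^\sharp(a)\circ\alpha_{a,M}(x)=\beta_{x,N}(a)\circ p(x)$ for all $a\in P$, $x\in a^{\downarrow_r}$. Let $\eta^{\mathsf L}_{r,M}:\mathsf L_rM\to M$ and $\eta^{\mathsf R}_{r,M}:M\to\mathsf R_rM$ be induced by the structure maps $M(x\le a)$, $x\in a^{\downarrow_r}$, respectively $M(a\le y)$, $y\in a^{\uparrow_r}$, and set $e_{r,M}=\eta^{\mathsf R}_{r,M}\circ\eta^{\mathsf L}_{r,M}:\mathsf L_rM\to\mathsf R_rM$. $M,N$ are $r$-height-interleaved with respect to $\rho$ if there are $p:M\to\mathsf R_rN$ and $q:N\to\mathsf R_rM$ with $e_{r,M}=q\circ p^\sharp$ and $e_{r,N}=p\circ q^\sharp$; $d_\rho(M,N)=\inf\{r\ge0: M,N \text{ are } r\text{-height-interleaved w.r.t. }\rho\}$. Put $\mathrm{Im}_rM=\operatorname{im}(\eta^{\mathsf L}_{r,M})\subseteq M$ and $\mathrm{Ker}_rM=\ker(\eta^{\mathsf R}_{r,M})\subseteq M$. An $r$-erosion neighborhood of $M$ is a module (up to isomorphism) of the form $M_1/M_2$ with submodules $M_2\subseteq M_1\subseteq M$ such that $\mathrm{Im}_rM\subseteq M_1$ and $M_2\subseteq\mathrm{Ker}_rM$; $\mathrm{EN}_r(M)$ is the set of isomorphism classes of these. Define $d_{\rho\text{-EN}}(M,N)=\inf\{r\ge0:\mathrm{EN}_r(M)\cap\mathrm{EN}_r(N)\ne\emptyset\}$.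 CIP: $(P,\rho)$ has the connected intersections property if for all $a,q\in P$ and $s,r\ge0$ the full subposet $a^{\downarrow_s}\cap q^{\uparrow_r}$ is empty or connected (any two elements are joined by a finite zigzag of comparabilities inside it). For $u,v\in[0,\infty]$ set $|u-v|_\infty=|u-v|$ if $u,v<\infty$, $0$ if $u=v=\infty$, and $\infty$ otherwise. For $c\ge0$, condition (IV$_c$): for any $a\le b$ in $P$ and any $t\in[0,\infty)$ with $t\le\rho(a,b)$ there exists $z\in P$ with $a\le z\le b$, $|\rho(a,z)-t|_\infty\le c/2$ and $|\rho(z,b)-(\rho(a,b)-t)|_\infty\le c/2$. Then $c(\rho)=\inf\{c\ge0:(P,\rho)\text{ satisfies (IV}_c)\}\in[0,\infty]$. An extended pseudo-distance is a $[0,\infty]$-valued function that is symmetric, vanishes on the diagonal and satisfies the triangle inequality. *)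

theory Defs
  imports "HOL-Algebra.AbelCoset" "HOL-Library.Extended_Nonnegative_Real"
    "Jordan_Normal_Form.Missing_VectorSpace"
begin

section \<open>Direct sums and quotients of vector spaces\<close>

text \<open>Vector spaces are \<open>('k, 'v) module\<close> records over a field \<open>K\<close>. The record extends \<open>ring\<close>,
  so it has fields \<open>mult\<close> and \<open>one\<close>; these play no role for vector spaces and are left
  \<open>undefined\<close> below.\<close>

definition vs_dsum :: "'i set \<Rightarrow> ('i \<Rightarrow> ('k, 'v) module) \<Rightarrow> ('k, 'i \<Rightarrow> 'v) module" where
  "vs_dsum S V =
    \<lparr>carrier = {f \<in> (\<Pi>\<^sub>E x\<in>S. carrier (V x)). finite {x \<in> S. f x \<noteq> \<zero>\<^bsub>V x\<^esub>}},
     mult = undefined, one = undefined,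
     zero = (\<lambda>x\<in>S. \<zero>\<^bsub>V x\<^esub>),
     add = (\<lambda>f g. \<lambda>x\<in>S. f x \<oplus>\<^bsub>V x\<^esub> g x),
     smult = (\<lambda>c f. \<lambda>x\<in>S. c \<odot>\<^bsub>V x\<^esub> f x)\<rparr>"

definition vs_dsum_in :: "'i set \<Rightarrow> ('i \<Rightarrow> ('k, 'v) module) \<Rightarrow> 'i \<Rightarrow> 'v \<Rightarrow> ('i \<Rightarrow> 'v)" where
  "vs_dsum_in S V x v = (\<lambda>y\<in>S. if y = x then v else \<zero>\<^bsub>V y\<^esub>)"

definition quot :: "('k, 'v) module \<Rightarrow> 'v set \<Rightarrow> ('k, 'v set) module" where
  "quot V W =
    \<lparr>carrier = a_rcosets\<^bsub>V\<^esub> W,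
     mult = undefined, one = undefined,
     zero = W,
     add = (\<lambda>X Y. X <+>\<^bsub>V\<^esub> Y),
     smult = (\<lambda>c X. \<Union>x\<in>X. W +>\<^bsub>V\<^esub> (c \<odot>\<^bsub>V\<^esub> x))\<rparr>"

section \<open>Representations of a poset\<close>

record ('k, 'p, 'v) rep =
  Ob :: "'p \<Rightarrow> ('k, 'v) module"
  Tr :: "'p \<Rightarrow> 'p \<Rightarrow> 'v \<Rightarrow> 'v"

text \<open>\<open>Tr M a b\<close> is the structure map \<open>M(a \<le> b)\<close>; its values for \<open>\<not> a \<le> b\<close> or outside the
  carrier of \<open>Ob M a\<close> are irrelevant.\<close>

definition Rep :: "('k, 'm) ring_scheme \<Rightarrow> ('k, 'p::order, 'v) rep set" where
  "Rep K = {M.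
     (\<forall>a. vectorspace K (Ob M a)) \<and>
     (\<forall>a b. a \<le> b \<longrightarrow> Tr M a b \<in> LinearCombinations.module_hom K (Ob M a) (Ob M b)) \<and>
     (\<forall>a. \<forall>v\<in>carrier (Ob M a). Tr M a a v = v) \<and>
     (\<forall>a b c. a \<le> b \<longrightarrow> b \<le> c \<longrightarrow> (\<forall>v\<in>carrier (Ob M a). Tr M b c (Tr M a b v) = Tr M a c v))}"

definition rep_hom :: "('k, 'm) ring_scheme \<Rightarrow> ('k, 'p::order, 'v) rep \<Rightarrow> ('k, 'p, 'w) rep
    \<Rightarrow> ('p \<Rightarrow> 'v \<Rightarrow> 'w) set" where
  "rep_hom K M N = {f.
     (\<forall>a. f a \<in> LinearCombinations.module_hom K (Ob M a) (Ob N a)) \<and>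
     (\<forall>a b. a \<le> b \<longrightarrow> (\<forall>v\<in>carrier (Ob M a). f b (Tr M a b v) = Tr N a b (f a v)))}"

text \<open>Morphisms are equal iff they agree on the carriers.\<close>

definition rep_hom_eq :: "('k, 'p, 'v) rep \<Rightarrow> ('p \<Rightarrow> 'v \<Rightarrow> 'w) \<Rightarrow> ('p \<Rightarrow> 'v \<Rightarrow> 'w) \<Rightarrow> bool" where
  "rep_hom_eq M f g \<longleftrightarrow> (\<forall>a. \<forall>v\<in>carrier (Ob M a). f a v = g a v)"

definition rep_comp :: "('p \<Rightarrow> 'v \<Rightarrow> 'w) \<Rightarrow> ('p \<Rightarrow> 'u \<Rightarrow> 'v) \<Rightarrow> ('p \<Rightarrow> 'u \<Rightarrow> 'w)" where
  "rep_comp g f = (\<lambda>a. g a \<circ> f a)"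

definition rep_iso :: "('k, 'm) ring_scheme \<Rightarrow> ('k, 'p::order, 'v) rep \<Rightarrow> ('k, 'p, 'w) rep \<Rightarrow> bool" where
  "rep_iso K M N \<longleftrightarrow>
     (\<exists>f\<in>rep_hom K M N. \<forall>a. bij_betw (f a) (carrier (Ob M a)) (carrier (Ob N a)))"

definition iso_class :: "('k, 'm) ring_scheme \<Rightarrow> ('k, 'p::order, 'v) rep \<Rightarrow> ('k, 'p, 'v) rep set" where
  "iso_class K M = {N \<in> Rep K. rep_iso K M N}"

definition subrep :: "('k, 'm) ring_scheme \<Rightarrow> ('p \<Rightarrow> 'v set) \<Rightarrow> ('k, 'p::order, 'v) rep \<Rightarrow> bool" where
  "subrep K W M \<longleftrightarrow>
     (\<forall>a. VectorSpace.subspace K (W a) (Ob M a)) \<and>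
     (\<forall>a b. a \<le> b \<longrightarrow> Tr M a b ` W a \<subseteq> W b)"

definition restrict_rep :: "('k, 'p, 'v) rep \<Rightarrow> ('p \<Rightarrow> 'v set) \<Rightarrow> ('k, 'p, 'v) rep" where
  "restrict_rep M W = \<lparr>Ob = (\<lambda>a. (Ob M a)\<lparr>carrier := W a\<rparr>), Tr = Tr M\<rparr>"

definition quot_rep :: "('k, 'p, 'v) rep \<Rightarrow> ('p \<Rightarrow> 'v set) \<Rightarrow> ('k, 'p, 'v set) rep" where
  "quot_rep M W =
    \<lparr>Ob = (\<lambda>a. quot (Ob M a) (W a)),
     Tr = (\<lambda>a b X. \<Union>x\<in>X. W b +>\<^bsub>Ob M b\<^esub> Tr M a b x)\<rparr>"

section \<open>Colimits and limits over full subposets\<close>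

text \<open>The colimit of \<open>M\<close> over the full subposet \<open>S\<close> is the direct sum of the \<open>M(x)\<close>, \<open>x \<in> S\<close>,
  modulo the relations identifying \<open>v \<in> M(x)\<close> with \<open>M(x \<le> y)(v)\<close>.\<close>

definition colim_rels :: "('k, 'm) ring_scheme \<Rightarrow> ('k, 'p::order, 'v) rep \<Rightarrow> 'p set \<Rightarrow> ('p \<Rightarrow> 'v) set" where
  "colim_rels K M S = LinearCombinations.module.span K (vs_dsum S (Ob M))
     {vs_dsum_in S (Ob M) x v \<ominus>\<^bsub>vs_dsum S (Ob M)\<^esub> vs_dsum_in S (Ob M) y (Tr M x y v) | x y v.
        x \<in> S \<and> y \<in> S \<and> x \<le> y \<and> v \<in> carrier (Ob M x)}"

definition colim :: "('k, 'm) ring_scheme \<Rightarrow> ('k, 'p::order, 'v) rep \<Rightarrow> 'p set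
    \<Rightarrow> ('k, ('p \<Rightarrow> 'v) set) module" where
  "colim K M S = quot (vs_dsum S (Ob M)) (colim_rels K M S)"

definition colim_in :: "('k, 'm) ring_scheme \<Rightarrow> ('k, 'p::order, 'v) rep \<Rightarrow> 'p set
    \<Rightarrow> 'p \<Rightarrow> 'v \<Rightarrow> ('p \<Rightarrow> 'v) set" where
  "colim_in K M S x v = colim_rels K M S +>\<^bsub>vs_dsum S (Ob M)\<^esub> vs_dsum_in S (Ob M) x v"

text \<open>\<open>colim_desc K M S V \<phi>\<close> is the linear map out of the colimit induced by a cocone
  \<open>\<phi> x : M(x) \<rightarrow> V\<close>; it is made unique as a HOL function by extensionality. That it exists and is
  unique is the fact \<open>colim_universal\<close> below.\<close>

definition colim_desc :: "('k, 'm) ring_scheme \<Rightarrow> ('k, 'p::order, 'v) rep \<Rightarrow> 'p set \<Rightarrow> ('k, 'w) module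
    \<Rightarrow> ('p \<Rightarrow> 'v \<Rightarrow> 'w) \<Rightarrow> ('p \<Rightarrow> 'v) set \<Rightarrow> 'w" where
  "colim_desc K M S V \<phi> = (THE g.
     g \<in> LinearCombinations.module_hom K (colim K M S) V \<and> g \<in> extensional (carrier (colim K M S)) \<and>
     (\<forall>x\<in>S. \<forall>v\<in>carrier (Ob M x). g (colim_in K M S x v) = \<phi> x v))"

definition lim :: "('k, 'p::order, 'v) rep \<Rightarrow> 'p set \<Rightarrow> ('k, 'p \<Rightarrow> 'v) module" where
  "lim M S =
    \<lparr>carrier = {f \<in> (\<Pi>\<^sub>E x\<in>S. carrier (Ob M x)). \<forall>x\<in>S. \<forall>y\<in>S. x \<le> y \<longrightarrow> Tr M x y (f x) = f y},
     mult = undefined, one = undefined,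
     zero = (\<lambda>x\<in>S. \<zero>\<^bsub>Ob M x\<^esub>),
     add = (\<lambda>f g. \<lambda>x\<in>S. f x \<oplus>\<^bsub>Ob M x\<^esub> g x),
     smult = (\<lambda>c f. \<lambda>x\<in>S. c \<odot>\<^bsub>Ob M x\<^esub> f x)\<rparr>"

definition lim_out :: "'p \<Rightarrow> ('p \<Rightarrow> 'v) \<Rightarrow> 'v" where
  "lim_out y f = f y"

definition lim_desc :: "'p set \<Rightarrow> ('p \<Rightarrow> 'u \<Rightarrow> 'v) \<Rightarrow> 'u \<Rightarrow> ('p \<Rightarrow> 'v)" where
  "lim_desc S \<psi> u = (\<lambda>y\<in>S. \<psi> y u)"

section \<open>The universal property of the colimit\<close>

lemma vs_dsum_vectorspace:
  assumes K: "field K" and V: "\<And>x. x \<in> S \<Longrightarrow> vectorspace K (V x)"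
  shows "vectorspace K (vs_dsum S V)"
proof -
  have ag: "abelian_group (V x)" and md: "Module.module K (V x)" if "x \<in> S" for x
    using V[OF that] unfolding vectorspace_def Module.module_def by auto
  note amon = abelian_group.axioms(1)[OF ag]
  have nz: "\<ominus>\<^bsub>V x\<^esub> \<zero>\<^bsub>V x\<^esub> = \<zero>\<^bsub>V x\<^esub>" if "x \<in> S" for x
    using abelian_group.minus_equality[OF ag[OF that]] abelian_monoid.l_zero[OF amon[OF that]]
      abelian_monoid.zero_closed[OF amon[OF that]] by blast
  have fin: "finite {x \<in> S. h x \<noteq> \<zero>\<^bsub>V x\<^esub>}"
    if "finite A" "\<And>x. x \<in> S \<Longrightarrow> x \<notin> A \<Longrightarrow> h x = \<zero>\<^bsub>V x\<^esub>" for h A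
    by (rule finite_subset[OF _ that(1)]) (use that(2) in auto)
  have "abelian_group (vs_dsum S V)"
  proof (rule abelian_groupI)
    fix f g assume f: "f \<in> carrier (vs_dsum S V)" and g: "g \<in> carrier (vs_dsum S V)"
    have "finite {x \<in> S. (f \<oplus>\<^bsub>vs_dsum S V\<^esub> g) x \<noteq> \<zero>\<^bsub>V x\<^esub>}"
      by (rule fin[of "{x \<in> S. f x \<noteq> \<zero>\<^bsub>V x\<^esub>} \<union> {x \<in> S. g x \<noteq> \<zero>\<^bsub>V x\<^esub>}"])
        (use f g in \<open>auto simp: vs_dsum_def abelian_monoid.l_zero[OF amon] abelian_monoid.zero_closed[OF amon]\<close>)
    then show "f \<oplus>\<^bsub>vs_dsum S V\<^esub> g \<in> carrier (vs_dsum S V)"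
      using f g by (auto simp: vs_dsum_def PiE_iff abelian_monoid.a_closed[OF amon])
    show "f \<oplus>\<^bsub>vs_dsum S V\<^esub> g = g \<oplus>\<^bsub>vs_dsum S V\<^esub> f"
      using f g by (auto simp: vs_dsum_def PiE_iff abelian_monoid.a_comm[OF amon] intro!: restrict_ext)
  next
    show "\<zero>\<^bsub>vs_dsum S V\<^esub> \<in> carrier (vs_dsum S V)"
      by (auto simp: vs_dsum_def abelian_monoid.zero_closed[OF amon])
  next
    fix f g h assume "f \<in> carrier (vs_dsum S V)" "g \<in> carrier (vs_dsum S V)" "h \<in> carrier (vs_dsum S V)"
    then show "f \<oplus>\<^bsub>vs_dsum S V\<^esub> g \<oplus>\<^bsub>vs_dsum S V\<^esub> h = f \<oplus>\<^bsub>vs_dsum S V\<^esub> (g \<oplus>\<^bsub>vs_dsum S V\<^esub> h)"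
      by (auto simp: vs_dsum_def PiE_iff abelian_monoid.a_assoc[OF amon] intro!: restrict_ext)
  next
    fix f assume f: "f \<in> carrier (vs_dsum S V)"
    then show "\<zero>\<^bsub>vs_dsum S V\<^esub> \<oplus>\<^bsub>vs_dsum S V\<^esub> f = f"
      by (auto simp: vs_dsum_def PiE_iff abelian_monoid.l_zero[OF amon] extensional_def)
    let ?n = "\<lambda>x\<in>S. \<ominus>\<^bsub>V x\<^esub> f x"
    have "finite {x \<in> S. ?n x \<noteq> \<zero>\<^bsub>V x\<^esub>}"
      by (rule fin[of "{x \<in> S. f x \<noteq> \<zero>\<^bsub>V x\<^esub>}"]) (use f nz in \<open>auto simp: vs_dsum_def\<close>)
    then have "?n \<in> carrier (vs_dsum S V)"
      using f by (auto simp: vs_dsum_def PiE_iff abelian_group.a_inv_closed[OF ag])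
    moreover have "?n \<oplus>\<^bsub>vs_dsum S V\<^esub> f = \<zero>\<^bsub>vs_dsum S V\<^esub>"
      using f by (auto simp: vs_dsum_def PiE_iff abelian_group.l_neg[OF ag] intro!: restrict_ext)
    ultimately show "\<exists>g\<in>carrier (vs_dsum S V). g \<oplus>\<^bsub>vs_dsum S V\<^esub> f = \<zero>\<^bsub>vs_dsum S V\<^esub>" by blast
  qed
  moreover have cr: "cring K" using K by (simp add: field_def domain_def)
  ultimately have "Module.module K (vs_dsum S V)"
  proof (intro Module.moduleI, goal_cases)
    case (3 c f)
    have "finite {x \<in> S. (c \<odot>\<^bsub>vs_dsum S V\<^esub> f) x \<noteq> \<zero>\<^bsub>V x\<^esub>}"
      by (rule fin[of "{x \<in> S. f x \<noteq> \<zero>\<^bsub>V x\<^esub>}"])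
        (use 3 in \<open>auto simp: vs_dsum_def PiE_iff Module.module.smult_r_null[OF md]\<close>)
    then show ?case using 3 by (auto simp: vs_dsum_def PiE_iff Module.module.smult_closed[OF md])
  next
    case (7 f) then show ?case
      by (auto simp: vs_dsum_def PiE_iff Module.module.smult_one[OF md] extensional_def)
  qed (auto simp: vs_dsum_def PiE_iff Module.module.smult_l_distr[OF md] Module.module.smult_r_distr[OF md]
         Module.module.smult_assoc1[OF md] intro!: restrict_ext)
  then show ?thesis using K by (simp add: vectorspace_def)
qed

lemma vs_dsum_in_hom:
  assumes V: "\<And>x. x \<in> S \<Longrightarrow> vectorspace K (V x)" and x: "x \<in> S"
  shows "vs_dsum_in S V x \<in> LinearCombinations.module_hom K (V x) (vs_dsum S V)"
proof -
  have ag: "abelian_group (V x)" and md: "Module.module K (V x)" if "x \<in> S" for x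
    using V[OF that] unfolding vectorspace_def Module.module_def by auto
  note amon = abelian_group.axioms(1)[OF ag]
  have "finite {y \<in> S. vs_dsum_in S V x v y \<noteq> \<zero>\<^bsub>V y\<^esub>}" for v
    by (rule finite_subset[of _ "{x}"]) (auto simp: vs_dsum_in_def)
  then show ?thesis
    by (auto simp: LinearCombinations.module_hom_def vs_dsum_def vs_dsum_in_def PiE_iff x
      abelian_monoid.zero_closed[OF amon] abelian_monoid.l_zero[OF amon] 
      Module.module.smult_r_null[OF md] split: if_splits intro!: restrict_ext)
qed

lemma vs_dsum_in_closed:
  assumes V: "\<And>x. x \<in> S \<Longrightarrow> vectorspace K (V x)" and "x \<in> S" "v \<in> carrier (V x)"
  shows "vs_dsum_in S V x v \<in> carrier (vs_dsum S V)"
  using vs_dsum_in_hom[of S K V x, OF V] assms by (auto simp: LinearCombinations.module_hom_def)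

context
  fixes K :: "('k, 'm) ring_scheme" and V :: "('k, 'v) module" and W
  assumes W: "VectorSpace.subspace K W V"
begin

interpretation vectorspace K V using W by (simp add: VectorSpace.subspace_def)

lemma quot_ab: "abelian_subgroup W V"
proof -
  have s: "LinearCombinations.submodule K W V" using W by (simp add: VectorSpace.subspace_def)
  have "subgroup W (add_monoid V)"
  proof
    show "W \<subseteq> carrier (add_monoid V)" using s by (auto simp: LinearCombinations.submodule_def)
  next
    fix x assume x: "x \<in> W"
    then have xc: "x \<in> carrier V" using s by (auto simp: LinearCombinations.submodule_def)
    have "\<ominus>\<^bsub>V\<^esub> x = (\<ominus>\<^bsub>K\<^esub> \<one>\<^bsub>K\<^esub>) \<odot>\<^bsub>V\<^esub> x" using smult_minus_1[OF xc] by simp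
    also have "\<dots> \<in> W" using s x by (auto simp: LinearCombinations.submodule_def)
    finally show "inv\<^bsub>add_monoid V\<^esub> x \<in> W" by (simp add: a_inv_def)
  qed (use s in \<open>auto simp: LinearCombinations.submodule_def\<close>)
  then show ?thesis
    by (intro abelian_subgroupI3 M.abelian_group_axioms) (simp add: additive_subgroup_def)
qed

interpretation Q: abelian_subgroup W V by (rule quot_ab)

lemma quot_add:
  "x \<in> carrier V \<Longrightarrow> y \<in> carrier V \<Longrightarrow> (W +>\<^bsub>V\<^esub> x) \<oplus>\<^bsub>quot V W\<^esub> (W +>\<^bsub>V\<^esub> y) = W +>\<^bsub>V\<^esub> (x \<oplus>\<^bsub>V\<^esub> y)"
  by (simp add: quot_def Q.a_rcos_sum)

lemma quot_carrier: "carrier (quot V W) = (\<lambda>x. W +>\<^bsub>V\<^esub> x) ` carrier V"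
  by (auto simp: quot_def A_RCOSETS_def')

lemma quot_zero: "\<zero>\<^bsub>quot V W\<^esub> = W" by (simp add: quot_def)

lemma quot_eq_iff:
  assumes "x \<in> carrier V" "y \<in> carrier V"
  shows "W +>\<^bsub>V\<^esub> x = W +>\<^bsub>V\<^esub> y \<longleftrightarrow> x \<ominus>\<^bsub>V\<^esub> y \<in> W"
proof -
  have "W +>\<^bsub>V\<^esub> x = W +>\<^bsub>V\<^esub> y \<longleftrightarrow> x \<in> W +>\<^bsub>V\<^esub> y"
    using assms Q.a_rcos_self M.a_repr_independence[OF _ _ Q.a_subgroup] by metis
  then show ?thesis using Q.a_rcos_module[OF assms(2,1)] by (simp add: a_minus_def)
qed

lemma quot_smult:
  assumes c: "c \<in> carrier K" and x: "x \<in> carrier V"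
  shows "c \<odot>\<^bsub>quot V W\<^esub> (W +>\<^bsub>V\<^esub> x) = W +>\<^bsub>V\<^esub> (c \<odot>\<^bsub>V\<^esub> x)"
proof -
  have s: "LinearCombinations.submodule K W V" using W by (simp add: VectorSpace.subspace_def)
  have sub: "W \<subseteq> carrier V" using s by (auto simp: LinearCombinations.submodule_def)
  have "W +>\<^bsub>V\<^esub> (c \<odot>\<^bsub>V\<^esub> y) = W +>\<^bsub>V\<^esub> (c \<odot>\<^bsub>V\<^esub> x)" if y: "y \<in> W +>\<^bsub>V\<^esub> x" for y
  proof -
    obtain w where w: "w \<in> W" "y = w \<oplus>\<^bsub>V\<^esub> x" using y by (auto simp: a_r_coset_def')
    have wc: "w \<in> carrier V" using w sub by auto
    have "c \<odot>\<^bsub>V\<^esub> y \<ominus>\<^bsub>V\<^esub> c \<odot>\<^bsub>V\<^esub> x = c \<odot>\<^bsub>V\<^esub> w"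
      using c x wc w(2) by (simp add: smult_r_distr M.minus_eq M.a_assoc M.r_neg)
    also have "\<dots> \<in> W" using s c w by (auto simp: LinearCombinations.submodule_def)
    finally show ?thesis using c x wc w(2) by (subst quot_eq_iff) auto
  qed
  moreover have "x \<in> W +>\<^bsub>V\<^esub> x" using x by (rule Q.a_rcos_self)
  ultimately have "(\<Union>y\<in>W +>\<^bsub>V\<^esub> x. W +>\<^bsub>V\<^esub> (c \<odot>\<^bsub>V\<^esub> y)) = W +>\<^bsub>V\<^esub> (c \<odot>\<^bsub>V\<^esub> x)"
    by blast
  then show ?thesis by (simp add: quot_def)
qed

lemma quot_vectorspace: "vectorspace K (quot V W)"
proof -
  have W0: "W = W +>\<^bsub>V\<^esub> \<zero>\<^bsub>V\<^esub>"
    using Q.a_rcos_const[OF Q.zero_closed] by simp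
  have "abelian_group (quot V W)"
  proof (rule abelian_groupI)
    fix X assume "X \<in> carrier (quot V W)"
    then obtain x where x: "x \<in> carrier V" "X = W +>\<^bsub>V\<^esub> x" by (auto simp: quot_carrier)
    then show "\<zero>\<^bsub>quot V W\<^esub> \<oplus>\<^bsub>quot V W\<^esub> X = X"
      using quot_add[OF M.zero_closed x(1)] by (simp add: quot_zero flip: W0)
    have "(W +>\<^bsub>V\<^esub> \<ominus>\<^bsub>V\<^esub> x) \<oplus>\<^bsub>quot V W\<^esub> X = \<zero>\<^bsub>quot V W\<^esub>"
      using x by (simp add: quot_add quot_zero M.l_neg flip: W0)
    then show "\<exists>Y\<in>carrier (quot V W). Y \<oplus>\<^bsub>quot V W\<^esub> X = \<zero>\<^bsub>quot V W\<^esub>"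
      using x by (auto simp: quot_carrier)
  qed (use W0 in \<open>auto simp: quot_carrier quot_add quot_zero M.a_assoc\<close>, (metis M.a_comm)+)
  then have "Module.module K (quot V W)"
    by (intro Module.moduleI R.is_cring)
      (auto simp: quot_carrier quot_smult quot_add smult_l_distr smult_r_distr smult_assoc1)
  then show ?thesis using field_axioms by (simp add: vectorspace_def)
qed

end

lemma quot_proj_hom:
  assumes "VectorSpace.subspace K W V"
  shows "(\<lambda>x. W +>\<^bsub>V\<^esub> x) \<in> LinearCombinations.module_hom K V (quot V W)"
  using assms by (auto simp: LinearCombinations.module_hom_def quot_carrier quot_add quot_smult)

lemma vs_dsum_hom_ext:
  assumes K: "field K" and V: "\<And>x. x \<in> S \<Longrightarrow> vectorspace K (V x)"
    and g: "g \<in> LinearCombinations.module_hom K (vs_dsum S V) U"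
    and h: "h \<in> LinearCombinations.module_hom K (vs_dsum S V) U"
    and eq: "\<And>x v. x \<in> S \<Longrightarrow> v \<in> carrier (V x) \<Longrightarrow> g (vs_dsum_in S V x v) = h (vs_dsum_in S V x v)"
    and U: "vectorspace K U"
    and f: "f \<in> carrier (vs_dsum S V)"
  shows "g f = h f"
proof -
  interpret D: vectorspace K "vs_dsum S V" by (rule vs_dsum_vectorspace[OF K V])
  have lm: "mod_hom K (vs_dsum S V) U g" "mod_hom K (vs_dsum S V) U h"
    using g h U D.module_axioms unfolding vectorspace_def mod_hom_def mod_hom_axioms_def by auto
  have ag: "abelian_group (V x)" if "x \<in> S" for x
    using V[OF that] unfolding vectorspace_def Module.module_def by auto
  note amon = abelian_group.axioms(1)[OF ag]
  have "finite A \<Longrightarrow> A \<subseteq> S \<Longrightarrow> f \<in> carrier (vs_dsum S V) \<Longrightarrow> {x \<in> S. f x \<noteq> \<zero>\<^bsub>V x\<^esub>} = A \<Longrightarrow> g f = h f" for A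
  proof (induction A arbitrary: f rule: finite_induct)
    case empty
    then have "f = \<zero>\<^bsub>vs_dsum S V\<^esub>"
      by (auto simp: vs_dsum_def PiE_iff extensional_def)
    then show ?case using mod_hom.f0_is_0[OF lm(1)] mod_hom.f0_is_0[OF lm(2)] by simp
  next
    case (insert x A)
    define f' where "f' = (\<lambda>y\<in>S. if y = x then \<zero>\<^bsub>V y\<^esub> else f y)"
    have x: "x \<in> S" and fx: "f x \<in> carrier (V x)" using insert.prems by (auto simp: vs_dsum_def PiE_iff)
    have "{y \<in> S. f' y \<noteq> \<zero>\<^bsub>V y\<^esub>} = A"
      using insert.prems insert.hyps by (auto simp: f'_def split: if_splits)
    moreover from this have f': "f' \<in> carrier (vs_dsum S V)"
      using insert.prems insert.hyps
      by (auto simp: vs_dsum_def PiE_iff f'_def abelian_monoid.zero_closed[OF amon])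
    ultimately have IH: "g f' = h f'" using insert by simp
    have inc: "vs_dsum_in S V x (f x) \<in> carrier (vs_dsum S V)"
      using V x fx by (rule vs_dsum_in_closed)
    have "f = vs_dsum_in S V x (f x) \<oplus>\<^bsub>vs_dsum S V\<^esub> f'"
      using insert.prems by (auto simp: vs_dsum_def PiE_iff f'_def vs_dsum_in_def extensional_def
          abelian_monoid.l_zero[OF amon] abelian_monoid.r_zero[OF amon])
    then show ?case
      using IH eq[OF x fx] LinearCombinations.module_hom_add[OF g inc f'] LinearCombinations.module_hom_add[OF h inc f'] by simp
  qed
  then show ?thesis using f by (auto simp: vs_dsum_def)
qed

lemma vs_dsum_hom_ex:
  assumes K: "field K" and V: "\<And>x. x \<in> S \<Longrightarrow> vectorspace K (V x)" and U: "vectorspace K U"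
    and \<phi>: "\<And>x. x \<in> S \<Longrightarrow> \<phi> x \<in> LinearCombinations.module_hom K (V x) U"
  shows "\<exists>g\<in>LinearCombinations.module_hom K (vs_dsum S V) U.
           \<forall>x\<in>S. \<forall>v\<in>carrier (V x). g (vs_dsum_in S V x v) = \<phi> x v"
proof -
  interpret U: vectorspace K U by (rule U)
  interpret D: vectorspace K "vs_dsum S V" by (rule vs_dsum_vectorspace[OF K V])
  have md: "Module.module K (V x)" if "x \<in> S" for x
    using V[OF that] unfolding vectorspace_def by auto
  have mh: "mod_hom K (V x) U (\<phi> x)" if "x \<in> S" for x
    using \<phi>[OF that] md[OF that] U.module_axioms by (simp add: mod_hom_def mod_hom_axioms_def)
  define g where "g f = finsum U (\<lambda>x. \<phi> x (f x)) {x \<in> S. f x \<noteq> \<zero>\<^bsub>V x\<^esub>}" for f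
  have c: "\<phi> x (f x) \<in> carrier U" if "x \<in> S" "f \<in> carrier (vs_dsum S V)" for x f
    using that mod_hom.f_im[OF mh] by (auto simp: vs_dsum_def PiE_iff)
  have g: "g f = finsum U (\<lambda>x. \<phi> x (f x)) A"
    if "finite A" "A \<subseteq> S" "{x \<in> S. f x \<noteq> \<zero>\<^bsub>V x\<^esub>} \<subseteq> A" "f \<in> carrier (vs_dsum S V)" for f A
    unfolding g_def
  proof (rule U.add.finprod_mono_neutral_cong_left[OF that(1,3)])
    show "(\<lambda>x. \<phi> x (f x)) \<in> A \<rightarrow> carrier U" by (intro Pi_I c[OF _ that(4)]) (use that(2) in blast)
  qed (use that(2) mod_hom.f0_is_0[OF mh] in auto)
  have "g \<in> LinearCombinations.module_hom K (vs_dsum S V) U"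
    unfolding LinearCombinations.module_hom_def
  proof (intro CollectI conjI allI impI Pi_I; (elim conjE)?)
    fix f assume "f \<in> carrier (vs_dsum S V)"
    then show "g f \<in> carrier U" unfolding g_def by (intro U.finsum_closed Pi_I c) auto
  next
    fix f h assume f: "f \<in> carrier (vs_dsum S V)" and h: "h \<in> carrier (vs_dsum S V)"
    let ?A = "{x \<in> S. f x \<noteq> \<zero>\<^bsub>V x\<^esub>} \<union> {x \<in> S. h x \<noteq> \<zero>\<^bsub>V x\<^esub>} \<union> {x \<in> S. (f \<oplus>\<^bsub>vs_dsum S V\<^esub> h) x \<noteq> \<zero>\<^bsub>V x\<^esub>}"
    have fh: "f \<oplus>\<^bsub>vs_dsum S V\<^esub> h \<in> carrier (vs_dsum S V)" using f h by simp
    have cf: "\<And>x. x \<in> S \<Longrightarrow> \<phi> x (f x) \<in> carrier U" by (rule c[OF _ f])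
    have ch: "\<And>x. x \<in> S \<Longrightarrow> \<phi> x (h x) \<in> carrier U" by (rule c[OF _ h])
    have fin: "finite ?A" using f h fh unfolding vs_dsum_def by (simp del: restrict_apply)
    have "finsum U (\<lambda>x. \<phi> x ((f \<oplus>\<^bsub>vs_dsum S V\<^esub> h) x)) ?A = finsum U (\<lambda>x. \<phi> x (f x) \<oplus>\<^bsub>U\<^esub> \<phi> x (h x)) ?A"
    proof (rule U.finsum_cong')
      fix x assume "x \<in> ?A"
      then have x: "x \<in> S" by auto
      then have "f x \<in> carrier (V x)" "h x \<in> carrier (V x)" using f h by (auto simp: vs_dsum_def PiE_iff)
      then show "\<phi> x ((f \<oplus>\<^bsub>vs_dsum S V\<^esub> h) x) = \<phi> x (f x) \<oplus>\<^bsub>U\<^esub> \<phi> x (h x)"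
        using x LinearCombinations.module_hom_add[OF \<phi>[OF x]] by (simp add: vs_dsum_def)
    qed (auto simp: cf ch)
    also have "\<dots> = finsum U (\<lambda>x. \<phi> x (f x)) ?A \<oplus>\<^bsub>U\<^esub> finsum U (\<lambda>x. \<phi> x (h x)) ?A"
      by (rule U.finsum_addf) (auto simp: cf ch)
    finally have "finsum U (\<lambda>x. \<phi> x ((f \<oplus>\<^bsub>vs_dsum S V\<^esub> h) x)) ?A =
        finsum U (\<lambda>x. \<phi> x (f x)) ?A \<oplus>\<^bsub>U\<^esub> finsum U (\<lambda>x. \<phi> x (h x)) ?A" .
    moreover have "g (f \<oplus>\<^bsub>vs_dsum S V\<^esub> h) = finsum U (\<lambda>x. \<phi> x ((f \<oplus>\<^bsub>vs_dsum S V\<^esub> h) x)) ?A"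
      by (rule g[OF fin _ _ fh]) blast+
    moreover have "g f = finsum U (\<lambda>x. \<phi> x (f x)) ?A" by (rule g[OF fin _ _ f]) blast+
    moreover have "g h = finsum U (\<lambda>x. \<phi> x (h x)) ?A" by (rule g[OF fin _ _ h]) blast+
    ultimately show "g (f \<oplus>\<^bsub>vs_dsum S V\<^esub> h) = g f \<oplus>\<^bsub>U\<^esub> g h"
      by (simp only:)
  next
    fix r f assume r: "r \<in> carrier K" and f: "f \<in> carrier (vs_dsum S V)"
    let ?A = "{x \<in> S. f x \<noteq> \<zero>\<^bsub>V x\<^esub>} \<union> {x \<in> S. (r \<odot>\<^bsub>vs_dsum S V\<^esub> f) x \<noteq> \<zero>\<^bsub>V x\<^esub>}"
    have rf: "r \<odot>\<^bsub>vs_dsum S V\<^esub> f \<in> carrier (vs_dsum S V)" using f r by simp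
    have cf: "\<And>x. x \<in> S \<Longrightarrow> \<phi> x (f x) \<in> carrier U" by (rule c[OF _ f])
    have fin: "finite ?A" using f rf unfolding vs_dsum_def by (simp del: restrict_apply)
    have "finsum U (\<lambda>x. \<phi> x ((r \<odot>\<^bsub>vs_dsum S V\<^esub> f) x)) ?A = finsum U (\<lambda>x. r \<odot>\<^bsub>U\<^esub> \<phi> x (f x)) ?A"
    proof (rule U.finsum_cong')
      fix x assume "x \<in> ?A"
      then have x: "x \<in> S" by auto
      then have "f x \<in> carrier (V x)" using f by (auto simp: vs_dsum_def PiE_iff)
      then show "\<phi> x ((r \<odot>\<^bsub>vs_dsum S V\<^esub> f) x) = r \<odot>\<^bsub>U\<^esub> \<phi> x (f x)"
        using x r LinearCombinations.module_hom_smult[OF \<phi>[OF x]] by (simp add: vs_dsum_def)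
    qed (auto simp: r cf)
    also have "\<dots> = r \<odot>\<^bsub>U\<^esub> finsum U (\<lambda>x. \<phi> x (f x)) ?A"
      by (rule U.finsum_smult_ldistr[OF fin r, symmetric]) (auto simp: cf)
    finally have "finsum U (\<lambda>x. \<phi> x ((r \<odot>\<^bsub>vs_dsum S V\<^esub> f) x)) ?A =
        r \<odot>\<^bsub>U\<^esub> finsum U (\<lambda>x. \<phi> x (f x)) ?A" .
    moreover have "g (r \<odot>\<^bsub>vs_dsum S V\<^esub> f) = finsum U (\<lambda>x. \<phi> x ((r \<odot>\<^bsub>vs_dsum S V\<^esub> f) x)) ?A"
      by (rule g[OF fin _ _ rf]) blast+
    moreover have "g f = finsum U (\<lambda>x. \<phi> x (f x)) ?A" by (rule g[OF fin _ _ f]) blast+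
    ultimately show "g (r \<odot>\<^bsub>vs_dsum S V\<^esub> f) = r \<odot>\<^bsub>U\<^esub> g f"
      by (simp only:)
  qed
  moreover have "g (vs_dsum_in S V x v) = \<phi> x v" if x: "x \<in> S" and v: "v \<in> carrier (V x)" for x v
  proof -
    have i: "vs_dsum_in S V x v \<in> carrier (vs_dsum S V)"
      using V x v by (rule vs_dsum_in_closed)
    have "g (vs_dsum_in S V x v) = finsum U (\<lambda>y. \<phi> y (vs_dsum_in S V x v y)) {x}"
      using x i by (intro g) (auto simp: vs_dsum_in_def)
    also have "\<dots> = \<phi> x v" using x v mod_hom.f_im[OF mh[OF x]] by (simp add: vs_dsum_in_def)
    finally show ?thesis .
  qed
  ultimately show ?thesis by (intro bexI[of _ g]) auto
qed

lemma Tr_closed: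
  assumes "M \<in> Rep K" "a \<le> b" "v \<in> carrier (Ob M a)"
  shows "Tr M a b v \<in> carrier (Ob M b)"
proof -
  have "Tr M a b \<in> LinearCombinations.module_hom K (Ob M a) (Ob M b)"
    using assms(1,2) by (simp add: Rep_def)
  then show ?thesis using LinearCombinations.module_hom_closed assms(3) by blast
qed

lemma colim_rels_subspace:
  assumes K: "field K" and M: "M \<in> Rep K"
  shows "VectorSpace.subspace K (colim_rels K M S) (vs_dsum S (Ob M))"
proof -
  have V: "vectorspace K (Ob M x)" for x using M by (simp add: Rep_def)
  interpret D: vectorspace K "vs_dsum S (Ob M)" by (rule vs_dsum_vectorspace[OF K V])
  have "vs_dsum_in S (Ob M) x v \<in> carrier (vs_dsum S (Ob M))" if "x \<in> S" "v \<in> carrier (Ob M x)" for x v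
    using V that by (rule vs_dsum_in_closed)
  moreover have "Tr M x y v \<in> carrier (Ob M y)" if "x \<le> y" "v \<in> carrier (Ob M x)" for x y v
    using M that by (rule Tr_closed)
  ultimately show ?thesis
    unfolding VectorSpace.subspace_def colim_rels_def
    by (intro conjI D.span_is_submodule D.vectorspace_axioms) auto
qed

lemma colim_vectorspace:
  assumes "field K" and "M \<in> Rep K"
  shows "vectorspace K (colim K M S)"
  unfolding colim_def by (rule quot_vectorspace[OF colim_rels_subspace[OF assms]])

lemma colim_in_hom:
  assumes K: "field K" and M: "M \<in> Rep K" and x: "x \<in> S"
  shows "colim_in K M S x \<in> LinearCombinations.module_hom K (Ob M x) (colim K M S)"
proof -
  have V: "vectorspace K (Ob M x)" for x using M by (simp add: Rep_def)
  show ?thesis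
    using vs_dsum_in_hom[where K = K and V = "Ob M", OF V x] quot_proj_hom[OF colim_rels_subspace[OF K M, of S]]
    unfolding LinearCombinations.module_hom_def colim_in_def colim_def by (auto simp: Pi_iff)
qed

lemma colim_in_cocone:
  assumes K: "field K" and M: "M \<in> Rep K"
    and xy: "x \<in> S" "y \<in> S" "x \<le> y" and v: "v \<in> carrier (Ob M x)"
  shows "colim_in K M S y (Tr M x y v) = colim_in K M S x v"
proof -
  have V: "vectorspace K (Ob M x)" for x using M by (simp add: Rep_def)
  interpret D: vectorspace K "vs_dsum S (Ob M)" by (rule vs_dsum_vectorspace[OF K V])
  have i: "vs_dsum_in S (Ob M) x v \<in> carrier (vs_dsum S (Ob M))" if "x \<in> S" "v \<in> carrier (Ob M x)" for x v
    using V that by (rule vs_dsum_in_closed)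
  have t: "Tr M x y v \<in> carrier (Ob M y)" if "x \<le> y" "v \<in> carrier (Ob M x)" for x y v
    using M that by (rule Tr_closed)
  have "vs_dsum_in S (Ob M) x v \<ominus>\<^bsub>vs_dsum S (Ob M)\<^esub> vs_dsum_in S (Ob M) y (Tr M x y v) \<in> colim_rels K M S"
    unfolding colim_rels_def
    by (rule subsetD[OF D.in_own_span]) (use i t xy v in auto)
  then show ?thesis
    unfolding colim_in_def
    using quot_eq_iff[OF colim_rels_subspace[OF K M] i[OF xy(1) v] i[OF xy(2) t[OF xy(3) v]]] by simp
qed

lemma colim_universal:
  assumes K: "field K" and M: "M \<in> Rep K" and U: "vectorspace K U"
    and \<phi>: "\<And>x. x \<in> S \<Longrightarrow> \<phi> x \<in> LinearCombinations.module_hom K (Ob M x) U"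
    and cocone: "\<And>x y v. x \<in> S \<Longrightarrow> y \<in> S \<Longrightarrow> x \<le> y \<Longrightarrow> v \<in> carrier (Ob M x) \<Longrightarrow> \<phi> y (Tr M x y v) = \<phi> x v"
  shows "\<exists>!g. g \<in> LinearCombinations.module_hom K (colim K M S) U \<and> g \<in> extensional (carrier (colim K M S)) \<and>
     (\<forall>x\<in>S. \<forall>v\<in>carrier (Ob M x). g (colim_in K M S x v) = \<phi> x v)"
proof -
  let ?D = "vs_dsum S (Ob M)" and ?R = "colim_rels K M S" and ?C = "colim K M S"
  have V: "vectorspace K (Ob M x)" for x using M by (simp add: Rep_def)
  interpret D: vectorspace K ?D by (rule vs_dsum_vectorspace[OF K V])
  interpret U: vectorspace K U by (rule U)
  note sub = colim_rels_subspace[OF K M, of S]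
  have i: "vs_dsum_in S (Ob M) x v \<in> carrier ?D" if "x \<in> S" "v \<in> carrier (Ob M x)" for x v
    using V that by (rule vs_dsum_in_closed)
  have t: "Tr M x y v \<in> carrier (Ob M y)" if "x \<le> y" "v \<in> carrier (Ob M x)" for x y v
    using M that by (rule Tr_closed)
  have carr: "carrier ?C = (\<lambda>f. ?R +>\<^bsub>?D\<^esub> f) ` carrier ?D"
    unfolding colim_def by (rule quot_carrier[OF sub])
  obtain h where h: "h \<in> LinearCombinations.module_hom K ?D U"
    and hi': "\<forall>x\<in>S. \<forall>v\<in>carrier (Ob M x). h (vs_dsum_in S (Ob M) x v) = \<phi> x v"
    using vs_dsum_hom_ex[where V = "Ob M" and \<phi> = \<phi> and S = S, OF K V U \<phi>] by (rule bexE)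
  have hi: "h (vs_dsum_in S (Ob M) x v) = \<phi> x v" if "x \<in> S" "v \<in> carrier (Ob M x)" for x v
    using hi' that by simp
  interpret h: mod_hom K ?D U h
    using h by (simp add: mod_hom_def mod_hom_axioms_def D.module_axioms U.module_axioms)
  have hminus: "h (f \<ominus>\<^bsub>?D\<^esub> f') = h f \<ominus>\<^bsub>U\<^esub> h f'" if "f \<in> carrier ?D" "f' \<in> carrier ?D" for f f'
  proof -
    have "h (\<ominus>\<^bsub>?D\<^esub> f') = \<ominus>\<^bsub>U\<^esub> h f'"
      using that D.smult_minus_1[OF that(2)] U.smult_minus_1[OF h.f_im[OF that(2)]]
        LinearCombinations.module_hom_smult[OF h _ that(2), of "\<ominus>\<^bsub>K\<^esub> \<one>\<^bsub>K\<^esub>"] by simp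
    then show ?thesis using that by (simp add: D.M.minus_eq U.M.minus_eq)
  qed
  have "?R \<subseteq> h.ker"
    unfolding colim_rels_def
  proof (rule D.span_is_subset[OF _ h.ker_is_submodule], safe)
    fix x y v assume xy: "x \<in> S" "y \<in> S" "x \<le> y" and v: "v \<in> carrier (Ob M x)"
    have "\<phi> x v \<in> carrier U" using LinearCombinations.module_hom_closed[OF \<phi>[OF xy(1)]] v by blast
    then show "vs_dsum_in S (Ob M) x v \<ominus>\<^bsub>?D\<^esub> vs_dsum_in S (Ob M) y (Tr M x y v) \<in> h.ker"
      using xy v i[OF xy(1) v] i[OF xy(2) t[OF xy(3) v]] t[OF xy(3) v]
      by (simp add: h.ker_def hminus hi cocone)
  qed
  then have hR: "h f = h f'" if "f \<in> carrier ?D" "f' \<in> carrier ?D" "?R +>\<^bsub>?D\<^esub> f = ?R +>\<^bsub>?D\<^esub> f'" for f f'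
    using that quot_eq_iff[OF sub that(1,2)] hminus[OF that(1,2)] by (auto simp: h.ker_def)
  define g where "g = restrict (\<lambda>X. h (SOME f. f \<in> carrier ?D \<and> ?R +>\<^bsub>?D\<^esub> f = X)) (carrier ?C)"
  have g: "g (?R +>\<^bsub>?D\<^esub> f) = h f" if f: "f \<in> carrier ?D" for f
  proof -
    let ?f = "SOME f'. f' \<in> carrier ?D \<and> ?R +>\<^bsub>?D\<^esub> f' = ?R +>\<^bsub>?D\<^esub> f"
    have "?f \<in> carrier ?D \<and> ?R +>\<^bsub>?D\<^esub> ?f = ?R +>\<^bsub>?D\<^esub> f" by (rule someI[of _ f]) (use f in simp)
    then show ?thesis using f hR[of ?f f] by (auto simp: g_def carr)
  qed
  have add: "(?R +>\<^bsub>?D\<^esub> f) \<oplus>\<^bsub>?C\<^esub> (?R +>\<^bsub>?D\<^esub> f') = ?R +>\<^bsub>?D\<^esub> (f \<oplus>\<^bsub>?D\<^esub> f')"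
    if "f \<in> carrier ?D" "f' \<in> carrier ?D" for f f'
    unfolding colim_def by (rule quot_add[OF sub that])
  have smul: "c \<odot>\<^bsub>?C\<^esub> (?R +>\<^bsub>?D\<^esub> f) = ?R +>\<^bsub>?D\<^esub> (c \<odot>\<^bsub>?D\<^esub> f)"
    if "c \<in> carrier K" "f \<in> carrier ?D" for c f
    unfolding colim_def by (rule quot_smult[OF sub that])
  have "g \<in> LinearCombinations.module_hom K ?C U"
    unfolding LinearCombinations.module_hom_def by (auto simp: carr g add smul)
  moreover have "g \<in> extensional (carrier ?C)" by (simp add: g_def)
  moreover have "g (colim_in K M S x v) = \<phi> x v" if "x \<in> S" "v \<in> carrier (Ob M x)" for x v
    using that i by (simp add: colim_in_def g hi)
  moreover have "g1 = g2"
    if g1: "g1 \<in> LinearCombinations.module_hom K ?C U" "g1 \<in> extensional (carrier ?C)"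
        "\<forall>x\<in>S. \<forall>v\<in>carrier (Ob M x). g1 (colim_in K M S x v) = \<phi> x v"
      and g2: "g2 \<in> LinearCombinations.module_hom K ?C U" "g2 \<in> extensional (carrier ?C)"
        "\<forall>x\<in>S. \<forall>v\<in>carrier (Ob M x). g2 (colim_in K M S x v) = \<phi> x v" for g1 g2
  proof (rule extensionalityI[OF g1(2) g2(2)])
    have comp: "(\<lambda>f. g' (?R +>\<^bsub>?D\<^esub> f)) \<in> LinearCombinations.module_hom K ?D U"
      if "g' \<in> LinearCombinations.module_hom K ?C U" for g'
    proof -
      have c: "?R +>\<^bsub>?D\<^esub> f \<in> carrier ?C" if "f \<in> carrier ?D" for f using that by (auto simp: carr)
      show ?thesis
        unfolding LinearCombinations.module_hom_def
        using LinearCombinations.module_hom_add[OF that c c] LinearCombinations.module_hom_smult[OF that _ c]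
          LinearCombinations.module_hom_closed[OF that] c
        by (simp add: add smul Pi_iff)
    qed
    fix X assume "X \<in> carrier ?C"
    then obtain f where f: "f \<in> carrier ?D" "X = ?R +>\<^bsub>?D\<^esub> f" by (auto simp: carr)
    have "(\<lambda>f. g1 (?R +>\<^bsub>?D\<^esub> f)) f = (\<lambda>f. g2 (?R +>\<^bsub>?D\<^esub> f)) f"
      by (rule vs_dsum_hom_ext[where V = "Ob M", OF K V comp[OF g1(1)] comp[OF g2(1)] _ U f(1)])
        (use g1(3) g2(3) in \<open>auto simp: colim_in_def\<close>)
    then show "g1 X = g2 X" by (simp add: f(2))
  qed
  ultimately show ?thesis by blast
qed

section \<open>Height differences and interleavings\<close>

text \<open>Only the values \<open>\<rho> a b\<close> with \<open>a \<le> b\<close> are meaningful; no definition below uses others.\<close>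

definition height_difference :: "('p::order \<Rightarrow> 'p \<Rightarrow> ennreal) \<Rightarrow> bool" where
  "height_difference \<rho> \<longleftrightarrow>
     (\<forall>a. \<rho> a a = 0) \<and> (\<forall>a b c. a \<le> b \<longrightarrow> b \<le> c \<longrightarrow> \<rho> a c \<ge> \<rho> a b + \<rho> b c)"

definition down :: "('p::order \<Rightarrow> 'p \<Rightarrow> ennreal) \<Rightarrow> real \<Rightarrow> 'p \<Rightarrow> 'p set" where
  "down \<rho> r a = {x. x \<le> a \<and> \<rho> x a \<ge> ennreal r}"

definition up :: "('p::order \<Rightarrow> 'p \<Rightarrow> ennreal) \<Rightarrow> real \<Rightarrow> 'p \<Rightarrow> 'p set" where
  "up \<rho> r a = {x. a \<le> x \<and> \<rho> a x \<ge> ennreal r}"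

definition Lfun :: "('k, 'm) ring_scheme \<Rightarrow> ('p::order \<Rightarrow> 'p \<Rightarrow> ennreal) \<Rightarrow> real
    \<Rightarrow> ('k, 'p, 'v) rep \<Rightarrow> ('k, 'p, ('p \<Rightarrow> 'v) set) rep" where
  "Lfun K \<rho> r M =
    \<lparr>Ob = (\<lambda>a. colim K M (down \<rho> r a)),
     Tr = (\<lambda>a b. colim_desc K M (down \<rho> r a) (colim K M (down \<rho> r b)) (colim_in K M (down \<rho> r b)))\<rparr>"

definition Rfun :: "('p::order \<Rightarrow> 'p \<Rightarrow> ennreal) \<Rightarrow> real
    \<Rightarrow> ('k, 'p, 'v) rep \<Rightarrow> ('k, 'p, 'p \<Rightarrow> 'v) rep" where
  "Rfun \<rho> r M =
    \<lparr>Ob = (\<lambda>a. lim M (up \<rho> r a)),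
     Tr = (\<lambda>a b. lim_desc (up \<rho> r b) lim_out)\<rparr>"

definition etaL :: "('k, 'm) ring_scheme \<Rightarrow> ('p::order \<Rightarrow> 'p \<Rightarrow> ennreal) \<Rightarrow> real
    \<Rightarrow> ('k, 'p, 'v) rep \<Rightarrow> 'p \<Rightarrow> ('p \<Rightarrow> 'v) set \<Rightarrow> 'v" where
  "etaL K \<rho> r M a = colim_desc K M (down \<rho> r a) (Ob M a) (\<lambda>x. Tr M x a)"

definition etaR :: "('p::order \<Rightarrow> 'p \<Rightarrow> ennreal) \<Rightarrow> real
    \<Rightarrow> ('k, 'p, 'v) rep \<Rightarrow> 'p \<Rightarrow> 'v \<Rightarrow> ('p \<Rightarrow> 'v)" where
  "etaR \<rho> r M a = lim_desc (up \<rho> r a) (\<lambda>y. Tr M a y)"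

definition emap :: "('k, 'm) ring_scheme \<Rightarrow> ('p::order \<Rightarrow> 'p \<Rightarrow> ennreal) \<Rightarrow> real
    \<Rightarrow> ('k, 'p, 'v) rep \<Rightarrow> 'p \<Rightarrow> ('p \<Rightarrow> 'v) set \<Rightarrow> ('p \<Rightarrow> 'v)" where
  "emap K \<rho> r M = rep_comp (etaR \<rho> r M) (etaL K \<rho> r M)"

text \<open>The adjoint \<open>p\<^sup>\<sharp> : L\<^sub>r M \<rightarrow> N\<close> of \<open>p : M \<rightarrow> R\<^sub>r N\<close>; at \<open>a\<close> it is the unique linear map whose
  composite with \<open>\<alpha>\<close> at \<open>x\<close> is \<open>\<beta> \<circ> p x\<close>, where \<open>\<beta>\<close> is evaluation at \<open>a\<close>.\<close>

definition sharp :: "('k, 'm) ring_scheme \<Rightarrow> ('p::order \<Rightarrow> 'p \<Rightarrow> ennreal) \<Rightarrow> real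
    \<Rightarrow> ('k, 'p, 'v) rep \<Rightarrow> ('k, 'p, 'w) rep \<Rightarrow> ('p \<Rightarrow> 'v \<Rightarrow> ('p \<Rightarrow> 'w))
    \<Rightarrow> 'p \<Rightarrow> ('p \<Rightarrow> 'v) set \<Rightarrow> 'w" where
  "sharp K \<rho> r M N p a = colim_desc K M (down \<rho> r a) (Ob N a) (\<lambda>x. lim_out a \<circ> p x)"

definition height_interleaved :: "('k, 'm) ring_scheme \<Rightarrow> ('p::order \<Rightarrow> 'p \<Rightarrow> ennreal) \<Rightarrow> real
    \<Rightarrow> ('k, 'p, 'v) rep \<Rightarrow> ('k, 'p, 'w) rep \<Rightarrow> bool" where
  "height_interleaved K \<rho> r M N \<longleftrightarrow>
     (\<exists>p\<in>rep_hom K M (Rfun \<rho> r N). \<exists>q\<in>rep_hom K N (Rfun \<rho> r M).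
        rep_hom_eq (Lfun K \<rho> r M) (emap K \<rho> r M) (rep_comp q (sharp K \<rho> r M N p)) \<and>
        rep_hom_eq (Lfun K \<rho> r N) (emap K \<rho> r N) (rep_comp p (sharp K \<rho> r N M q)))"

definition d_height :: "('k, 'm) ring_scheme \<Rightarrow> ('p::order \<Rightarrow> 'p \<Rightarrow> ennreal)
    \<Rightarrow> ('k, 'p, 'v) rep \<Rightarrow> ('k, 'p, 'w) rep \<Rightarrow> ennreal" where
  "d_height K \<rho> M N = Inf {ennreal r | r. 0 \<le> r \<and> height_interleaved K \<rho> r M N}"

section \<open>Erosion neighborhoods\<close>

definition Im_rep :: "('k, 'm) ring_scheme \<Rightarrow> ('p::order \<Rightarrow> 'p \<Rightarrow> ennreal) \<Rightarrow> real
    \<Rightarrow> ('k, 'p, 'v) rep \<Rightarrow> 'p \<Rightarrow> 'v set" where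
  "Im_rep K \<rho> r M a = etaL K \<rho> r M a ` carrier (Ob (Lfun K \<rho> r M) a)"

definition Ker_rep :: "('p::order \<Rightarrow> 'p \<Rightarrow> ennreal) \<Rightarrow> real
    \<Rightarrow> ('k, 'p, 'v) rep \<Rightarrow> 'p \<Rightarrow> 'v set" where
  "Ker_rep \<rho> r M a = a_kernel (Ob M a) (Ob (Rfun \<rho> r M) a) (etaR \<rho> r M a)"

text \<open>Isomorphism classes are formed among representations on the type \<open>'v set\<close> of cosets, where
  all subquotients of representations on \<open>'v\<close> live, so the neighborhoods of any two of these
  can be intersected.\<close>

definition EN :: "('k, 'm) ring_scheme \<Rightarrow> ('p::order \<Rightarrow> 'p \<Rightarrow> ennreal) \<Rightarrow> real
    \<Rightarrow> ('k, 'p, 'v) rep \<Rightarrow> ('k, 'p, 'v set) rep set set" where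
  "EN K \<rho> r M = {iso_class K (quot_rep (restrict_rep M M1) M2) | M1 M2.
     subrep K M1 M \<and> subrep K M2 M \<and>
     (\<forall>a. M2 a \<subseteq> M1 a \<and> Im_rep K \<rho> r M a \<subseteq> M1 a \<and> M2 a \<subseteq> Ker_rep \<rho> r M a)}"

definition d_EN :: "('k, 'm) ring_scheme \<Rightarrow> ('p::order \<Rightarrow> 'p \<Rightarrow> ennreal)
    \<Rightarrow> ('k, 'p, 'v) rep \<Rightarrow> ('k, 'p, 'v) rep \<Rightarrow> ennreal" where
  "d_EN K \<rho> M N = Inf {ennreal r | r. 0 \<le> r \<and> EN K \<rho> r M \<inter> EN K \<rho> r N \<noteq> {}}"

section \<open>Connected intersections and the constant \<open>c(\<rho>)\<close>\<close>

definition zigzag_connected :: "'p::order set \<Rightarrow> bool" where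
  "zigzag_connected S \<longleftrightarrow>
     (\<forall>x\<in>S. \<forall>y\<in>S. (x, y) \<in> {(u, v). u \<in> S \<and> v \<in> S \<and> (u \<le> v \<or> v \<le> u)}\<^sup>*)"

definition CIP :: "('p::order \<Rightarrow> 'p \<Rightarrow> ennreal) \<Rightarrow> bool" where
  "CIP \<rho> \<longleftrightarrow> (\<forall>a q s r. 0 \<le> s \<longrightarrow> 0 \<le> r \<longrightarrow>
     down \<rho> s a \<inter> up \<rho> r q = {} \<or> zigzag_connected (down \<rho> s a \<inter> up \<rho> r q))"

definition ediff :: "ennreal \<Rightarrow> ennreal \<Rightarrow> ennreal" where
  "ediff u v =
    (if u < \<infinity> \<and> v < \<infinity> then ennreal \<bar>enn2real u - enn2real v\<bar>
     else if u = \<infinity> \<and> v = \<infinity> then 0 else \<infinity>)"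

definition cond_IV :: "('p::order \<Rightarrow> 'p \<Rightarrow> ennreal) \<Rightarrow> real \<Rightarrow> bool" where
  "cond_IV \<rho> c \<longleftrightarrow> (\<forall>a b t. a \<le> b \<longrightarrow> 0 \<le> t \<longrightarrow> ennreal t \<le> \<rho> a b \<longrightarrow>
     (\<exists>z. a \<le> z \<and> z \<le> b \<and> ediff (\<rho> a z) (ennreal t) \<le> ennreal (c / 2) \<and>
          ediff (\<rho> z b) (\<rho> a b - ennreal t) \<le> ennreal (c / 2)))"

definition c_const :: "('p::order \<Rightarrow> 'p \<Rightarrow> ennreal) \<Rightarrow> ennreal" where
  "c_const \<rho> = Inf {ennreal c | c. 0 \<le> c \<and> cond_IV \<rho> c}"

definition ext_pseudo_distance_on :: "'a set \<Rightarrow> ('a \<Rightarrow> 'a \<Rightarrow> ennreal) \<Rightarrow> bool" where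
  "ext_pseudo_distance_on A d \<longleftrightarrow>
     (\<forall>x\<in>A. d x x = 0) \<and> (\<forall>x\<in>A. \<forall>y\<in>A. d x y = d y x) \<and>
     (\<forall>x\<in>A. \<forall>y\<in>A. \<forall>z\<in>A. d x z \<le> d x y + d y z)"

end

theory Submission
  imports Defs
begin

text \<open>By Goursat's lemma, an isomorphism between a subquotient \<open>M\<^sub>1/M\<^sub>2\<close> of \<open>M\<close> and a subquotient
  \<open>N\<^sub>1/N\<^sub>2\<close> of \<open>N\<close> is the same as a subrepresentation \<open>G \<subseteq> M \<oplus> N\<close> with domain \<open>M\<^sub>1\<close>, range \<open>N\<^sub>1\<close>
  and with \<open>M\<^sub>2\<close>, \<open>N\<^sub>2\<close> the vectors related to zero. A common erosion neighborhood is thus a linear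
  correspondence satisfying image and kernel conditions, and these conditions can be checked on vectors
  instead of on colimits and limits.

  An interleaving \<open>(p, q)\<close> gives the correspondence that is the image of
  \<open>(\<eta>, q\<^sup>\<sharp>; p\<^sup>\<sharp>, \<eta>) : L\<^sub>r M \<oplus> L\<^sub>r N \<rightarrow> M \<oplus> N\<close>. The relaxed triangle inequality comes from
  composing correspondences, with (IV) splitting a step of height \<open>r + s + c\<close> into steps of height
  \<open>r\<close> and \<open>s\<close>. Conversely, a correspondence \<open>G\<close> of level \<open>r\<close> yields an interleaving of level
  \<open>2r + c\<close>: to transfer \<open>m \<in> M(a)\<close> to \<open>N(y)\<close>, push \<open>m\<close> to a point \<open>z\<close> midway, choose a partner of the
  result under \<open>G(z)\<close>, and push that to \<open>y\<close>.\<close>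

abbreviation lhom :: "('k, 'm) ring_scheme \<Rightarrow> ('k, 'v) module \<Rightarrow> ('k, 'w) module \<Rightarrow> ('v \<Rightarrow> 'w) set" where
  "lhom \<equiv> LinearCombinations.module_hom"

section \<open>Linear maps\<close>

lemma lhom_comp: "g \<in> lhom K U V \<Longrightarrow> f \<in> lhom K W U \<Longrightarrow> (\<lambda>x. g (f x)) \<in> lhom K W V"
  by (auto simp: LinearCombinations.module_hom_def Pi_iff)

lemma lhom_closed: "f \<in> lhom K V U \<Longrightarrow> x \<in> carrier V \<Longrightarrow> f x \<in> carrier U"
  by (auto simp: LinearCombinations.module_hom_def)

lemma lhom_zero:
  assumes "vectorspace K V" "vectorspace K U" "f \<in> lhom K V U"
  shows "f \<zero>\<^bsub>V\<^esub> = \<zero>\<^bsub>U\<^esub>"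
proof -
  interpret V: vectorspace K V by fact
  interpret U: vectorspace K U by fact
  interpret mod_hom K V U f
    using assms(3) V.module_axioms U.module_axioms by (simp add: mod_hom_def mod_hom_axioms_def)
  show ?thesis by (rule f0_is_0)
qed

lemma Rep_vectorspace: "M \<in> Rep K \<Longrightarrow> vectorspace K (Ob M a)"
  by (simp add: Rep_def)

lemma Rep_Tr: "M \<in> Rep K \<Longrightarrow> a \<le> b \<Longrightarrow> Tr M a b \<in> lhom K (Ob M a) (Ob M b)"
  by (simp add: Rep_def)

lemma Rep_Tr_id: "M \<in> Rep K \<Longrightarrow> v \<in> carrier (Ob M a) \<Longrightarrow> Tr M a a v = v"
  by (simp add: Rep_def)

lemma Rep_Tr_comp:
  "M \<in> Rep K \<Longrightarrow> a \<le> b \<Longrightarrow> b \<le> c \<Longrightarrow> v \<in> carrier (Ob M a) \<Longrightarrow> Tr M b c (Tr M a b v) = Tr M a c v"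
  by (simp add: Rep_def)

lemma Rep_Tr_zero: "M \<in> Rep K \<Longrightarrow> a \<le> b \<Longrightarrow> Tr M a b \<zero>\<^bsub>Ob M a\<^esub> = \<zero>\<^bsub>Ob M b\<^esub>"
  by (metis Rep_Tr Rep_vectorspace lhom_zero)

lemma subspace_iff:
  assumes "vectorspace K V"
  shows "VectorSpace.subspace K W V \<longleftrightarrow> W \<subseteq> carrier V \<and> \<zero>\<^bsub>V\<^esub> \<in> W \<and>
    (\<forall>x\<in>W. \<forall>y\<in>W. x \<oplus>\<^bsub>V\<^esub> y \<in> W) \<and> (\<forall>c\<in>carrier K. \<forall>x\<in>W. c \<odot>\<^bsub>V\<^esub> x \<in> W)"
  using assms by (auto simp: VectorSpace.subspace_def LinearCombinations.submodule_def vectorspace_def)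

lemma subspace_carrier: "VectorSpace.subspace K W V \<Longrightarrow> x \<in> W \<Longrightarrow> x \<in> carrier V"
  by (auto simp: VectorSpace.subspace_def LinearCombinations.submodule_def)

text \<open>A coset uses only the addition, so shrinking the carrier does not change it. Elements of
  a subquotient are therefore cosets formed in the ambient representation.\<close>

lemma a_r_coset_restrict [simp]: "W +>\<^bsub>V\<lparr>carrier := D\<rparr>\<^esub> x = W +>\<^bsub>V\<^esub> x"
  by (simp add: a_r_coset_def')

section \<open>Subquotients of representations\<close>

lemma restrict_rep_Rep:
  assumes M: "M \<in> Rep K" and W: "subrep K W M"
  shows "restrict_rep M W \<in> Rep K"
proof -
  have sub: "VectorSpace.subspace K (W a) (Ob M a)" for a using W by (simp add: subrep_def)
  have vs: "vectorspace K ((Ob M a)\<lparr>carrier := W a\<rparr>)" for a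
    by (rule vectorspace.subspace_is_vs[OF Rep_vectorspace[OF M] sub])
  have in_carrier: "v \<in> W a \<Longrightarrow> v \<in> carrier (Ob M a)" for a v
    by (rule subspace_carrier[OF sub])
  show ?thesis
    unfolding Rep_def
    using vs in_carrier W Rep_Tr_id[OF M] Rep_Tr_comp[OF M] Rep_Tr[OF M]
    by (auto simp: restrict_rep_def LinearCombinations.module_hom_def subrep_def image_subset_iff)
qed

text \<open>The structure map of \<open>quot_rep\<close> is a union over all representatives. They
  all give the same coset because \<open>Tr M a b\<close> is additive and maps \<open>W a\<close>
  into \<open>W b\<close>.\<close>

lemma quot_rep_Tr:
  assumes M: "M \<in> Rep K" and W: "subrep K W M" and ab: "a \<le> b" and x: "x \<in> carrier (Ob M a)"
  shows "Tr (quot_rep M W) a b (W a +>\<^bsub>Ob M a\<^esub> x) = W b +>\<^bsub>Ob M b\<^esub> Tr M a b x"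
proof -
  have sub: "VectorSpace.subspace K (W a) (Ob M a)" for a using W by (simp add: subrep_def)
  note subD = sub[unfolded subspace_iff[OF Rep_vectorspace[OF M]]]
  interpret A: vectorspace K "Ob M a" by (rule Rep_vectorspace[OF M])
  interpret B: vectorspace K "Ob M b" by (rule Rep_vectorspace[OF M])
  have "W b +>\<^bsub>Ob M b\<^esub> Tr M a b y = W b +>\<^bsub>Ob M b\<^esub> Tr M a b x" if "y \<in> W a +>\<^bsub>Ob M a\<^esub> x" for y
  proof -
    obtain w where w: "w \<in> W a" "y = w \<oplus>\<^bsub>Ob M a\<^esub> x" using \<open>y \<in> _\<close> by (auto simp: a_r_coset_def')
    then have wc: "w \<in> carrier (Ob M a)" using subD by blast
    have Tc: "Tr M a b w \<in> carrier (Ob M b)" "Tr M a b x \<in> carrier (Ob M b)"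
      using Tr_closed[OF M ab] wc x by auto
    have "Tr M a b y = Tr M a b w \<oplus>\<^bsub>Ob M b\<^esub> Tr M a b x"
      using LinearCombinations.module_hom_add[OF Rep_Tr[OF M ab] wc x] w by simp
    moreover have "Tr M a b w \<in> W b" using W ab w by (auto simp: subrep_def image_subset_iff)
    moreover have "(w' \<oplus>\<^bsub>Ob M b\<^esub> x') \<ominus>\<^bsub>Ob M b\<^esub> x' = w'"
      if "w' \<in> carrier (Ob M b)" "x' \<in> carrier (Ob M b)" for w' x'
      using that by (simp add: B.M.minus_eq B.M.a_assoc B.M.r_neg)
    ultimately show ?thesis
      using Tc by (subst quot_eq_iff[OF sub]) auto
  qed
  moreover have "x \<in> W a +>\<^bsub>Ob M a\<^esub> x"
    using subD[of a] x by (auto simp: a_r_coset_def' intro!: bexI[of _ "\<zero>\<^bsub>Ob M a\<^esub>"])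
  ultimately have "(\<Union>y\<in>W a +>\<^bsub>Ob M a\<^esub> x. W b +>\<^bsub>Ob M b\<^esub> Tr M a b y) = W b +>\<^bsub>Ob M b\<^esub> Tr M a b x"
    by blast
  then show ?thesis by (simp add: quot_rep_def)
qed

lemma quot_rep_Rep:
  assumes M: "M \<in> Rep K" and W: "subrep K W M"
  shows "quot_rep M W \<in> Rep K"
proof -
  have sub: "VectorSpace.subspace K (W a) (Ob M a)" for a using W by (simp add: subrep_def)
  let ?Q = "quot_rep M W"
  have Ob: "Ob ?Q a = quot (Ob M a) (W a)" for a by (simp add: quot_rep_def)
  have cosetE: "\<exists>x\<in>carrier (Ob M a). X = W a +>\<^bsub>Ob M a\<^esub> x" if "X \<in> carrier (quot (Ob M a) (W a))" for a X
    using that by (auto simp: quot_carrier[OF sub])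
  have "Tr ?Q a b \<in> lhom K (Ob ?Q a) (Ob ?Q b)" if ab: "a \<le> b" for a b
  proof -
    interpret A: vectorspace K "Ob M a" by (rule Rep_vectorspace[OF M])
    interpret B: vectorspace K "Ob M b" by (rule Rep_vectorspace[OF M])
    show ?thesis
      using Tr_closed[OF M ab] LinearCombinations.module_hom_add[OF Rep_Tr[OF M ab]]
        LinearCombinations.module_hom_smult[OF Rep_Tr[OF M ab]]
      by (auto simp: LinearCombinations.module_hom_def Ob quot_carrier[OF sub]
          quot_add[OF sub] quot_smult[OF sub] quot_rep_Tr[OF M W ab])
  qed
  moreover have "Tr ?Q a a X = X" if X: "X \<in> carrier (Ob ?Q a)" for a X
  proof -
    obtain x where x: "x \<in> carrier (Ob M a)" "X = W a +>\<^bsub>Ob M a\<^esub> x"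
      using cosetE X unfolding Ob by blast
    show ?thesis unfolding x(2) quot_rep_Tr[OF M W order_refl x(1)] Rep_Tr_id[OF M x(1)] ..
  qed
  moreover have "Tr ?Q b c (Tr ?Q a b X) = Tr ?Q a c X"
    if ab: "a \<le> b" and bc: "b \<le> c" and X: "X \<in> carrier (Ob ?Q a)" for a b c X
  proof -
    obtain x where x: "x \<in> carrier (Ob M a)" "X = W a +>\<^bsub>Ob M a\<^esub> x"
      using cosetE X unfolding Ob by blast
    show ?thesis
      unfolding x(2) quot_rep_Tr[OF M W ab x(1)] quot_rep_Tr[OF M W bc Tr_closed[OF M ab x(1)]]
        quot_rep_Tr[OF M W order_trans[OF ab bc] x(1)] Rep_Tr_comp[OF M ab bc x(1)] ..
  qed
  ultimately show ?thesis
    unfolding Rep_def using quot_vectorspace[OF sub] by (auto simp: Ob)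
qed

lemma subrep_restrict:
  assumes M: "M \<in> Rep K" and "subrep K M1 M" "subrep K M2 M" "\<And>a. M2 a \<subseteq> M1 a"
  shows "subrep K M2 (restrict_rep M M1)"
proof -
  have vs: "vectorspace K ((Ob M a)\<lparr>carrier := M1 a\<rparr>)" for a
    using vectorspace.subspace_is_vs[OF Rep_vectorspace[OF M]] assms(2) by (auto simp: subrep_def)
  have "VectorSpace.subspace K (M2 a) (Ob M a)" for a using assms(3) by (simp add: subrep_def)
  then have "VectorSpace.subspace K (M2 a) ((Ob M a)\<lparr>carrier := M1 a\<rparr>)" for a
    unfolding subspace_iff[OF vs] subspace_iff[OF Rep_vectorspace[OF M]] using assms(4) by simp
  then show ?thesis using assms(3) by (simp add: subrep_def restrict_rep_def)
qed

lemma subquot_Rep: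
  assumes "M \<in> Rep K" "subrep K M1 M" "subrep K M2 M" "\<And>a. M2 a \<subseteq> M1 a"
  shows "quot_rep (restrict_rep M M1) M2 \<in> Rep K"
  by (rule quot_rep_Rep[OF restrict_rep_Rep[OF assms(1,2)] subrep_restrict[OF assms]])

lemma subquot_carrier:
  assumes "M \<in> Rep K" "subrep K M1 M" "subrep K M2 M" "\<And>a. M2 a \<subseteq> M1 a"
  shows "carrier (Ob (quot_rep (restrict_rep M M1) M2) a) = (\<lambda>x. M2 a +>\<^bsub>Ob M a\<^esub> x) ` M1 a"
proof -
  have "VectorSpace.subspace K (M2 a) (Ob (restrict_rep M M1) a)"
    using subrep_restrict[OF assms] by (simp add: subrep_def)
  from quot_carrier[OF this] show ?thesis by (simp add: quot_rep_def) (simp add: restrict_rep_def)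
qed

text \<open>Every operation of a subquotient is computed on representatives, with cosets taken in
  \<open>M\<close> itself, so \<open>restrict_rep\<close> drops out of later calculations.\<close>

lemma subquot_ops:
  assumes "M \<in> Rep K" "subrep K M1 M" "subrep K M2 M" "\<And>a. M2 a \<subseteq> M1 a" and x: "x \<in> M1 a"
  defines "Q \<equiv> quot_rep (restrict_rep M M1) M2"
  shows subquot_add: "y \<in> M1 a \<Longrightarrow> (M2 a +>\<^bsub>Ob M a\<^esub> x) \<oplus>\<^bsub>Ob Q a\<^esub> (M2 a +>\<^bsub>Ob M a\<^esub> y) = M2 a +>\<^bsub>Ob M a\<^esub> (x \<oplus>\<^bsub>Ob M a\<^esub> y)"
    and subquot_smult: "c \<in> carrier K \<Longrightarrow> c \<odot>\<^bsub>Ob Q a\<^esub> (M2 a +>\<^bsub>Ob M a\<^esub> x) = M2 a +>\<^bsub>Ob M a\<^esub> (c \<odot>\<^bsub>Ob M a\<^esub> x)"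
    and subquot_Tr: "a \<le> b \<Longrightarrow> Tr Q a b (M2 a +>\<^bsub>Ob M a\<^esub> x) = M2 b +>\<^bsub>Ob M b\<^esub> Tr M a b x"
    and subquot_zero: "\<zero>\<^bsub>Ob Q a\<^esub> = M2 a"
proof -
  let ?R = "restrict_rep M M1"
  have R: "?R \<in> Rep K" "subrep K M2 ?R"
    using restrict_rep_Rep[OF assms(1,2)] subrep_restrict[OF assms(1-4)] .
  have s: "VectorSpace.subspace K (M2 a) (Ob ?R a)" using R(2) by (simp add: subrep_def)
  have s': "VectorSpace.subspace K (M2 a) ((Ob M a)\<lparr>carrier := M1 a\<rparr>)" using s by (simp add: restrict_rep_def)
  have Q: "Ob Q a = quot ((Ob M a)\<lparr>carrier := M1 a\<rparr>) (M2 a)"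
    by (simp add: Q_def quot_rep_def restrict_rep_def)
  show "(M2 a +>\<^bsub>Ob M a\<^esub> x) \<oplus>\<^bsub>Ob Q a\<^esub> (M2 a +>\<^bsub>Ob M a\<^esub> y) = M2 a +>\<^bsub>Ob M a\<^esub> (x \<oplus>\<^bsub>Ob M a\<^esub> y)" if "y \<in> M1 a"
    using quot_add[OF s', of x y] x that by (simp add: Q)
  show "c \<odot>\<^bsub>Ob Q a\<^esub> (M2 a +>\<^bsub>Ob M a\<^esub> x) = M2 a +>\<^bsub>Ob M a\<^esub> (c \<odot>\<^bsub>Ob M a\<^esub> x)" if "c \<in> carrier K"
    using quot_smult[OF s' that, of x] x by (simp add: Q)
  show "Tr Q a b (M2 a +>\<^bsub>Ob M a\<^esub> x) = M2 b +>\<^bsub>Ob M b\<^esub> Tr M a b x" if "a \<le> b"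
    using quot_rep_Tr[OF R that, of x] x unfolding Q_def by (simp add: restrict_rep_def)
  show "\<zero>\<^bsub>Ob Q a\<^esub> = M2 a" by (simp add: Q quot_def)
qed

section \<open>Isomorphism classes\<close>

lemma rep_iso_refl: "rep_iso K M M"
  unfolding rep_iso_def
  by (rule bexI[of _ "\<lambda>a v. v"]) (auto simp: rep_hom_def LinearCombinations.module_hom_def bij_betw_def)

lemma rep_iso_trans:
  assumes "rep_iso K M N" "rep_iso K N L"
  shows "rep_iso K M L"
proof -
  from assms obtain f g where fg: "f \<in> rep_hom K M N" "g \<in> rep_hom K N L"
    and bij: "\<And>a. bij_betw (f a) (carrier (Ob M a)) (carrier (Ob N a))"
      "\<And>a. bij_betw (g a) (carrier (Ob N a)) (carrier (Ob L a))"
    unfolding rep_iso_def by blast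
  have "rep_comp g f \<in> rep_hom K M L"
    using fg by (auto simp: rep_hom_def rep_comp_def LinearCombinations.module_hom_def Pi_iff)
  moreover have "bij_betw (rep_comp g f a) (carrier (Ob M a)) (carrier (Ob L a))" for a
    unfolding rep_comp_def by (rule bij_betw_trans[OF bij])
  ultimately show ?thesis unfolding rep_iso_def by blast
qed

text \<open>Every vector of \<open>N\<close> is some \<open>f a v\<close>, so linearity and
  naturality of the pointwise inverse can be read off from those of \<open>f\<close>.\<close>

lemma rep_iso_sym:
  assumes M: "M \<in> Rep K" and "rep_iso K M N"
  shows "rep_iso K N M"
proof -
  from assms(2) obtain f where f: "f \<in> rep_hom K M N"
    and bij: "\<And>a. bij_betw (f a) (carrier (Ob M a)) (carrier (Ob N a))"
    unfolding rep_iso_def by blast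
  define g where "g a = inv_into (carrier (Ob M a)) (f a)" for a
  have fh: "f a \<in> lhom K (Ob M a) (Ob N a)" for a using f by (simp add: rep_hom_def)
  have nat: "f b (Tr M a b v) = Tr N a b (f a v)" if "a \<le> b" "v \<in> carrier (Ob M a)" for a b v
    using f that by (simp add: rep_hom_def)
  have gf: "g a (f a v) = v" if "v \<in> carrier (Ob M a)" for a v
    using bij[of a] that by (simp add: g_def bij_betw_def)
  have fE: "\<exists>v\<in>carrier (Ob M a). w = f a v" if "w \<in> carrier (Ob N a)" for a w
    using bij[of a] that by (auto simp: bij_betw_def)
  have "g a \<in> lhom K (Ob N a) (Ob M a)" for a
  proof -
    interpret A: vectorspace K "Ob M a" by (rule Rep_vectorspace[OF M])
    show ?thesis
      unfolding LinearCombinations.module_hom_def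
    proof (intro CollectI conjI allI impI Pi_I; (elim conjE)?)
      fix w assume "w \<in> carrier (Ob N a)" then show "g a w \<in> carrier (Ob M a)" using fE[of w a] gf by auto
    next
      fix w w' assume "w \<in> carrier (Ob N a)" "w' \<in> carrier (Ob N a)"
      then obtain v v' where v: "v \<in> carrier (Ob M a)" "v' \<in> carrier (Ob M a)" "w = f a v" "w' = f a v'"
        using fE by metis
      then show "g a (w \<oplus>\<^bsub>Ob N a\<^esub> w') = g a w \<oplus>\<^bsub>Ob M a\<^esub> g a w'"
        using LinearCombinations.module_hom_add[OF fh v(1,2), symmetric] gf by simp
    next
      fix c w assume c: "c \<in> carrier K" and "w \<in> carrier (Ob N a)"
      then obtain v where v: "v \<in> carrier (Ob M a)" "w = f a v" using fE by metis
      then show "g a (c \<odot>\<^bsub>Ob N a\<^esub> w) = c \<odot>\<^bsub>Ob M a\<^esub> g a w"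
        using LinearCombinations.module_hom_smult[OF fh c v(1), symmetric] gf c by simp
    qed
  qed
  moreover have "g b (Tr N a b w) = Tr M a b (g a w)" if ab: "a \<le> b" and w: "w \<in> carrier (Ob N a)" for a b w
  proof -
    obtain v where v: "v \<in> carrier (Ob M a)" "w = f a v" using fE w by metis
    then show ?thesis using gf nat[OF ab v(1), symmetric] Tr_closed[OF M ab v(1)] by simp
  qed
  ultimately have "g \<in> rep_hom K N M" by (auto simp: rep_hom_def)
  moreover have "bij_betw (g a) (carrier (Ob N a)) (carrier (Ob M a))" for a
    unfolding g_def by (rule bij_betw_inv_into[OF bij])
  ultimately show ?thesis unfolding rep_iso_def by blast
qed

text \<open>\<open>EN\<close> consists of isomorphism classes; this turns a common element into an
  actual isomorphism of subquotients, and back.\<close>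

lemma iso_class_eq_iff:
  assumes "M \<in> Rep K" "N \<in> Rep K"
  shows "iso_class K M = iso_class K N \<longleftrightarrow> rep_iso K M N"
proof
  assume "iso_class K M = iso_class K N"
  then have "N \<in> iso_class K M" using assms by (auto simp: iso_class_def rep_iso_refl)
  then show "rep_iso K M N" by (simp add: iso_class_def)
next
  assume "rep_iso K M N"
  then show "iso_class K M = iso_class K N"
    using rep_iso_sym[OF assms(1)] rep_iso_trans unfolding iso_class_def by blast
qed

lemma subspaceD:
  assumes "VectorSpace.subspace K W V"
  shows subspace_zero: "\<zero>\<^bsub>V\<^esub> \<in> W"
    and subspace_add: "x \<in> W \<Longrightarrow> y \<in> W \<Longrightarrow> x \<oplus>\<^bsub>V\<^esub> y \<in> W"
    and subspace_smult: "c \<in> carrier K \<Longrightarrow> x \<in> W \<Longrightarrow> c \<odot>\<^bsub>V\<^esub> x \<in> W"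
  using assms by (auto simp: VectorSpace.subspace_def LinearCombinations.submodule_def)

text \<open>The zero of \<open>quot V W\<close> is the set \<open>W\<close>; writing it as the coset
  of the zero vector makes it comparable with other cosets.\<close>

lemma quot_coset_zero:
  fixes V :: "('k, 'v) module"
  assumes W: "VectorSpace.subspace K W V"
  shows "W +>\<^bsub>V\<^esub> \<zero>\<^bsub>V\<^esub> = W"
proof -
  interpret abelian_subgroup W V by (rule quot_ab[OF W])
  show ?thesis by (rule a_rcos_const) simp
qed

lemma quot_eq_zero_iff:
  fixes V :: "('k, 'v) module"
  assumes W: "VectorSpace.subspace K W V" and x: "x \<in> carrier V"
  shows "W +>\<^bsub>V\<^esub> x = W +>\<^bsub>V\<^esub> \<zero>\<^bsub>V\<^esub> \<longleftrightarrow> x \<in> W"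
proof -
  interpret vectorspace K V using W by (simp add: VectorSpace.subspace_def)
  have "\<ominus>\<^bsub>V\<^esub> \<zero>\<^bsub>V\<^esub> = \<zero>\<^bsub>V\<^esub>" by (rule M.minus_equality) auto
  then have "x \<ominus>\<^bsub>V\<^esub> \<zero>\<^bsub>V\<^esub> = x" using x by (simp add: M.minus_eq)
  then show ?thesis using quot_eq_iff[OF W x M.zero_closed] by simp
qed

section \<open>Correspondences\<close>

text \<open>A linear subspace of the product of \<open>V\<close> and \<open>U\<close>. Encoding it
  as a HOL relation makes \<open>O\<close>, converse, \<open>Domain\<close> and image available
  without building a product module.\<close>

definition lin_rel :: "('k, 'm) ring_scheme \<Rightarrow> ('k, 'v) module \<Rightarrow> ('k, 'w) module \<Rightarrow> ('v \<times> 'w) set \<Rightarrow> bool" where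
  "lin_rel K V U G \<longleftrightarrow> G \<subseteq> carrier V \<times> carrier U \<and> (\<zero>\<^bsub>V\<^esub>, \<zero>\<^bsub>U\<^esub>) \<in> G \<and>
     (\<forall>x y x' y'. (x, y) \<in> G \<longrightarrow> (x', y') \<in> G \<longrightarrow> (x \<oplus>\<^bsub>V\<^esub> x', y \<oplus>\<^bsub>U\<^esub> y') \<in> G) \<and>
     (\<forall>c x y. c \<in> carrier K \<longrightarrow> (x, y) \<in> G \<longrightarrow> (c \<odot>\<^bsub>V\<^esub> x, c \<odot>\<^bsub>U\<^esub> y) \<in> G)"

lemma lin_rel_left: "lin_rel K V U G \<Longrightarrow> (x, y) \<in> G \<Longrightarrow> x \<in> carrier V"
  by (auto simp: lin_rel_def)

lemma lin_rel_right: "lin_rel K V U G \<Longrightarrow> (x, y) \<in> G \<Longrightarrow> y \<in> carrier U"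
  by (auto simp: lin_rel_def)

lemma lin_rel_add:
  "lin_rel K V U G \<Longrightarrow> (x, y) \<in> G \<Longrightarrow> (x', y') \<in> G \<Longrightarrow> (x \<oplus>\<^bsub>V\<^esub> x', y \<oplus>\<^bsub>U\<^esub> y') \<in> G"
  by (simp add: lin_rel_def)

lemma lin_rel_smult:
  "lin_rel K V U G \<Longrightarrow> (x, y) \<in> G \<Longrightarrow> c \<in> carrier K \<Longrightarrow> (c \<odot>\<^bsub>V\<^esub> x, c \<odot>\<^bsub>U\<^esub> y) \<in> G"
  by (simp add: lin_rel_def)

lemma lin_rel_zero: "lin_rel K V U G \<Longrightarrow> (\<zero>\<^bsub>V\<^esub>, \<zero>\<^bsub>U\<^esub>) \<in> G"
  by (simp add: lin_rel_def)

lemma lin_rel_converse: "lin_rel K V U G \<Longrightarrow> lin_rel K U V (G\<inverse>)"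
  by (auto simp: lin_rel_def)

lemma lin_rel_relcomp:
  assumes "lin_rel K V U G" "lin_rel K U W H"
  shows "lin_rel K V W (G O H)"
proof -
  have "G O H \<subseteq> carrier V \<times> carrier W" using lin_rel_left[OF assms(1)] lin_rel_right[OF assms(2)] by auto
  moreover have "(\<zero>\<^bsub>V\<^esub>, \<zero>\<^bsub>W\<^esub>) \<in> G O H"
    by (rule relcompI[OF lin_rel_zero[OF assms(1)] lin_rel_zero[OF assms(2)]])
  moreover have "(x \<oplus>\<^bsub>V\<^esub> x', z \<oplus>\<^bsub>W\<^esub> z') \<in> G O H" if "(x, z) \<in> G O H" "(x', z') \<in> G O H" for x z x' z'
    using that by (auto elim!: relcompEpair intro!: relcompI lin_rel_add[OF assms(1)] lin_rel_add[OF assms(2)])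
  moreover have "(c \<odot>\<^bsub>V\<^esub> x, c \<odot>\<^bsub>W\<^esub> z) \<in> G O H" if "c \<in> carrier K" "(x, z) \<in> G O H" for c x z
    using that by (auto elim!: relcompEpair intro!: relcompI lin_rel_smult[OF assms(1)] lin_rel_smult[OF assms(2)])
  ultimately show ?thesis unfolding lin_rel_def by (intro conjI allI impI)
qed

lemma lin_rel_minus:
  assumes V: "vectorspace K V" and U: "vectorspace K U" and G: "lin_rel K V U G"
    and xy: "(x, y) \<in> G" "(x', y') \<in> G"
  shows "(x \<ominus>\<^bsub>V\<^esub> x', y \<ominus>\<^bsub>U\<^esub> y') \<in> G"
proof -
  interpret V: vectorspace K V by fact
  interpret U: vectorspace K U by fact
  \<comment> \<open>The closure conditions mention only sums and scalars, so negatives are obtained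
    as multiples by minus one.\<close>
  have "((\<ominus>\<^bsub>K\<^esub> \<one>\<^bsub>K\<^esub>) \<odot>\<^bsub>V\<^esub> x', (\<ominus>\<^bsub>K\<^esub> \<one>\<^bsub>K\<^esub>) \<odot>\<^bsub>U\<^esub> y') \<in> G"
    by (rule lin_rel_smult[OF G xy(2)]) simp
  then have "(\<ominus>\<^bsub>V\<^esub> x', \<ominus>\<^bsub>U\<^esub> y') \<in> G"
    using V.smult_minus_1[OF lin_rel_left[OF G xy(2)]] U.smult_minus_1[OF lin_rel_right[OF G xy(2)]] by simp
  from lin_rel_add[OF G xy(1) this] show ?thesis by (simp add: V.M.minus_eq U.M.minus_eq)
qed

lemma lin_rel_Domain:
  assumes "vectorspace K V" "lin_rel K V U G"
  shows "VectorSpace.subspace K (Domain G) V"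
  unfolding subspace_iff[OF assms(1)]
  by (auto elim!: DomainE intro: lin_rel_left[OF assms(2)] intro!: DomainI[OF lin_rel_zero[OF assms(2)]]
      DomainI[OF lin_rel_add[OF assms(2)]] DomainI[OF lin_rel_smult[OF assms(2)]])

lemma lin_rel_null:
  assumes V: "vectorspace K V" and U: "vectorspace K U" and G: "lin_rel K V U G"
  shows "VectorSpace.subspace K {x. (x, \<zero>\<^bsub>U\<^esub>) \<in> G} V"
proof -
  interpret U: vectorspace K U by fact
  have "\<zero>\<^bsub>U\<^esub> \<oplus>\<^bsub>U\<^esub> \<zero>\<^bsub>U\<^esub> = \<zero>\<^bsub>U\<^esub>" "\<And>c. c \<in> carrier K \<Longrightarrow> c \<odot>\<^bsub>U\<^esub> \<zero>\<^bsub>U\<^esub> = \<zero>\<^bsub>U\<^esub>" by auto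
  then show ?thesis
    unfolding subspace_iff[OF V]
    using lin_rel_left[OF G] lin_rel_zero[OF G] lin_rel_add[OF G] lin_rel_smult[OF G]
    by (auto, metis, metis)
qed

text \<open>The pointwise core of Goursat's lemma: two partners of one vector differ by a vector
  related to zero. A linear relation thus sends a coset modulo its left null space to exactly one
  coset modulo its right null space.\<close>

lemma lin_rel_Image_coset:
  assumes V: "vectorspace K V" and U: "vectorspace K U" and G: "lin_rel K V U G" and xy: "(x, y) \<in> G"
  shows "G `` ({x. (x, \<zero>\<^bsub>U\<^esub>) \<in> G} +>\<^bsub>V\<^esub> x) = {y. (\<zero>\<^bsub>V\<^esub>, y) \<in> G} +>\<^bsub>U\<^esub> y"
proof -
  interpret V: vectorspace K V by fact
  interpret U: vectorspace K U by fact
  have x: "x \<in> carrier V" and y: "y \<in> carrier U" using lin_rel_left[OF G xy] lin_rel_right[OF G xy] .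
  have "n \<in> {y. (\<zero>\<^bsub>V\<^esub>, y) \<in> G} +>\<^bsub>U\<^esub> y" if w: "(w, \<zero>\<^bsub>U\<^esub>) \<in> G" and n: "(w \<oplus>\<^bsub>V\<^esub> x, n) \<in> G" for w n
  proof -
    have wc: "w \<in> carrier V" and nc: "n \<in> carrier U" using lin_rel_left[OF G w] lin_rel_right[OF G n] .
    have "(w \<oplus>\<^bsub>V\<^esub> x, \<zero>\<^bsub>U\<^esub> \<oplus>\<^bsub>U\<^esub> y) \<in> G" by (rule lin_rel_add[OF G w xy])
    \<comment> \<open>Both pairs have the same left entry, so their difference relates zero to
      \<open>n\<close> minus \<open>y\<close>.\<close>
    from lin_rel_minus[OF V U G n this] have "(\<zero>\<^bsub>V\<^esub>, n \<ominus>\<^bsub>U\<^esub> y) \<in> G"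
      using wc x y by (simp add: V.M.minus_eq V.M.r_neg)
    moreover have "n = (n \<ominus>\<^bsub>U\<^esub> y) \<oplus>\<^bsub>U\<^esub> y" using nc y by (simp add: U.M.minus_eq U.M.a_assoc U.M.l_neg)
    ultimately show ?thesis by (auto simp: a_r_coset_def')
  qed
  moreover have "w \<oplus>\<^bsub>U\<^esub> y \<in> G `` ({x. (x, \<zero>\<^bsub>U\<^esub>) \<in> G} +>\<^bsub>V\<^esub> x)" if w: "(\<zero>\<^bsub>V\<^esub>, w) \<in> G" for w
    using lin_rel_add[OF G w xy] lin_rel_zero[OF G] unfolding a_r_coset_def' by blast
  ultimately show ?thesis by (auto simp: a_r_coset_def')
qed

text \<open>A subrepresentation of the direct sum of \<open>M\<close> and \<open>N\<close>, given as
  one linear relation per point and stable under the structure maps.\<close>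

definition corr :: "('k, 'm) ring_scheme \<Rightarrow> ('k, 'p::order, 'v) rep \<Rightarrow> ('k, 'p, 'w) rep
    \<Rightarrow> ('p \<Rightarrow> ('v \<times> 'w) set) \<Rightarrow> bool" where
  "corr K M N G \<longleftrightarrow> (\<forall>a. lin_rel K (Ob M a) (Ob N a) (G a)) \<and>
     (\<forall>a b m n. a \<le> b \<longrightarrow> (m, n) \<in> G a \<longrightarrow> (Tr M a b m, Tr N a b n) \<in> G b)"

text \<open>This is the \<open>M2\<close> of Goursat's lemma. The other null space,
  \<open>N2\<close>, is the same construction for the converse relation, with \<open>M\<close> as
  target.\<close>

definition corr_null :: "('k, 'p, 'w) rep \<Rightarrow> ('p \<Rightarrow> ('v \<times> 'w) set) \<Rightarrow> 'p \<Rightarrow> 'v set" where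
  "corr_null N G a = {m. (m, \<zero>\<^bsub>Ob N a\<^esub>) \<in> G a}"

lemma corr_lin_rel: "corr K M N G \<Longrightarrow> lin_rel K (Ob M a) (Ob N a) (G a)"
  by (simp add: corr_def)

lemma corr_Tr: "corr K M N G \<Longrightarrow> a \<le> b \<Longrightarrow> (m, n) \<in> G a \<Longrightarrow> (Tr M a b m, Tr N a b n) \<in> G b"
  by (simp add: corr_def)

lemma corr_converse: "corr K M N G \<Longrightarrow> corr K N M (\<lambda>a. (G a)\<inverse>)"
  by (simp add: corr_def lin_rel_converse)

lemma corr_relcomp: "corr K M X G \<Longrightarrow> corr K X N H \<Longrightarrow> corr K M N (\<lambda>a. G a O H a)"
  using lin_rel_relcomp[of K] by (fastforce simp: corr_def)

text \<open>The three conclusions have the shape of the premises of the \<open>subquot\<close>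
  lemmas, so those apply directly to the subquotient cut out by \<open>G\<close>.\<close>

lemma corr_subrep:
  assumes M: "M \<in> Rep K" and N: "N \<in> Rep K" and G: "corr K M N G"
  shows "subrep K (\<lambda>a. Domain (G a)) M" "subrep K (corr_null N G) M" "corr_null N G a \<subseteq> Domain (G a)"
proof -
  have "Tr M a b ` Domain (G a) \<subseteq> Domain (G b)" if "a \<le> b" for a b
    using corr_Tr[OF G that] by blast
  then show "subrep K (\<lambda>a. Domain (G a)) M"
    unfolding subrep_def using lin_rel_Domain[OF Rep_vectorspace[OF M] corr_lin_rel[OF G]] by blast
  have "Tr M a b m \<in> corr_null N G b" if "a \<le> b" "m \<in> corr_null N G a" for a b m
    using corr_Tr[OF G that(1), of m "\<zero>\<^bsub>Ob N a\<^esub>"] that(2) Rep_Tr_zero[OF N that(1)] by (simp add: corr_null_def)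
  moreover have "VectorSpace.subspace K (corr_null N G a) (Ob M a)" for a
    unfolding corr_null_def
    by (rule lin_rel_null[OF Rep_vectorspace[OF M] Rep_vectorspace[OF N] corr_lin_rel[OF G]])
  ultimately show "subrep K (corr_null N G) M" unfolding subrep_def by blast
  show "corr_null N G a \<subseteq> Domain (G a)" by (auto simp: corr_null_def)
qed

definition corr_quot :: "('k, 'p, 'v) rep \<Rightarrow> ('k, 'p, 'w) rep \<Rightarrow> ('p \<Rightarrow> ('v \<times> 'w) set)
    \<Rightarrow> ('k, 'p, 'v set) rep" where
  "corr_quot M N G = quot_rep (restrict_rep M (\<lambda>a. Domain (G a))) (corr_null N G)"

text \<open>Goursat's lemma. The isomorphism sends a coset to its image under the relation.\<close>

lemma corr_quot_iso:
  fixes M :: "('k, 'p::order, 'v) rep" and N :: "('k, 'p, 'w) rep"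
  assumes M: "M \<in> Rep K" and N: "N \<in> Rep K" and G: "corr K M N G"
  shows "rep_iso K (corr_quot M N G) (corr_quot N M (\<lambda>a. (G a)\<inverse>))"
proof -
  let ?H = "\<lambda>a. (G a)\<inverse>"
  let ?A = "corr_quot M N G" and ?B = "corr_quot N M ?H"
  note H = corr_converse[OF G]
  note VM = Rep_vectorspace[OF M] and VN = Rep_vectorspace[OF N]
  note sM = M corr_subrep[OF M N G] and sN = N corr_subrep[OF N M H]
  let ?c = "\<lambda>a x. corr_null N G a +>\<^bsub>Ob M a\<^esub> x" and ?d = "\<lambda>a y. corr_null M ?H a +>\<^bsub>Ob N a\<^esub> y"
  have img: "G a `` ?c a x = ?d a y" if "(x, y) \<in> G a" for a x y
    using lin_rel_Image_coset[OF VM VN corr_lin_rel[OF G] that] by (simp add: corr_null_def)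
  have img': "?H a `` ?d a y = ?c a x" if "(x, y) \<in> G a" for a x y
    using lin_rel_Image_coset[OF VN VM corr_lin_rel[OF H], of y x a] that by (simp add: corr_null_def)
  have cA: "carrier (Ob ?A a) = ?c a ` Domain (G a)" for a
    unfolding corr_quot_def by (rule subquot_carrier[OF sM])
  have cB: "carrier (Ob ?B a) = ?d a ` Range (G a)" for a
    unfolding corr_quot_def using subquot_carrier[OF sN] by simp
  have AE: "\<exists>x y. (x, y) \<in> G a \<and> X = ?c a x" if "X \<in> carrier (Ob ?A a)" for X a
    using that unfolding cA by blast
  have BE: "\<exists>x y. (x, y) \<in> G a \<and> X = ?d a y" if "X \<in> carrier (Ob ?B a)" for X a
    using that unfolding cB by blast
  have dI: "?d a y \<in> carrier (Ob ?B a)" if "(x, y) \<in> G a" for a x y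
    using that unfolding cB by blast
  have cI: "?c a x \<in> carrier (Ob ?A a)" if "(x, y) \<in> G a" for a x y
    using that unfolding cA by blast
  have addA: "?c a x \<oplus>\<^bsub>Ob ?A a\<^esub> ?c a x' = ?c a (x \<oplus>\<^bsub>Ob M a\<^esub> x')"
    if "(x, y) \<in> G a" "(x', y') \<in> G a" for a x y x' y'
    unfolding corr_quot_def by (rule subquot_add[OF sM]) (use that in auto)
  have addB: "?d a y \<oplus>\<^bsub>Ob ?B a\<^esub> ?d a y' = ?d a (y \<oplus>\<^bsub>Ob N a\<^esub> y')"
    if "(x, y) \<in> G a" "(x', y') \<in> G a" for a x y x' y'
    unfolding corr_quot_def by (rule subquot_add[OF sN]) (use that in auto)
  have smA: "k \<odot>\<^bsub>Ob ?A a\<^esub> ?c a x = ?c a (k \<odot>\<^bsub>Ob M a\<^esub> x)"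
    if "k \<in> carrier K" "(x, y) \<in> G a" for k a x y
    unfolding corr_quot_def by (rule subquot_smult[OF sM]) (use that in auto)
  have smB: "k \<odot>\<^bsub>Ob ?B a\<^esub> ?d a y = ?d a (k \<odot>\<^bsub>Ob N a\<^esub> y)"
    if "k \<in> carrier K" "(x, y) \<in> G a" for k a x y
    unfolding corr_quot_def by (rule subquot_smult[OF sN]) (use that in auto)
  have trA: "Tr ?A a b (?c a x) = ?c b (Tr M a b x)" if "a \<le> b" "(x, y) \<in> G a" for a b x y
    unfolding corr_quot_def by (rule subquot_Tr[OF sM]) (use that in auto)
  have trB: "Tr ?B a b (?d a y) = ?d b (Tr N a b y)" if "a \<le> b" "(x, y) \<in> G a" for a b x y
    unfolding corr_quot_def by (rule subquot_Tr[OF sN]) (use that in auto)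
  \<comment> \<open>Taking images of sets avoids choosing representatives; by \<open>img\<close>,
    the image of a coset is again a coset.\<close>
  define f where "f a X = G a `` X" for a X
  have f: "f a (?c a x) = ?d a y" if "(x, y) \<in> G a" for a x y using img[OF that] by (simp add: f_def)
  have "f a \<in> lhom K (Ob ?A a) (Ob ?B a)" for a
    unfolding LinearCombinations.module_hom_def
  proof (intro CollectI conjI allI impI Pi_I; (elim conjE)?)
    fix X assume "X \<in> carrier (Ob ?A a)"
    then obtain x y where xy: "(x, y) \<in> G a" "X = ?c a x" using AE by blast
    show "f a X \<in> carrier (Ob ?B a)" using f[OF xy(1)] dI[OF xy(1)] xy(2) by simp
  next
    fix X X' assume XX: "X \<in> carrier (Ob ?A a)" "X' \<in> carrier (Ob ?A a)"
    obtain x y where xy: "(x, y) \<in> G a" and X: "X = ?c a x" using AE[OF XX(1)] by blast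
    obtain x' y' where xy': "(x', y') \<in> G a" and X': "X' = ?c a x'" using AE[OF XX(2)] by blast
    show "f a (X \<oplus>\<^bsub>Ob ?A a\<^esub> X') = f a X \<oplus>\<^bsub>Ob ?B a\<^esub> f a X'"
      unfolding X X' addA[OF xy xy'] f[OF lin_rel_add[OF corr_lin_rel[OF G] xy xy']] f[OF xy] f[OF xy']
        addB[OF xy xy'] ..
  next
    fix k X assume k: "k \<in> carrier K" and "X \<in> carrier (Ob ?A a)"
    then obtain x y where xy: "(x, y) \<in> G a" and X: "X = ?c a x" using AE by blast
    show "f a (k \<odot>\<^bsub>Ob ?A a\<^esub> X) = k \<odot>\<^bsub>Ob ?B a\<^esub> f a X"
      unfolding X smA[OF k xy] f[OF lin_rel_smult[OF corr_lin_rel[OF G] xy k]] f[OF xy] smB[OF k xy] ..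
  qed
  moreover have "f b (Tr ?A a b X) = Tr ?B a b (f a X)" if ab: "a \<le> b" and XA: "X \<in> carrier (Ob ?A a)" for a b X
  proof -
    obtain x y where xy: "(x, y) \<in> G a" and X: "X = ?c a x" using AE XA by blast
    show ?thesis unfolding X trA[OF ab xy] f[OF corr_Tr[OF G ab xy]] f[OF xy] trB[OF ab xy] ..
  qed
  ultimately have "f \<in> rep_hom K ?A ?B" by (simp add: rep_hom_def)
  moreover have "bij_betw (f a) (carrier (Ob ?A a)) (carrier (Ob ?B a))" for a
  \<comment> \<open>By \<open>img'\<close>, taking images under the converse relation is the inverse
    map.\<close>
  proof (rule bij_betw_byWitness[where f' = "\<lambda>Y. ?H a `` Y"])
    show "\<forall>X\<in>carrier (Ob ?A a). ?H a `` f a X = X"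
      using AE[of _ a] f[of _ _ a] img'[of _ _ a] by metis
    show "\<forall>Y\<in>carrier (Ob ?B a). f a (?H a `` Y) = Y"
      using BE[of _ a] f[of _ _ a] img'[of _ _ a] by metis
    show "f a ` carrier (Ob ?A a) \<subseteq> carrier (Ob ?B a)"
      by (auto dest!: AE simp: f dI)
    show "(\<lambda>Y. ?H a `` Y) ` carrier (Ob ?B a) \<subseteq> carrier (Ob ?A a)"
      by (auto dest!: BE simp: img' cI simp del: converse_iff)
  qed
  ultimately show ?thesis unfolding rep_iso_def by blast
qed

text \<open>The other direction of Goursat's lemma. Pulling the graph of the isomorphism back along
  the two projections gives \<open>G\<close>; its domain is all of \<open>M1\<close> because the map
  is total, its range all of \<open>N1\<close> by surjectivity, and its null spaces are
  \<open>M2\<close> by injectivity and \<open>N2\<close> because zero goes to zero.\<close>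

lemma subquot_iso_corr:
  assumes M: "M \<in> Rep K" "subrep K M1 M" "subrep K M2 M" "\<And>a. M2 a \<subseteq> M1 a"
    and N: "N \<in> Rep K" "subrep K N1 N" "subrep K N2 N" "\<And>a. N2 a \<subseteq> N1 a"
    and iso: "rep_iso K (quot_rep (restrict_rep M M1) M2) (quot_rep (restrict_rep N N1) N2)"
  obtains G where "corr K M N G" "\<And>a. Domain (G a) = M1 a" "\<And>a. Range (G a) = N1 a"
    "\<And>a. corr_null N G a = M2 a" "\<And>a. corr_null M (\<lambda>a. (G a)\<inverse>) a = N2 a"
proof -
  let ?A = "quot_rep (restrict_rep M M1) M2" and ?B = "quot_rep (restrict_rep N N1) N2"
  let ?c = "\<lambda>a x. M2 a +>\<^bsub>Ob M a\<^esub> x" and ?d = "\<lambda>a y. N2 a +>\<^bsub>Ob N a\<^esub> y"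
  from iso obtain f where f: "f \<in> rep_hom K ?A ?B"
    and bij: "\<And>a. bij_betw (f a) (carrier (Ob ?A a)) (carrier (Ob ?B a))"
    unfolding rep_iso_def by blast
  have fh: "f a \<in> lhom K (Ob ?A a) (Ob ?B a)" for a using f by (simp add: rep_hom_def)
  have nat: "f b (Tr ?A a b X) = Tr ?B a b (f a X)" if "a \<le> b" "X \<in> carrier (Ob ?A a)" for a b X
    using f that by (simp add: rep_hom_def)
  have cA: "carrier (Ob ?A a) = ?c a ` M1 a" and cB: "carrier (Ob ?B a) = ?d a ` N1 a" for a
    using subquot_carrier[OF M] subquot_carrier[OF N] by auto
  have vA: "vectorspace K (Ob ?A a)" and vB: "vectorspace K (Ob ?B a)" for a
    using Rep_vectorspace subquot_Rep[OF M] subquot_Rep[OF N] by blast+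
  have sub: "VectorSpace.subspace K (M1 a) (Ob M a)" "VectorSpace.subspace K (M2 a) (Ob M a)"
    "VectorSpace.subspace K (N1 a) (Ob N a)" "VectorSpace.subspace K (N2 a) (Ob N a)" for a
    using M N by (auto simp: subrep_def)
  have zA: "\<zero>\<^bsub>Ob ?A a\<^esub> = ?c a \<zero>\<^bsub>Ob M a\<^esub>" for a
    unfolding subquot_zero[OF M subspace_zero[OF sub(1)]] quot_coset_zero[OF sub(2)] ..
  have zB: "\<zero>\<^bsub>Ob ?B a\<^esub> = ?d a \<zero>\<^bsub>Ob N a\<^esub>" for a
    unfolding subquot_zero[OF N subspace_zero[OF sub(3)]] quot_coset_zero[OF sub(4)] ..
  have f0: "f a (?c a \<zero>\<^bsub>Ob M a\<^esub>) = ?d a \<zero>\<^bsub>Ob N a\<^esub>" for a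
    using lhom_zero[OF vA vB fh] unfolding zA zB .
  have c0: "?c a m = ?c a \<zero>\<^bsub>Ob M a\<^esub> \<longleftrightarrow> m \<in> M2 a" if "m \<in> M1 a" for a m
    using quot_eq_zero_iff[OF sub(2)] subspace_carrier[OF sub(1) that] by blast
  have d0: "?d a m = ?d a \<zero>\<^bsub>Ob N a\<^esub> \<longleftrightarrow> m \<in> N2 a" if "m \<in> N1 a" for a m
    using quot_eq_zero_iff[OF sub(4)] subspace_carrier[OF sub(3) that] by blast
  have cI: "?c a m \<in> carrier (Ob ?A a)" if "m \<in> M1 a" for a m using that unfolding cA by blast
  \<comment> \<open>The preimage of the graph of \<open>f\<close> in the product of
    \<open>M1 a\<close> and \<open>N1 a\<close>.\<close>
  define G where "G a = {(m, n). m \<in> M1 a \<and> n \<in> N1 a \<and> f a (?c a m) = ?d a n}" for a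
  have addA: "?c a (x \<oplus>\<^bsub>Ob M a\<^esub> x') = ?c a x \<oplus>\<^bsub>Ob ?A a\<^esub> ?c a x'" if "x \<in> M1 a" "x' \<in> M1 a" for a x x'
    by (rule subquot_add[OF M that, symmetric])
  have addB: "?d a (x \<oplus>\<^bsub>Ob N a\<^esub> x') = ?d a x \<oplus>\<^bsub>Ob ?B a\<^esub> ?d a x'" if "x \<in> N1 a" "x' \<in> N1 a" for a x x'
    by (rule subquot_add[OF N that, symmetric])
  have smA: "?c a (k \<odot>\<^bsub>Ob M a\<^esub> x) = k \<odot>\<^bsub>Ob ?A a\<^esub> ?c a x" if "x \<in> M1 a" "k \<in> carrier K" for a x k
    by (rule subquot_smult[OF M that, symmetric])
  have smB: "?d a (k \<odot>\<^bsub>Ob N a\<^esub> x) = k \<odot>\<^bsub>Ob ?B a\<^esub> ?d a x" if "x \<in> N1 a" "k \<in> carrier K" for a x k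
    by (rule subquot_smult[OF N that, symmetric])
  have "lin_rel K (Ob M a) (Ob N a) (G a)" for a
    unfolding lin_rel_def
  proof (intro conjI allI impI)
    show "G a \<subseteq> carrier (Ob M a) \<times> carrier (Ob N a)" 
      using subspace_carrier[OF sub(1)] subspace_carrier[OF sub(3)] unfolding G_def by blast
    show "(\<zero>\<^bsub>Ob M a\<^esub>, \<zero>\<^bsub>Ob N a\<^esub>) \<in> G a" 
      using subspace_zero[OF sub(1)] subspace_zero[OF sub(3)] f0 by (simp add: G_def)
  next
    fix x y x' y' assume "(x, y) \<in> G a" "(x', y') \<in> G a"
    then have 1: "x \<in> M1 a" "x' \<in> M1 a" and 2: "y \<in> N1 a" "y' \<in> N1 a"
      and 3: "f a (?c a x) = ?d a y" "f a (?c a x') = ?d a y'" by (auto simp: G_def)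
    have "f a (?c a (x \<oplus>\<^bsub>Ob M a\<^esub> x')) = ?d a (y \<oplus>\<^bsub>Ob N a\<^esub> y')"
      unfolding addA[OF 1] addB[OF 2] LinearCombinations.module_hom_add[OF fh cI[OF 1(1)] cI[OF 1(2)]] 3 ..
    then show "(x \<oplus>\<^bsub>Ob M a\<^esub> x', y \<oplus>\<^bsub>Ob N a\<^esub> y') \<in> G a" 
      using subspace_add[OF sub(1) 1] subspace_add[OF sub(3) 2] by (simp add: G_def)
  next
    fix k x y assume k: "k \<in> carrier K" and "(x, y) \<in> G a"
    then have 1: "x \<in> M1 a" and 2: "y \<in> N1 a" and 3: "f a (?c a x) = ?d a y" by (auto simp: G_def)
    have "f a (?c a (k \<odot>\<^bsub>Ob M a\<^esub> x)) = ?d a (k \<odot>\<^bsub>Ob N a\<^esub> y)"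
      unfolding smA[OF 1 k] smB[OF 2 k] LinearCombinations.module_hom_smult[OF fh k cI[OF 1]] 3 ..
    then show "(k \<odot>\<^bsub>Ob M a\<^esub> x, k \<odot>\<^bsub>Ob N a\<^esub> y) \<in> G a" 
      using subspace_smult[OF sub(1) k 1] subspace_smult[OF sub(3) k 2] by (simp add: G_def)
  qed
  moreover have "(Tr M a b m, Tr N a b n) \<in> G b" if ab: "a \<le> b" and mn: "(m, n) \<in> G a" for a b m n
  proof -
    have 1: "m \<in> M1 a" and 2: "n \<in> N1 a" and 3: "f a (?c a m) = ?d a n" using mn by (auto simp: G_def)
    have "f b (?c b (Tr M a b m)) = ?d b (Tr N a b n)"
      unfolding subquot_Tr[OF M 1 ab, symmetric] subquot_Tr[OF N 2 ab, symmetric] nat[OF ab cI[OF 1]] 3 ..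
    moreover have "Tr M a b m \<in> M1 b" "Tr N a b n \<in> N1 b"
      using M(2) N(2) ab 1 2 by (auto simp: subrep_def image_subset_iff)
    ultimately show ?thesis by (simp add: G_def)
  qed
  ultimately have "corr K M N G" by (simp add: corr_def)
  moreover have "Domain (G a) = M1 a" for a
  proof -
    have "\<exists>n\<in>N1 a. f a (?c a m) = ?d a n" if "m \<in> M1 a" for m
      using lhom_closed[OF fh cI[OF that]] unfolding cB by blast
    then show ?thesis by (auto simp: G_def)
  qed
  moreover have "Range (G a) = N1 a" for a
  proof -
    have "\<exists>m\<in>M1 a. f a (?c a m) = ?d a n" if "n \<in> N1 a" for n
    proof -
      have "?d a n \<in> f a ` carrier (Ob ?A a)" using bij[of a] that by (auto simp: bij_betw_def cB)
      then show ?thesis unfolding cA by force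
    qed
    then show ?thesis by (auto simp: G_def)
  qed
  moreover have "corr_null N G a = M2 a" for a
  proof -
    have "f a (?c a m) = ?d a \<zero>\<^bsub>Ob N a\<^esub> \<longleftrightarrow> m \<in> M2 a" if m: "m \<in> M1 a" for m
    proof -
      have z: "\<zero>\<^bsub>Ob M a\<^esub> \<in> M1 a" by (rule subspace_zero[OF sub(1)])
      have "f a (?c a m) = f a (?c a \<zero>\<^bsub>Ob M a\<^esub>) \<longleftrightarrow> ?c a m = ?c a \<zero>\<^bsub>Ob M a\<^esub>"
        by (rule inj_on_eq_iff[OF bij_betw_imp_inj_on[OF bij] cI[OF m] cI[OF z]])
      then show ?thesis using c0[OF m] f0[of a] by simp
    qed
    then show ?thesis
      using M(4)[of a] subspace_zero[OF sub(3), of a] by (auto simp: corr_null_def G_def)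
  qed
  moreover have "corr_null M (\<lambda>a. (G a)\<inverse>) a = N2 a" for a
    using d0[of _ a] f0[of a] N(4)[of a] subspace_zero[OF sub(1), of a] by (auto simp: corr_null_def G_def)
  ultimately show thesis using that by blast
qed

section \<open>Common erosion neighborhoods as correspondences\<close>

definition erosion_corr :: "('k, 'm) ring_scheme \<Rightarrow> ('p::order \<Rightarrow> 'p \<Rightarrow> ennreal) \<Rightarrow> real
    \<Rightarrow> ('k, 'p, 'v) rep \<Rightarrow> ('k, 'p, 'w) rep \<Rightarrow> ('p \<Rightarrow> ('v \<times> 'w) set) \<Rightarrow> bool" where
  "erosion_corr K \<rho> r M N G \<longleftrightarrow> corr K M N G \<and>
     (\<forall>a. Im_rep K \<rho> r M a \<subseteq> Domain (G a) \<and> corr_null N G a \<subseteq> Ker_rep \<rho> r M a) \<and>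
     (\<forall>a. Im_rep K \<rho> r N a \<subseteq> Range (G a) \<and> corr_null M (\<lambda>a. (G a)\<inverse>) a \<subseteq> Ker_rep \<rho> r N a)"

text \<open>Under the two directions of Goursat's lemma, \<open>M1\<close>, \<open>N1\<close> become
  the domain and range of \<open>G\<close>, and \<open>M2\<close>, \<open>N2\<close> its null
  spaces. The image and kernel conditions of \<open>EN\<close> then translate word for word.\<close>

lemma EN_Int_iff_erosion_corr:
  assumes M: "M \<in> Rep K" and N: "N \<in> Rep K"
  shows "EN K \<rho> r M \<inter> EN K \<rho> r N \<noteq> {} \<longleftrightarrow> (\<exists>G. erosion_corr K \<rho> r M N G)"
proof
  assume "EN K \<rho> r M \<inter> EN K \<rho> r N \<noteq> {}"
  then obtain Q where "Q \<in> EN K \<rho> r M" "Q \<in> EN K \<rho> r N" by blast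
  then obtain M1 M2 N1 N2 where
      eq: "iso_class K (quot_rep (restrict_rep M M1) M2) = iso_class K (quot_rep (restrict_rep N N1) N2)"
    and M': "subrep K M1 M" "subrep K M2 M" "\<And>a. M2 a \<subseteq> M1 a"
      "\<And>a. Im_rep K \<rho> r M a \<subseteq> M1 a" "\<And>a. M2 a \<subseteq> Ker_rep \<rho> r M a"
    and N': "subrep K N1 N" "subrep K N2 N" "\<And>a. N2 a \<subseteq> N1 a"
      "\<And>a. Im_rep K \<rho> r N a \<subseteq> N1 a" "\<And>a. N2 a \<subseteq> Ker_rep \<rho> r N a"
    unfolding EN_def by clarsimp
  have "rep_iso K (quot_rep (restrict_rep M M1) M2) (quot_rep (restrict_rep N N1) N2)"
    using eq iso_class_eq_iff[OF subquot_Rep[OF M M'(1-3)] subquot_Rep[OF N N'(1-3)]] by simp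
  from subquot_iso_corr[OF M M'(1-3) N N'(1-3) this] obtain G where G: "corr K M N G"
    "\<And>a. Domain (G a) = M1 a" "\<And>a. Range (G a) = N1 a"
    "\<And>a. corr_null N G a = M2 a" "\<And>a. corr_null M (\<lambda>a. (G a)\<inverse>) a = N2 a" by metis
  show "\<exists>G. erosion_corr K \<rho> r M N G"
    by (rule exI[of _ G]) (simp add: erosion_corr_def G M' N')
next
  assume "\<exists>G. erosion_corr K \<rho> r M N G"
  then obtain G where G: "corr K M N G"
    and ImKer: "\<And>a. Im_rep K \<rho> r M a \<subseteq> Domain (G a)" "\<And>a. corr_null N G a \<subseteq> Ker_rep \<rho> r M a"
      "\<And>a. Im_rep K \<rho> r N a \<subseteq> Range (G a)" "\<And>a. corr_null M (\<lambda>a. (G a)\<inverse>) a \<subseteq> Ker_rep \<rho> r N a"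
    unfolding erosion_corr_def by blast
  note H = corr_converse[OF G]
  have "iso_class K (corr_quot M N G) = iso_class K (corr_quot N M (\<lambda>a. (G a)\<inverse>))"
    using corr_quot_iso[OF M N G]
      iso_class_eq_iff[OF subquot_Rep[OF M corr_subrep[OF M N G]] subquot_Rep[OF N corr_subrep[OF N M H]]]
    by (simp add: corr_quot_def)
  moreover have "iso_class K (corr_quot M N G) \<in> EN K \<rho> r M"
    unfolding EN_def corr_quot_def using corr_subrep[OF M N G] ImKer by blast
  moreover have "iso_class K (corr_quot N M (\<lambda>a. (G a)\<inverse>)) \<in> EN K \<rho> r N"
    unfolding EN_def corr_quot_def using corr_subrep[OF N M H] ImKer(3,4)
    by (intro CollectI exI[of _ "\<lambda>a. Domain ((G a)\<inverse>)"] exI[of _ "corr_null M (\<lambda>a. (G a)\<inverse>)"]) auto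
  ultimately show "EN K \<rho> r M \<inter> EN K \<rho> r N \<noteq> {}" by auto
qed

section \<open>Maps out of colimits and into limits\<close>

text \<open>The uniqueness half of the universal property. It lets every identity between linear
  maps out of \<open>Lfun\<close> be checked on the generators
  \<open>colim_in K M S x v\<close>.\<close>

lemma colim_ext:
  assumes K: "field K" and M: "M \<in> Rep K" and U: "vectorspace K U"
    and g: "g \<in> lhom K (colim K M S) U" and h: "h \<in> lhom K (colim K M S) U"
    and eq: "\<And>x v. x \<in> S \<Longrightarrow> v \<in> carrier (Ob M x) \<Longrightarrow> g (colim_in K M S x v) = h (colim_in K M S x v)"
    and X: "X \<in> carrier (colim K M S)"
  shows "g X = h X"
proof -
  let ?C = "colim K M S"
  have in_closed: "colim_in K M S x v \<in> carrier ?C" if "x \<in> S" "v \<in> carrier (Ob M x)" for x v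
    using lhom_closed[OF colim_in_hom[OF K M that(1)] that(2)] .
  interpret C: vectorspace K ?C by (rule colim_vectorspace[OF K M])
  \<comment> \<open>\<open>colim_universal\<close> speaks of extensional functions only, so
    uniqueness is applied to the restrictions of \<open>g\<close> and \<open>h\<close>.\<close>
  have res: "restrict f (carrier ?C) \<in> lhom K ?C U" if "f \<in> lhom K ?C U" for f
    using that by (auto simp: LinearCombinations.module_hom_def)
  have "\<exists>!f. f \<in> lhom K ?C U \<and> f \<in> extensional (carrier ?C) \<and>
     (\<forall>x\<in>S. \<forall>v\<in>carrier (Ob M x). f (colim_in K M S x v) = h (colim_in K M S x v))"
  proof (rule colim_universal[OF K M U])
    fix x assume "x \<in> S"
    then show "(\<lambda>v. h (colim_in K M S x v)) \<in> lhom K (Ob M x) U"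
      by (intro lhom_comp[OF h] colim_in_hom[OF K M])
  next
    fix x y v assume "x \<in> S" "y \<in> S" "x \<le> y" "v \<in> carrier (Ob M x)"
    then show "h (colim_in K M S y (Tr M x y v)) = h (colim_in K M S x v)"
      by (simp add: colim_in_cocone[OF K M])
  qed
  then have "restrict g (carrier ?C) = restrict h (carrier ?C)"
  proof (rule alt_ex1E)
    fix f
    assume *: "\<forall>y y'. (y \<in> lhom K ?C U \<and> y \<in> extensional (carrier ?C) \<and>
          (\<forall>x\<in>S. \<forall>v\<in>carrier (Ob M x). y (colim_in K M S x v) = h (colim_in K M S x v))) \<and>
        (y' \<in> lhom K ?C U \<and> y' \<in> extensional (carrier ?C) \<and>
          (\<forall>x\<in>S. \<forall>v\<in>carrier (Ob M x). y' (colim_in K M S x v) = h (colim_in K M S x v))) \<longrightarrow> y = y'"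
    show ?thesis
      by (rule *[rule_format], intro conjI ballI res g h restrict_extensional) (simp_all add: in_closed eq)
  qed
  then have "restrict g (carrier ?C) X = restrict h (carrier ?C) X" by simp
  then show ?thesis using X by simp
qed

lemma colim_desc:
  assumes "field K" "M \<in> Rep K" "vectorspace K U"
    and "\<And>x. x \<in> S \<Longrightarrow> \<phi> x \<in> lhom K (Ob M x) U"
    and "\<And>x y v. x \<in> S \<Longrightarrow> y \<in> S \<Longrightarrow> x \<le> y \<Longrightarrow> v \<in> carrier (Ob M x) \<Longrightarrow> \<phi> y (Tr M x y v) = \<phi> x v"
  shows colim_desc_hom: "colim_desc K M S U \<phi> \<in> lhom K (colim K M S) U"
    and colim_desc_in: "x \<in> S \<Longrightarrow> v \<in> carrier (Ob M x) \<Longrightarrow> colim_desc K M S U \<phi> (colim_in K M S x v) = \<phi> x v"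
  using theI'[OF colim_universal[where \<phi> = \<phi> and S = S, OF assms]] unfolding colim_desc_def by blast+

text \<open>Limits sit inside products, so a morphism into \<open>Rfun\<close> is a family of maps
  with two indices \<open>a\<close> and \<open>y\<close>: compatible in \<open>y\<close>, linear in
  the vector and natural in \<open>a\<close>. The premises are these conditions, together with
  extensionality.\<close>

lemma Rfun_homI:
  assumes "\<And>a v y. v \<in> carrier (Ob M a) \<Longrightarrow> y \<in> up \<rho> r a \<Longrightarrow> p a v y \<in> carrier (Ob N y)"
    and "\<And>a v. v \<in> carrier (Ob M a) \<Longrightarrow> p a v \<in> extensional (up \<rho> r a)"
    and "\<And>a v y z. v \<in> carrier (Ob M a) \<Longrightarrow> y \<in> up \<rho> r a \<Longrightarrow> z \<in> up \<rho> r a \<Longrightarrow> y \<le> z \<Longrightarrow> Tr N y z (p a v y) = p a v z"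
    and "\<And>a v w y. v \<in> carrier (Ob M a) \<Longrightarrow> w \<in> carrier (Ob M a) \<Longrightarrow> y \<in> up \<rho> r a \<Longrightarrow>
      p a (v \<oplus>\<^bsub>Ob M a\<^esub> w) y = p a v y \<oplus>\<^bsub>Ob N y\<^esub> p a w y"
    and "\<And>a c v y. c \<in> carrier K \<Longrightarrow> v \<in> carrier (Ob M a) \<Longrightarrow> y \<in> up \<rho> r a \<Longrightarrow>
      p a (c \<odot>\<^bsub>Ob M a\<^esub> v) y = c \<odot>\<^bsub>Ob N y\<^esub> p a v y"
    and "\<And>a b v y. a \<le> b \<Longrightarrow> v \<in> carrier (Ob M a) \<Longrightarrow> y \<in> up \<rho> r b \<Longrightarrow> p b (Tr M a b v) y = p a v y"
    and "M \<in> Rep K"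
  shows "p \<in> rep_hom K M (Rfun \<rho> r N)"
proof -
  have "p a \<in> lhom K (Ob M a) (lim N (up \<rho> r a))" for a
  proof -
    interpret vectorspace K "Ob M a" by (rule Rep_vectorspace[OF assms(7)])
    show ?thesis
      unfolding LinearCombinations.module_hom_def lim_def
      using assms(1-5)
      by (auto simp: PiE_iff intro!: extensionalityI[OF assms(2)])
  qed
  moreover have "p b (Tr M a b v) = lim_desc (up \<rho> r b) lim_out (p a v)"
    if "a \<le> b" "v \<in> carrier (Ob M a)" for a b v
    unfolding lim_desc_def lim_out_def
    by (rule extensionalityI[OF assms(2)]) (use that assms(6) Tr_closed[OF assms(7)] in auto)
  ultimately show ?thesis by (simp add: rep_hom_def Rfun_def)
qed

section \<open>Components of a morphism into \<open>Rfun\<close>\<close>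

context
  fixes K :: "('k, 'm) ring_scheme" and \<rho> :: "'p::order \<Rightarrow> 'p \<Rightarrow> ennreal" and r :: real
    and M :: "('k, 'p, 'v) rep" and N :: "('k, 'p, 'w) rep" and p
  assumes p: "p \<in> rep_hom K M (Rfun \<rho> r N)"
begin

lemma Rfun_hom_lim: "p a \<in> lhom K (Ob M a) (lim N (up \<rho> r a))"
  using p by (simp add: rep_hom_def Rfun_def)

lemma Rfun_hom_extensional: "v \<in> carrier (Ob M a) \<Longrightarrow> p a v \<in> extensional (up \<rho> r a)"
  using lhom_closed[OF Rfun_hom_lim] by (auto simp: lim_def PiE_iff)

lemma Rfun_hom_Tr: "v \<in> carrier (Ob M a) \<Longrightarrow> y \<in> up \<rho> r a \<Longrightarrow> z \<in> up \<rho> r a \<Longrightarrow> y \<le> z \<Longrightarrow>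
    Tr N y z (p a v y) = p a v z"
  using lhom_closed[OF Rfun_hom_lim, of v a] by (simp add: lim_def)

lemma Rfun_hom_nat: "a \<le> b \<Longrightarrow> v \<in> carrier (Ob M a) \<Longrightarrow> y \<in> up \<rho> r b \<Longrightarrow> p b (Tr M a b v) y = p a v y"
  using p by (simp add: rep_hom_def Rfun_def lim_desc_def lim_out_def)

lemma Rfun_hom_at: "y \<in> up \<rho> r a \<Longrightarrow> (\<lambda>v. p a v y) \<in> lhom K (Ob M a) (Ob N y)"
  using Rfun_hom_lim[of a] by (auto simp: LinearCombinations.module_hom_def lim_def Pi_iff PiE_iff)

end

text \<open>This symmetry of the index sets is the source of the adjunction: the component of
  \<open>p\<close> at \<open>x\<close> evaluated at \<open>a\<close> is also the component of its
  adjoint at \<open>a\<close> on the summand of \<open>x\<close>.\<close>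

lemma up_iff_down: "y \<in> up \<rho> r x \<longleftrightarrow> x \<in> down \<rho> r y"
  by (simp add: up_def down_def)

lemma down_le: "x \<in> down \<rho> r a \<Longrightarrow> x \<le> a" and up_le: "y \<in> up \<rho> r a \<Longrightarrow> a \<le> y"
  by (auto simp: down_def up_def)

text \<open>Superadditivity of \<rho> bounds \<open>\<rho> x b\<close> below by
  \<open>\<rho> x a\<close>. This inclusion is what defines the structure maps of
  \<open>Lfun\<close>; \<open>up_mono\<close> is the dual fact for \<open>Rfun\<close>.\<close>

lemma down_mono:
  assumes "height_difference \<rho>" "x \<in> down \<rho> r a" "a \<le> b"
  shows "x \<in> down \<rho> r b"
proof -
  have "\<rho> x a + \<rho> a b \<le> \<rho> x b" using assms by (auto simp: height_difference_def down_def)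
  moreover have "\<rho> x a \<le> \<rho> x a + \<rho> a b" by simp
  ultimately show ?thesis using assms(2,3) unfolding down_def by (blast intro: order_trans)
qed

lemma up_mono:
  assumes "height_difference \<rho>" "y \<in> up \<rho> r b" "a \<le> b"
  shows "y \<in> up \<rho> r a"
proof -
  have "\<rho> a b + \<rho> b y \<le> \<rho> a y" using assms by (auto simp: height_difference_def up_def)
  moreover have "\<rho> b y \<le> \<rho> a b + \<rho> b y" by simp
  ultimately show ?thesis using assms(2,3) unfolding up_def by (blast intro: order_trans)
qed

lemma Lfun_Ob [simp]: "Ob (Lfun K \<rho> r M) a = colim K M (down \<rho> r a)"
  by (simp add: Lfun_def)

section \<open>\<open>Lfun\<close>, its counit-like map \<open>etaL\<close> and adjoints, evaluated
  on generators\<close>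

context
  fixes K :: "('k, 'm) ring_scheme" and \<rho> :: "'p::order \<Rightarrow> 'p \<Rightarrow> ennreal" and r :: real
    and M :: "('k, 'p, 'v) rep"
  assumes K: "field K" and M: "M \<in> Rep K"
begin

lemma etaL_hom: "etaL K \<rho> r M a \<in> lhom K (colim K M (down \<rho> r a)) (Ob M a)"
  and etaL_in: "x \<in> down \<rho> r a \<Longrightarrow> v \<in> carrier (Ob M x) \<Longrightarrow>
    etaL K \<rho> r M a (colim_in K M (down \<rho> r a) x v) = Tr M x a v"
  unfolding etaL_def
  using Rep_Tr[OF M] Rep_Tr_comp[OF M] down_le
  by (auto intro!: colim_desc_hom colim_desc_in K M Rep_vectorspace[OF M] dest: down_le)

text \<open>The cocone condition that \<open>colim_desc\<close> requires is the naturality of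
  \<open>p\<close>, read at the fixed point \<open>a\<close>.\<close>

lemma sharp_hom:
    "p \<in> rep_hom K M (Rfun \<rho> r N) \<Longrightarrow> N \<in> Rep K \<Longrightarrow>
      sharp K \<rho> r M N p a \<in> lhom K (colim K M (down \<rho> r a)) (Ob N a)"
  and sharp_in:
    "p \<in> rep_hom K M (Rfun \<rho> r N) \<Longrightarrow> N \<in> Rep K \<Longrightarrow> x \<in> down \<rho> r a \<Longrightarrow> v \<in> carrier (Ob M x) \<Longrightarrow>
      sharp K \<rho> r M N p a (colim_in K M (down \<rho> r a) x v) = p x v a"
proof -
  assume p: "p \<in> rep_hom K M (Rfun \<rho> r N)" and N: "N \<in> Rep K"
  let ?\<phi> = "\<lambda>x. lim_out a \<circ> p x"
  have 1: "?\<phi> x \<in> lhom K (Ob M x) (Ob N a)" if "x \<in> down \<rho> r a" for x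
    using Rfun_hom_at[OF p, of a x] that by (simp add: up_iff_down lim_out_def comp_def)
  have 2: "?\<phi> y (Tr M x y v) = ?\<phi> x v"
    if "x \<in> down \<rho> r a" "y \<in> down \<rho> r a" "x \<le> y" "v \<in> carrier (Ob M x)" for x y v
    using Rfun_hom_nat[OF p that(3,4), of a] that(2) by (simp add: up_iff_down lim_out_def)
  show "sharp K \<rho> r M N p a \<in> lhom K (colim K M (down \<rho> r a)) (Ob N a)"
    unfolding sharp_def by (rule colim_desc_hom[OF K M Rep_vectorspace[OF N] 1 2])
  show "sharp K \<rho> r M N p a (colim_in K M (down \<rho> r a) x v) = p x v a"
    if "x \<in> down \<rho> r a" "v \<in> carrier (Ob M x)"
    unfolding sharp_def using colim_desc_in[where \<phi> = ?\<phi>, OF K M Rep_vectorspace[OF N] 1 2 that]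
    by (simp add: lim_out_def)
qed

lemma Lfun_Tr_hom: "height_difference \<rho> \<Longrightarrow> a \<le> b \<Longrightarrow>
      Tr (Lfun K \<rho> r M) a b \<in> lhom K (colim K M (down \<rho> r a)) (colim K M (down \<rho> r b))"
  and Lfun_Tr_in: "height_difference \<rho> \<Longrightarrow> a \<le> b \<Longrightarrow> x \<in> down \<rho> r a \<Longrightarrow> v \<in> carrier (Ob M x) \<Longrightarrow>
      Tr (Lfun K \<rho> r M) a b (colim_in K M (down \<rho> r a) x v) = colim_in K M (down \<rho> r b) x v"
proof -
  assume \<rho>: "height_difference \<rho>" and ab: "a \<le> b"
  let ?\<phi> = "colim_in K M (down \<rho> r b)"
  have 1: "?\<phi> x \<in> lhom K (Ob M x) (colim K M (down \<rho> r b))" if "x \<in> down \<rho> r a" for x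
    by (rule colim_in_hom[OF K M down_mono[OF \<rho> that ab]])
  have 2: "?\<phi> y (Tr M x y v) = ?\<phi> x v"
    if "x \<in> down \<rho> r a" "y \<in> down \<rho> r a" "x \<le> y" "v \<in> carrier (Ob M x)" for x y v
    by (rule colim_in_cocone[OF K M down_mono[OF \<rho> that(1) ab] down_mono[OF \<rho> that(2) ab] that(3,4)])
  note U = colim_vectorspace[OF K M]
  show "Tr (Lfun K \<rho> r M) a b \<in> lhom K (colim K M (down \<rho> r a)) (colim K M (down \<rho> r b))"
    using colim_desc_hom[where \<phi> = ?\<phi>, OF K M U 1 2] by (simp add: Lfun_def)
  show "Tr (Lfun K \<rho> r M) a b (colim_in K M (down \<rho> r a) x v) = ?\<phi> x v"
    if "x \<in> down \<rho> r a" "v \<in> carrier (Ob M x)"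
    using colim_desc_in[where \<phi> = ?\<phi>, OF K M U 1 2 that] by (simp add: Lfun_def)
qed

lemma etaL_nat:
  assumes \<rho>: "height_difference \<rho>" and ab: "a \<le> b" and X: "X \<in> carrier (colim K M (down \<rho> r a))"
  shows "Tr M a b (etaL K \<rho> r M a X) = etaL K \<rho> r M b (Tr (Lfun K \<rho> r M) a b X)"
proof (rule colim_ext[OF K M Rep_vectorspace[OF M] lhom_comp[OF Rep_Tr[OF M ab] etaL_hom]
      lhom_comp[OF etaL_hom Lfun_Tr_hom[OF \<rho> ab]] _ X])
  fix x v assume x: "x \<in> down \<rho> r a" and v: "v \<in> carrier (Ob M x)"
  show "Tr M a b (etaL K \<rho> r M a (colim_in K M (down \<rho> r a) x v)) =
      etaL K \<rho> r M b (Tr (Lfun K \<rho> r M) a b (colim_in K M (down \<rho> r a) x v))"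
    by (simp add: etaL_in Lfun_Tr_in \<rho> ab x v down_mono[OF \<rho> x ab] Rep_Tr_comp[OF M down_le[OF x]])
qed

text \<open>On a generator from \<open>x\<close> both sides equal \<open>p x v b\<close>: the left
  by compatibility of the family \<open>p x v\<close>, the right by
  \<open>Lfun_Tr_in\<close>.\<close>

lemma sharp_nat:
  assumes p: "p \<in> rep_hom K M (Rfun \<rho> r N)" and N: "N \<in> Rep K"
    and \<rho>: "height_difference \<rho>" and ab: "a \<le> b" and X: "X \<in> carrier (colim K M (down \<rho> r a))"
  shows "Tr N a b (sharp K \<rho> r M N p a X) = sharp K \<rho> r M N p b (Tr (Lfun K \<rho> r M) a b X)"
proof (rule colim_ext[OF K M Rep_vectorspace[OF N] lhom_comp[OF Rep_Tr[OF N ab] sharp_hom[OF p N]]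
      lhom_comp[OF sharp_hom[OF p N] Lfun_Tr_hom[OF \<rho> ab]] _ X])
  fix x v assume x: "x \<in> down \<rho> r a" and v: "v \<in> carrier (Ob M x)"
  have x': "x \<in> down \<rho> r b" by (rule down_mono[OF \<rho> x ab])
  show "Tr N a b (sharp K \<rho> r M N p a (colim_in K M (down \<rho> r a) x v)) =
      sharp K \<rho> r M N p b (Tr (Lfun K \<rho> r M) a b (colim_in K M (down \<rho> r a) x v))"
    using Rfun_hom_Tr[OF p v, of a b] x x' by (simp add: sharp_in[OF p N] Lfun_Tr_in \<rho> ab v up_iff_down)
qed

lemma Tr_in_Im_rep: "x \<in> down \<rho> r a \<Longrightarrow> v \<in> carrier (Ob M x) \<Longrightarrow> Tr M x a v \<in> Im_rep K \<rho> r M a"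
  unfolding Im_rep_def Lfun_Ob
  by (rule image_eqI, rule etaL_in[symmetric]) (auto intro: lhom_closed[OF colim_in_hom[OF K M]])

text \<open>The vectors \<open>Tr M x a v\<close> generate the image of \<open>etaL\<close>. Instead
  of decomposing elements of the colimit, the proof compares two maps into the quotient by
  \<open>W\<close>, the projection after \<open>etaL\<close> and the zero map, on
  generators.\<close>

lemma Im_rep_subset:
  assumes W: "VectorSpace.subspace K W (Ob M a)"
    and "\<And>x v. x \<in> down \<rho> r a \<Longrightarrow> v \<in> carrier (Ob M x) \<Longrightarrow> Tr M x a v \<in> W"
  shows "Im_rep K \<rho> r M a \<subseteq> W"
proof -
  have "etaL K \<rho> r M a X \<in> W" if X: "X \<in> carrier (colim K M (down \<rho> r a))" for X
  proof -
    have ec: "etaL K \<rho> r M a X \<in> carrier (Ob M a)" by (rule lhom_closed[OF etaL_hom X])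
    interpret Q: vectorspace K "quot (Ob M a) W" by (rule quot_vectorspace[OF W])
    have z: "W = W +>\<^bsub>Ob M a\<^esub> \<zero>\<^bsub>Ob M a\<^esub>" using quot_coset_zero[OF W] by simp
    have WQ: "W \<in> carrier (quot (Ob M a) W)" using Q.M.zero_closed by (simp add: quot_def)
    have "W \<oplus>\<^bsub>quot (Ob M a) W\<^esub> W = W" using Q.M.l_zero[OF WQ] by (simp add: quot_def)
    moreover have "c \<odot>\<^bsub>quot (Ob M a) W\<^esub> W = W" if "c \<in> carrier K" for c
      using Q.smult_r_null[OF that] by (simp add: quot_def)
    \<comment> \<open>The constant map with value \<open>W\<close> is the zero map, since
      \<open>W\<close> is the zero of the quotient.\<close>
    ultimately have zero: "(\<lambda>X. W) \<in> lhom K (colim K M (down \<rho> r a)) (quot (Ob M a) W)"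
      using WQ by (auto simp: LinearCombinations.module_hom_def)
    have "W +>\<^bsub>Ob M a\<^esub> etaL K \<rho> r M a X = W"
    proof (rule colim_ext[OF K M Q.vectorspace_axioms lhom_comp[OF quot_proj_hom[OF W] etaL_hom] zero _ X])
      fix x v assume x: "x \<in> down \<rho> r a" and v: "v \<in> carrier (Ob M x)"
      have "Tr M x a v \<in> W" by (rule assms(2)[OF x v])
      then show "W +>\<^bsub>Ob M a\<^esub> etaL K \<rho> r M a (colim_in K M (down \<rho> r a) x v) = W"
        using quot_eq_zero_iff[OF W subspace_carrier[OF W]] z by (simp add: etaL_in x v)
    qed
    then show ?thesis using quot_eq_zero_iff[OF W ec] z by simp
  qed
  then show ?thesis by (auto simp: Im_rep_def)
qed

lemma Ker_rep_iff:
  "v \<in> Ker_rep \<rho> r M a \<longleftrightarrow> v \<in> carrier (Ob M a) \<and> (\<forall>y\<in>up \<rho> r a. Tr M a y v = \<zero>\<^bsub>Ob M y\<^esub>)"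
  by (auto simp: Ker_rep_def a_kernel_def' Rfun_def lim_def etaR_def lim_desc_def fun_eq_iff)

end

section \<open>Erosion correspondences\<close>

text \<open>The \<open>M\<close> half of the conditions in \<open>erosion_corr\<close>, stated on
  vectors. The \<open>N\<close> half is the same predicate for the converse relation, so each later
  argument is given for one side and then applied to both.\<close>

definition erodes :: "('p::order \<Rightarrow> 'p \<Rightarrow> ennreal) \<Rightarrow> real
    \<Rightarrow> ('k, 'p, 'v) rep \<Rightarrow> ('k, 'p, 'w) rep \<Rightarrow> ('p \<Rightarrow> ('v \<times> 'w) set) \<Rightarrow> bool" where
  "erodes \<rho> r M N G \<longleftrightarrow>
     (\<forall>a x v. x \<in> down \<rho> r a \<longrightarrow> v \<in> carrier (Ob M x) \<longrightarrow> Tr M x a v \<in> Domain (G a)) \<and>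
     (\<forall>a y m. y \<in> up \<rho> r a \<longrightarrow> (m, \<zero>\<^bsub>Ob N a\<^esub>) \<in> G a \<longrightarrow> Tr M a y m = \<zero>\<^bsub>Ob M y\<^esub>)"

lemma erodes_Domain:
  "erodes \<rho> r M N G \<Longrightarrow> x \<in> down \<rho> r a \<Longrightarrow> v \<in> carrier (Ob M x) \<Longrightarrow> Tr M x a v \<in> Domain (G a)"
  unfolding erodes_def by blast

lemma erodes_null:
  "erodes \<rho> r M N G \<Longrightarrow> y \<in> up \<rho> r a \<Longrightarrow> (m, \<zero>\<^bsub>Ob N a\<^esub>) \<in> G a \<Longrightarrow> Tr M a y m = \<zero>\<^bsub>Ob M y\<^esub>"
  unfolding erodes_def by blast

lemma erodes_iff:
  assumes K: "field K" and M: "M \<in> Rep K" and N: "N \<in> Rep K" and G: "corr K M N G"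
  shows "erodes \<rho> r M N G \<longleftrightarrow>
    (\<forall>a. Im_rep K \<rho> r M a \<subseteq> Domain (G a) \<and> corr_null N G a \<subseteq> Ker_rep \<rho> r M a)"
proof
  assume e: "erodes \<rho> r M N G"
  have "Im_rep K \<rho> r M a \<subseteq> Domain (G a)" for a
    by (rule Im_rep_subset[OF K M lin_rel_Domain[OF Rep_vectorspace[OF M] corr_lin_rel[OF G]] erodes_Domain[OF e]])
  moreover have "corr_null N G a \<subseteq> Ker_rep \<rho> r M a" for a
    using erodes_null[OF e] lin_rel_left[OF corr_lin_rel[OF G]]
    by (auto simp: Ker_rep_iff[OF K M] corr_null_def)
  ultimately show "\<forall>a. Im_rep K \<rho> r M a \<subseteq> Domain (G a) \<and> corr_null N G a \<subseteq> Ker_rep \<rho> r M a" by simp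
next
  assume *: "\<forall>a. Im_rep K \<rho> r M a \<subseteq> Domain (G a) \<and> corr_null N G a \<subseteq> Ker_rep \<rho> r M a"
  have "Tr M x a v \<in> Domain (G a)" if "x \<in> down \<rho> r a" "v \<in> carrier (Ob M x)" for a x v
    using * Tr_in_Im_rep[OF K M that] by blast
  moreover have "Tr M a y m = \<zero>\<^bsub>Ob M y\<^esub>" if "y \<in> up \<rho> r a" "(m, \<zero>\<^bsub>Ob N a\<^esub>) \<in> G a" for a y m
  proof -
    have "m \<in> corr_null N G a" using that(2) by (simp add: corr_null_def)
    then have "m \<in> Ker_rep \<rho> r M a" using * by blast
    then show ?thesis using that(1) by (simp add: Ker_rep_iff[OF K M])
  qed
  ultimately show "erodes \<rho> r M N G" unfolding erodes_def by blast
qed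

lemma EN_Int_iff:
  assumes K: "field K" and M: "M \<in> Rep K" and N: "N \<in> Rep K"
  shows "EN K \<rho> r M \<inter> EN K \<rho> r N \<noteq> {} \<longleftrightarrow>
    (\<exists>G. corr K M N G \<and> erodes \<rho> r M N G \<and> erodes \<rho> r N M (\<lambda>a. (G a)\<inverse>))"
proof -
  have "erosion_corr K \<rho> r M N G \<longleftrightarrow>
      corr K M N G \<and> erodes \<rho> r M N G \<and> erodes \<rho> r N M (\<lambda>a. (G a)\<inverse>)" for G
    by (cases "corr K M N G")
      (simp_all add: erosion_corr_def erodes_iff[OF K M N] erodes_iff[OF K N M corr_converse])
  then show ?thesis by (simp add: EN_Int_iff_erosion_corr[OF M N])
qed

section \<open>Interpolation by (IV) and composition of correspondences\<close>

lemma ediff_le_imp_ge: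
  assumes d: "ediff u v \<le> ennreal d" "0 \<le> d" and v: "ennreal (w + d) \<le> v" and w: "0 \<le> w"
  shows "ennreal w \<le> u"
proof (cases u)
  case (real u')
  \<comment> \<open>A finite \<open>u\<close> at finite distance from \<open>v\<close> forces
    \<open>v\<close> to be finite, which reduces the claim to real arithmetic.\<close>
  then obtain v' where v': "v = ennreal v'" "0 \<le> v'"
    using d by (cases v) (auto simp: ediff_def top_unique)
  have "\<bar>u' - v'\<bar> \<le> d" using d real v' by (simp add: ediff_def)
  moreover have "w + d \<le> v'" using v v' by (simp add: ennreal_le_iff)
  ultimately show ?thesis using real by (simp add: ennreal_leI)
qed simp

text \<open>The surplus \<open>c\<close> in the height is shared equally between the two steps,
  where it absorbs the two errors of at most \<open>c / 2\<close> that (IV) permits.\<close>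

lemma cond_IV_interpolate:
  assumes c: "cond_IV \<rho> c" "0 \<le> c" and rs: "0 \<le> r" "0 \<le> s" and ab: "a \<in> down \<rho> (r + s + c) b"
  obtains z where "a \<in> down \<rho> r z" "z \<in> down \<rho> s b"
proof -
  \<comment> \<open>The first step then has height at least \<open>r\<close>, and the remaining
    height, at least \<open>s + c / 2\<close>, still leaves \<open>s\<close> after the
    error.\<close>
  let ?t = "r + c / 2"
  have le: "a \<le> b" and \<rho>: "ennreal (r + s + c) \<le> \<rho> a b" using ab by (auto simp: down_def)
  have "ennreal ?t \<le> ennreal (r + s + c)" using assms by (intro ennreal_leI) auto
  with \<rho> have "ennreal ?t \<le> \<rho> a b" by (rule order_trans[rotated])
  moreover have "0 \<le> ?t" using assms by simp
  ultimately obtain z where z: "a \<le> z" "z \<le> b" "ediff (\<rho> a z) (ennreal ?t) \<le> ennreal (c / 2)"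
      "ediff (\<rho> z b) (\<rho> a b - ennreal ?t) \<le> ennreal (c / 2)"
    using c(1) le unfolding cond_IV_def by blast
  have "ennreal (r + s + c) - ennreal ?t = ennreal (r + s + c - ?t)"
    using assms by (intro ennreal_minus) simp
  also have "r + s + c - ?t = s + c / 2" by (simp add: field_simps)
  finally have "ennreal (r + s + c) - ennreal ?t = ennreal (s + c / 2)" .
  then have "ennreal (s + c / 2) \<le> \<rho> a b - ennreal ?t" using ennreal_minus_mono[OF \<rho> order_refl, of "ennreal ?t"] by simp
  then have "ennreal s \<le> \<rho> z b" using ediff_le_imp_ge[OF z(4)] c(2) rs by simp
  moreover have "ennreal r \<le> \<rho> a z" using ediff_le_imp_ge[OF z(3)] c(2) rs by simp
  ultimately show thesis using that z(1,2) by (simp add: down_def)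
qed

text \<open>For the domain, a vector is pushed to an intermediate point where it has a partner under
  \<open>G\<close>, and pushing that partner further puts it in the domain of \<open>H\<close>. For
  the null space, the middle vector is killed first, and then what remains is null for
  \<open>G\<close>.\<close>

lemma erodes_relcomp:
  assumes M: "M \<in> Rep K" and X: "X \<in> Rep K" and G: "corr K M X G" and H: "corr K X N H"
    and eG: "erodes \<rho> r M X G" and eH: "erodes \<rho> s X N H"
    and c: "cond_IV \<rho> c" "0 \<le> c" and rs: "0 \<le> r" "0 \<le> s"
  shows "erodes \<rho> (r + s + c) M N (\<lambda>a. G a O H a)"
  unfolding erodes_def
proof (intro conjI allI impI)
  fix a x v assume x: "x \<in> down \<rho> (r + s + c) a" and v: "v \<in> carrier (Ob M x)"
  obtain z where z: "x \<in> down \<rho> r z" "z \<in> down \<rho> s a" by (rule cond_IV_interpolate[OF c rs x])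
  obtain \<xi> where \<xi>: "(Tr M x z v, \<xi>) \<in> G z" using erodes_Domain[OF eG z(1) v] by blast
  have "Tr X z a \<xi> \<in> Domain (H a)"
    by (rule erodes_Domain[OF eH z(2) lin_rel_right[OF corr_lin_rel[OF G] \<xi>]])
  moreover have "(Tr M x a v, Tr X z a \<xi>) \<in> G a"
    using corr_Tr[OF G down_le[OF z(2)] \<xi>] Rep_Tr_comp[OF M down_le[OF z(1)] down_le[OF z(2)] v] by simp
  ultimately show "Tr M x a v \<in> Domain (G a O H a)" by blast
next
  fix a y m assume y: "y \<in> up \<rho> (r + s + c) a" and m: "(m, \<zero>\<^bsub>Ob N a\<^esub>) \<in> G a O H a"
  \<comment> \<open>The step of height \<open>s\<close> comes first here: \<open>H\<close> must kill
    the middle vector before \<open>G\<close> can kill the image of \<open>m\<close>.\<close>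
  have "a \<in> down \<rho> (s + r + c) y" using y by (simp add: up_iff_down add.commute)
  then obtain z where "a \<in> down \<rho> s z" "z \<in> down \<rho> r y" by (rule cond_IV_interpolate[OF c rs(2,1)])
  then have z: "z \<in> up \<rho> s a" "y \<in> up \<rho> r z" by (simp_all add: up_iff_down)
  obtain \<xi> where \<xi>: "(m, \<xi>) \<in> G a" "(\<xi>, \<zero>\<^bsub>Ob N a\<^esub>) \<in> H a" using m by blast
  have "(Tr M a z m, \<zero>\<^bsub>Ob X z\<^esub>) \<in> G z"
    using corr_Tr[OF G up_le[OF z(1)] \<xi>(1)] erodes_null[OF eH z(1) \<xi>(2)] by simp
  then have "Tr M z y (Tr M a z m) = \<zero>\<^bsub>Ob M y\<^esub>" by (rule erodes_null[OF eG z(2)])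
  then show "Tr M a y m = \<zero>\<^bsub>Ob M y\<^esub>"
    using Rep_Tr_comp[OF M up_le[OF z(1)] up_le[OF z(2)] lin_rel_left[OF corr_lin_rel[OF G] \<xi>(1)]] by simp
qed

lemma EN_Int_trans:
  assumes K: "field K" and M: "M \<in> Rep K" and X: "X \<in> Rep K" and N: "N \<in> Rep K"
    and c: "cond_IV \<rho> c" "0 \<le> c" and rs: "0 \<le> r" "0 \<le> s"
    and EN: "EN K \<rho> r M \<inter> EN K \<rho> r X \<noteq> {}" "EN K \<rho> s X \<inter> EN K \<rho> s N \<noteq> {}"
  shows "EN K \<rho> (r + s + c) M \<inter> EN K \<rho> (r + s + c) N \<noteq> {}"
proof -
  obtain G H where G: "corr K M X G" "erodes \<rho> r M X G" "erodes \<rho> r X M (\<lambda>a. (G a)\<inverse>)"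
    and H: "corr K X N H" "erodes \<rho> s X N H" "erodes \<rho> s N X (\<lambda>a. (H a)\<inverse>)"
    using EN unfolding EN_Int_iff[OF K M X] EN_Int_iff[OF K X N] by blast
  have "erodes \<rho> (r + s + c) M N (\<lambda>a. G a O H a)"
    by (rule erodes_relcomp[OF M X G(1) H(1) G(2) H(2) c rs])
  moreover have "erodes \<rho> (r + s + c) N M (\<lambda>a. (G a O H a)\<inverse>)"
    using erodes_relcomp[OF N X corr_converse[OF H(1)] corr_converse[OF G(1)] H(3) G(3) c rs(2,1)]
    by (simp add: converse_relcomp add.commute)
  ultimately show ?thesis using EN_Int_iff[OF K M N] corr_relcomp[OF G(1) H(1)] by blast
qed

text \<open>The diagonal correspondence has full domain and trivial null space, so it erodes at
  every level, including zero.\<close>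

lemma EN_Int_refl:
  assumes "field K" "M \<in> Rep K"
  shows "EN K \<rho> r M \<inter> EN K \<rho> r M \<noteq> {}"
proof -
  let ?G = "\<lambda>a. Id_on (carrier (Ob M a))"
  have "lin_rel K (Ob M a) (Ob M a) (?G a)" for a
  proof -
    interpret vectorspace K "Ob M a" by (rule Rep_vectorspace[OF assms(2)])
    show ?thesis by (auto simp: lin_rel_def)
  qed
  then have "corr K M M ?G" by (auto simp: corr_def Tr_closed[OF assms(2)])
  moreover have "erodes \<rho> r M M ?G"
    using Tr_closed[OF assms(2)] Rep_Tr_zero[OF assms(2)]
    by (auto simp: erodes_def Id_on_iff dest: down_le up_le)
  ultimately show ?thesis unfolding EN_Int_iff[OF assms(1,2,2)] by (intro exI[of _ ?G]) simp
qed

section \<open>From interleavings to erosion neighborhoods\<close>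

text \<open>The identity of \<open>p\<close> after \<open>etaL\<close> with \<open>etaR\<close>
  after the adjoint of \<open>p\<close>, evaluated at \<open>y\<close>. On a generator from
  \<open>x\<close> both sides are \<open>p x v y\<close>: the left by naturality in the source
  point, the right by compatibility of the family.\<close>

lemma Rfun_hom_etaL:
  assumes K: "field K" and M: "M \<in> Rep K" and N: "N \<in> Rep K" and p: "p \<in> rep_hom K M (Rfun \<rho> r N)"
    and \<rho>: "height_difference \<rho>" and y: "y \<in> up \<rho> r a" and X: "X \<in> carrier (colim K M (down \<rho> r a))"
  shows "p a (etaL K \<rho> r M a X) y = Tr N a y (sharp K \<rho> r M N p a X)"
proof (rule colim_ext[OF K M Rep_vectorspace[OF N] lhom_comp[OF Rfun_hom_at[OF p y] etaL_hom[OF K M]]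
      lhom_comp[OF Rep_Tr[OF N up_le[OF y]] sharp_hom[OF K M p N]] _ X])
  fix x v assume x: "x \<in> down \<rho> r a" and v: "v \<in> carrier (Ob M x)"
  have "Tr N a y (p x v a) = p x v y"
    using Rfun_hom_Tr[OF p v _ up_mono[OF \<rho> y down_le[OF x]] up_le[OF y]] x by (simp add: up_iff_down)
  then show "p a (etaL K \<rho> r M a (colim_in K M (down \<rho> r a) x v)) y =
      Tr N a y (sharp K \<rho> r M N p a (colim_in K M (down \<rho> r a) x v))"
    by (simp add: etaL_in[OF K M x v] sharp_in[OF K M p N x v] Rfun_hom_nat[OF p down_le[OF x] v y])
qed

lemma emap_eq_at:
  assumes "rep_hom_eq (Lfun K \<rho> r M) (emap K \<rho> r M) (rep_comp q (sharp K \<rho> r M N p))"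
    and y: "y \<in> up \<rho> r a" and X: "X \<in> carrier (colim K M (down \<rho> r a))"
  shows "q a (sharp K \<rho> r M N p a X) y = Tr M a y (etaL K \<rho> r M a X)"
proof -
  have "emap K \<rho> r M a X = q a (sharp K \<rho> r M N p a X)"
    using assms(1) X by (simp add: rep_hom_eq_def rep_comp_def)
  moreover have "emap K \<rho> r M a X y = Tr M a y (etaL K \<rho> r M a X)"
    using y by (simp add: emap_def rep_comp_def etaR_def lim_desc_def)
  ultimately show ?thesis by simp
qed

definition interleaving_corr :: "('k, 'm) ring_scheme \<Rightarrow> ('p::order \<Rightarrow> 'p \<Rightarrow> ennreal) \<Rightarrow> real
    \<Rightarrow> ('k, 'p, 'v) rep \<Rightarrow> ('k, 'p, 'w) rep \<Rightarrow> ('p \<Rightarrow> 'v \<Rightarrow> 'p \<Rightarrow> 'w) \<Rightarrow> ('p \<Rightarrow> 'w \<Rightarrow> 'p \<Rightarrow> 'v)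
    \<Rightarrow> 'p \<Rightarrow> ('v \<times> 'w) set" where
  "interleaving_corr K \<rho> r M N p q a =
     {(etaL K \<rho> r M a u \<oplus>\<^bsub>Ob M a\<^esub> sharp K \<rho> r N M q a w, sharp K \<rho> r M N p a u \<oplus>\<^bsub>Ob N a\<^esub> etaL K \<rho> r N a w) | u w.
        u \<in> carrier (colim K M (down \<rho> r a)) \<and> w \<in> carrier (colim K N (down \<rho> r a))}"

context
  fixes K :: "('k, 'm) ring_scheme" and \<rho> :: "'p::order \<Rightarrow> 'p \<Rightarrow> ennreal" and r :: real
    and M :: "('k, 'p, 'v) rep" and N :: "('k, 'p, 'w) rep" and p q
  assumes K: "field K" and \<rho>: "height_difference \<rho>" and M: "M \<in> Rep K" and N: "N \<in> Rep K"
    and p: "p \<in> rep_hom K M (Rfun \<rho> r N)" and q: "q \<in> rep_hom K N (Rfun \<rho> r M)"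
begin

text \<open>The matrix of maps is symmetric under exchanging (\<open>M\<close>, \<open>p\<close>)
  with (\<open>N\<close>, \<open>q\<close>), up to the order of the summands.\<close>

lemma interleaving_corr_converse:
  "(interleaving_corr K \<rho> r M N p q a)\<inverse> = interleaving_corr K \<rho> r N M q p a"
proof -
  interpret A: vectorspace K "Ob M a" by (rule Rep_vectorspace[OF M])
  interpret B: vectorspace K "Ob N a" by (rule Rep_vectorspace[OF N])
  have 1: "etaL K \<rho> r M a u \<oplus>\<^bsub>Ob M a\<^esub> sharp K \<rho> r N M q a w = sharp K \<rho> r N M q a w \<oplus>\<^bsub>Ob M a\<^esub> etaL K \<rho> r M a u"
    and 2: "sharp K \<rho> r M N p a u \<oplus>\<^bsub>Ob N a\<^esub> etaL K \<rho> r N a w = etaL K \<rho> r N a w \<oplus>\<^bsub>Ob N a\<^esub> sharp K \<rho> r M N p a u"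
    if u: "u \<in> carrier (colim K M (down \<rho> r a))" and w: "w \<in> carrier (colim K N (down \<rho> r a))" for u w
    using lhom_closed[OF etaL_hom[OF K M] u] lhom_closed[OF etaL_hom[OF K N] w]
      lhom_closed[OF sharp_hom[OF K M p N] u] lhom_closed[OF sharp_hom[OF K N q M] w]
    by (auto intro: A.M.a_comm B.M.a_comm)
  show ?thesis
  proof (intro subset_antisym subrelI)
    fix n m assume "(n, m) \<in> (interleaving_corr K \<rho> r M N p q a)\<inverse>"
    then obtain u w where u: "u \<in> carrier (colim K M (down \<rho> r a))" and w: "w \<in> carrier (colim K N (down \<rho> r a))"
      and mn: "m = etaL K \<rho> r M a u \<oplus>\<^bsub>Ob M a\<^esub> sharp K \<rho> r N M q a w"
        "n = sharp K \<rho> r M N p a u \<oplus>\<^bsub>Ob N a\<^esub> etaL K \<rho> r N a w"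
      unfolding interleaving_corr_def by auto
    show "(n, m) \<in> interleaving_corr K \<rho> r N M q p a"
      unfolding interleaving_corr_def mn 1[OF u w] 2[OF u w] using u w by blast
  next
    fix n m assume "(n, m) \<in> interleaving_corr K \<rho> r N M q p a"
    then obtain u w where u: "u \<in> carrier (colim K M (down \<rho> r a))" and w: "w \<in> carrier (colim K N (down \<rho> r a))"
      and mn: "m = sharp K \<rho> r N M q a w \<oplus>\<^bsub>Ob M a\<^esub> etaL K \<rho> r M a u"
        "n = etaL K \<rho> r N a w \<oplus>\<^bsub>Ob N a\<^esub> sharp K \<rho> r M N p a u"
      unfolding interleaving_corr_def by auto
    show "(n, m) \<in> (interleaving_corr K \<rho> r M N p q a)\<inverse>"
      unfolding interleaving_corr_def mn converse_iff 1[OF u w, symmetric] 2[OF u w, symmetric] using u w by blast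
  qed
qed

text \<open>The image of a linear map is a linear relation, and stability under the structure maps
  is naturality of \<open>etaL\<close> and of both adjoints.\<close>

lemma interleaving_corr: "corr K M N (interleaving_corr K \<rho> r M N p q)"
proof -
  let ?G = "interleaving_corr K \<rho> r M N p q"
  let ?C = "\<lambda>a. colim K M (down \<rho> r a)" and ?D = "\<lambda>a. colim K N (down \<rho> r a)"
  let ?s = "\<lambda>a. etaL K \<rho> r M a" and ?t = "\<lambda>a. etaL K \<rho> r N a"
    and ?p = "\<lambda>a. sharp K \<rho> r M N p a" and ?q = "\<lambda>a. sharp K \<rho> r N M q a"
  note s = etaL_hom[OF K M, of \<rho> r] and t = etaL_hom[OF K N, of \<rho> r]
    and p' = sharp_hom[OF K M p N] and q' = sharp_hom[OF K N q M]
  have GI: "(?s a u \<oplus>\<^bsub>Ob M a\<^esub> ?q a w, ?p a u \<oplus>\<^bsub>Ob N a\<^esub> ?t a w) \<in> ?G a"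
    if "u \<in> carrier (?C a)" "w \<in> carrier (?D a)" for a u w
    using that unfolding interleaving_corr_def by blast
  have "lin_rel K (Ob M a) (Ob N a) (?G a)" for a
  proof -
    interpret A: vectorspace K "Ob M a" by (rule Rep_vectorspace[OF M])
    interpret B: vectorspace K "Ob N a" by (rule Rep_vectorspace[OF N])
    interpret C: vectorspace K "?C a" by (rule colim_vectorspace[OF K M])
    interpret D: vectorspace K "?D a" by (rule colim_vectorspace[OF K N])
    note cl = lhom_closed[OF s, of _ a] lhom_closed[OF t, of _ a] lhom_closed[OF p', of _ a] lhom_closed[OF q', of _ a]
    note vs = A.vectorspace_axioms B.vectorspace_axioms C.vectorspace_axioms D.vectorspace_axioms
    show ?thesis
      unfolding lin_rel_def
    proof (intro conjI allI impI)
      show "?G a \<subseteq> carrier (Ob M a) \<times> carrier (Ob N a)"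
        unfolding interleaving_corr_def using cl by auto
      show "(\<zero>\<^bsub>Ob M a\<^esub>, \<zero>\<^bsub>Ob N a\<^esub>) \<in> ?G a"
        using GI[OF C.M.zero_closed D.M.zero_closed]
        by (simp add: lhom_zero[OF vs(3,1) s] lhom_zero[OF vs(4,2) t] lhom_zero[OF vs(3,2) p'] lhom_zero[OF vs(4,1) q'])
    next
      fix x y x' y' assume "(x, y) \<in> ?G a" "(x', y') \<in> ?G a"
      then obtain u w u' w' where u: "u \<in> carrier (?C a)" "u' \<in> carrier (?C a)"
        and w: "w \<in> carrier (?D a)" "w' \<in> carrier (?D a)"
        and xy: "x = ?s a u \<oplus>\<^bsub>Ob M a\<^esub> ?q a w" "y = ?p a u \<oplus>\<^bsub>Ob N a\<^esub> ?t a w"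
          "x' = ?s a u' \<oplus>\<^bsub>Ob M a\<^esub> ?q a w'" "y' = ?p a u' \<oplus>\<^bsub>Ob N a\<^esub> ?t a w'"
        unfolding interleaving_corr_def by auto
      have "x \<oplus>\<^bsub>Ob M a\<^esub> x' = ?s a (u \<oplus>\<^bsub>?C a\<^esub> u') \<oplus>\<^bsub>Ob M a\<^esub> ?q a (w \<oplus>\<^bsub>?D a\<^esub> w')"
        unfolding xy LinearCombinations.module_hom_add[OF s u] LinearCombinations.module_hom_add[OF q' w]
        using cl u w by (simp add: A.M.a_ac)
      moreover have "y \<oplus>\<^bsub>Ob N a\<^esub> y' = ?p a (u \<oplus>\<^bsub>?C a\<^esub> u') \<oplus>\<^bsub>Ob N a\<^esub> ?t a (w \<oplus>\<^bsub>?D a\<^esub> w')"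
        unfolding xy LinearCombinations.module_hom_add[OF p' u] LinearCombinations.module_hom_add[OF t w]
        using cl u w by (simp add: B.M.a_ac)
      ultimately show "(x \<oplus>\<^bsub>Ob M a\<^esub> x', y \<oplus>\<^bsub>Ob N a\<^esub> y') \<in> ?G a"
        using GI[of "u \<oplus>\<^bsub>?C a\<^esub> u'" a "w \<oplus>\<^bsub>?D a\<^esub> w'"] u w by simp
    next
      fix c x y assume c: "c \<in> carrier K" and "(x, y) \<in> ?G a"
      then obtain u w where u: "u \<in> carrier (?C a)" and w: "w \<in> carrier (?D a)"
        and xy: "x = ?s a u \<oplus>\<^bsub>Ob M a\<^esub> ?q a w" "y = ?p a u \<oplus>\<^bsub>Ob N a\<^esub> ?t a w"
        unfolding interleaving_corr_def by auto
      have "c \<odot>\<^bsub>Ob M a\<^esub> x = ?s a (c \<odot>\<^bsub>?C a\<^esub> u) \<oplus>\<^bsub>Ob M a\<^esub> ?q a (c \<odot>\<^bsub>?D a\<^esub> w)"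
        unfolding xy LinearCombinations.module_hom_smult[OF s c u] LinearCombinations.module_hom_smult[OF q' c w]
        using cl u w c by (simp add: A.smult_r_distr)
      moreover have "c \<odot>\<^bsub>Ob N a\<^esub> y = ?p a (c \<odot>\<^bsub>?C a\<^esub> u) \<oplus>\<^bsub>Ob N a\<^esub> ?t a (c \<odot>\<^bsub>?D a\<^esub> w)"
        unfolding xy LinearCombinations.module_hom_smult[OF p' c u] LinearCombinations.module_hom_smult[OF t c w]
        using cl u w c by (simp add: B.smult_r_distr)
      ultimately show "(c \<odot>\<^bsub>Ob M a\<^esub> x, c \<odot>\<^bsub>Ob N a\<^esub> y) \<in> ?G a"
        using GI[of "c \<odot>\<^bsub>?C a\<^esub> u" a "c \<odot>\<^bsub>?D a\<^esub> w"] u w c by simp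
    qed
  qed
  moreover have "(Tr M a b m, Tr N a b n) \<in> ?G b" if ab: "a \<le> b" and mn: "(m, n) \<in> ?G a" for a b m n
  proof -
    obtain u w where u: "u \<in> carrier (?C a)" and w: "w \<in> carrier (?D a)"
      and xy: "m = ?s a u \<oplus>\<^bsub>Ob M a\<^esub> ?q a w" "n = ?p a u \<oplus>\<^bsub>Ob N a\<^esub> ?t a w"
      using mn unfolding interleaving_corr_def by auto
    let ?u = "Tr (Lfun K \<rho> r M) a b u" and ?w = "Tr (Lfun K \<rho> r N) a b w"
    have "Tr M a b m = ?s b ?u \<oplus>\<^bsub>Ob M b\<^esub> ?q b ?w"
      unfolding xy LinearCombinations.module_hom_add[OF Rep_Tr[OF M ab] lhom_closed[OF s u] lhom_closed[OF q' w]]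
        etaL_nat[OF K M \<rho> ab u] sharp_nat[OF K N q M \<rho> ab w] ..
    moreover have "Tr N a b n = ?p b ?u \<oplus>\<^bsub>Ob N b\<^esub> ?t b ?w"
      unfolding xy LinearCombinations.module_hom_add[OF Rep_Tr[OF N ab] lhom_closed[OF p' u] lhom_closed[OF t w]]
        etaL_nat[OF K N \<rho> ab w] sharp_nat[OF K M p N \<rho> ab u] ..
    ultimately show ?thesis
      using GI[OF lhom_closed[OF Lfun_Tr_hom[OF K M \<rho> ab] u] lhom_closed[OF Lfun_Tr_hom[OF K N \<rho> ab] w]] by simp
  qed
  ultimately show ?thesis by (simp add: corr_def)
qed

text \<open>Setting \<open>w\<close> to zero puts the image of \<open>etaL\<close> into the domain.
  For the null space, the interleaving identity and \<open>Rfun_hom_etaL\<close> show that pushing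
  \<open>m\<close> to \<open>y\<close> amounts to applying \<open>q\<close> to its partner, which is
  zero.\<close>

lemma interleaving_corr_erodes:
  assumes eM: "rep_hom_eq (Lfun K \<rho> r M) (emap K \<rho> r M) (rep_comp q (sharp K \<rho> r M N p))"
  shows "erodes \<rho> r M N (interleaving_corr K \<rho> r M N p q)"
  unfolding erodes_def
proof (intro conjI allI impI)
  let ?G = "interleaving_corr K \<rho> r M N p q"
  let ?C = "\<lambda>a. colim K M (down \<rho> r a)" and ?D = "\<lambda>a. colim K N (down \<rho> r a)"
  let ?s = "\<lambda>a. etaL K \<rho> r M a" and ?t = "\<lambda>a. etaL K \<rho> r N a"
    and ?p = "\<lambda>a. sharp K \<rho> r M N p a" and ?q = "\<lambda>a. sharp K \<rho> r N M q a"
  note s = etaL_hom[OF K M, of \<rho> r] and t = etaL_hom[OF K N, of \<rho> r]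
    and p' = sharp_hom[OF K M p N] and q' = sharp_hom[OF K N q M]
  {
    fix a x v assume x: "x \<in> down \<rho> r a" and v: "v \<in> carrier (Ob M x)"
    interpret A: vectorspace K "Ob M a" by (rule Rep_vectorspace[OF M])
    interpret D: vectorspace K "?D a" by (rule colim_vectorspace[OF K N])
    let ?u = "colim_in K M (down \<rho> r a) x v"
    have u: "?u \<in> carrier (?C a)" by (rule lhom_closed[OF colim_in_hom[OF K M x] v])
    have "(?s a ?u \<oplus>\<^bsub>Ob M a\<^esub> ?q a \<zero>\<^bsub>?D a\<^esub>, ?p a ?u \<oplus>\<^bsub>Ob N a\<^esub> ?t a \<zero>\<^bsub>?D a\<^esub>) \<in> ?G a"
      unfolding interleaving_corr_def using u D.M.zero_closed by blast
    moreover have "?s a ?u \<oplus>\<^bsub>Ob M a\<^esub> ?q a \<zero>\<^bsub>?D a\<^esub> = Tr M x a v"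
      using Tr_closed[OF M down_le[OF x] v]
      by (simp add: etaL_in[OF K M x v] lhom_zero[OF D.vectorspace_axioms A.vectorspace_axioms q'])
    ultimately show "Tr M x a v \<in> Domain (?G a)" by auto
  next
    fix a y m assume y: "y \<in> up \<rho> r a" and m: "(m, \<zero>\<^bsub>Ob N a\<^esub>) \<in> ?G a"
    obtain u w where u: "u \<in> carrier (?C a)" and w: "w \<in> carrier (?D a)"
      and xy: "m = ?s a u \<oplus>\<^bsub>Ob M a\<^esub> ?q a w" "\<zero>\<^bsub>Ob N a\<^esub> = ?p a u \<oplus>\<^bsub>Ob N a\<^esub> ?t a w"
      using m unfolding interleaving_corr_def by auto
    have "Tr M a y m = Tr M a y (?s a u) \<oplus>\<^bsub>Ob M y\<^esub> Tr M a y (?q a w)"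
      unfolding xy by (rule LinearCombinations.module_hom_add[OF Rep_Tr[OF M up_le[OF y]] lhom_closed[OF s u] lhom_closed[OF q' w]])
    \<comment> \<open>The first summand is rewritten by the interleaving identity for
      \<open>M\<close>, the second by exchanging \<open>q\<close> with its adjoint; now
      \<open>q\<close> can be pulled out of the sum.\<close>
    also have "\<dots> = q a (?p a u) y \<oplus>\<^bsub>Ob M y\<^esub> q a (?t a w) y"
      unfolding emap_eq_at[OF eM y u] Rfun_hom_etaL[OF K N M q \<rho> y w] ..
    also have "\<dots> = q a \<zero>\<^bsub>Ob N a\<^esub> y"
      unfolding xy LinearCombinations.module_hom_add[OF Rfun_hom_at[OF q y] lhom_closed[OF p' u] lhom_closed[OF t w]] ..
    also have "\<dots> = \<zero>\<^bsub>Ob M y\<^esub>"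
      by (rule lhom_zero[OF Rep_vectorspace[OF N] Rep_vectorspace[OF M] Rfun_hom_at[OF q y]])
    finally show "Tr M a y m = \<zero>\<^bsub>Ob M y\<^esub>" .
  }
qed

end

lemma interleaved_imp_EN_Int:
  assumes K: "field K" and \<rho>: "height_difference \<rho>" and M: "M \<in> Rep K" and N: "N \<in> Rep K"
    and "height_interleaved K \<rho> r M N"
  shows "EN K \<rho> r M \<inter> EN K \<rho> r N \<noteq> {}"
proof -
  from assms(5) obtain p q where p: "p \<in> rep_hom K M (Rfun \<rho> r N)" and q: "q \<in> rep_hom K N (Rfun \<rho> r M)"
    and eM: "rep_hom_eq (Lfun K \<rho> r M) (emap K \<rho> r M) (rep_comp q (sharp K \<rho> r M N p))"
    and eN: "rep_hom_eq (Lfun K \<rho> r N) (emap K \<rho> r N) (rep_comp p (sharp K \<rho> r N M q))"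
    unfolding height_interleaved_def by blast
  have "erodes \<rho> r N M (\<lambda>a. (interleaving_corr K \<rho> r M N p q a)\<inverse>)"
    unfolding interleaving_corr_converse[OF K \<rho> M N p q] by (rule interleaving_corr_erodes[OF K \<rho> N M q p eN])
  then show ?thesis
    using interleaving_corr[OF K \<rho> M N p q] interleaving_corr_erodes[OF K \<rho> M N p q eM]
      EN_Int_iff[OF K M N] by blast
qed

section \<open>From erosion neighborhoods to interleavings\<close>

text \<open>A relation rather than a function, because both the intermediate point \<open>z\<close>
  and the partner \<open>n\<close> are choices. Independence of them is
  \<open>transfer_indep\<close>.\<close>

definition corr_transfer :: "('p::order \<Rightarrow> 'p \<Rightarrow> ennreal) \<Rightarrow> real
    \<Rightarrow> ('k, 'p, 'v) rep \<Rightarrow> ('k, 'p, 'w) rep \<Rightarrow> ('p \<Rightarrow> ('v \<times> 'w) set) \<Rightarrow> 'p \<Rightarrow> 'v \<Rightarrow> 'p \<Rightarrow> 'w \<Rightarrow> bool" where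
  "corr_transfer \<rho> r M N G a m y w \<longleftrightarrow>
     (\<exists>z\<in>down \<rho> r y \<inter> up \<rho> r a. \<exists>n. (Tr M a z m, n) \<in> G z \<and> w = Tr N z y n)"

text \<open>The assumptions are symmetric under passing to the converse relation, so a second
  interpretation provides the transfer from \<open>N\<close> back to \<open>M\<close>.\<close>

locale eroding_corr =
  fixes K :: "('k, 'm) ring_scheme" and \<rho> :: "'p::order \<Rightarrow> 'p \<Rightarrow> ennreal" and r :: real
    and M :: "('k, 'p, 'v) rep" and N :: "('k, 'p, 'w) rep" and G
  assumes M: "M \<in> Rep K" and N: "N \<in> Rep K"
    and \<rho>: "height_difference \<rho>" and CIP: "CIP \<rho>" and r: "0 \<le> r"
    and G: "corr K M N G" and eM: "erodes \<rho> r M N G" and eN: "erodes \<rho> r N M (\<lambda>a. (G a)\<inverse>)"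
begin

text \<open>Pushing \<open>n\<close> from \<open>z\<close> to \<open>z'\<close> yields another
  partner of the vector that has partner \<open>n'\<close>. Two partners differ by a vector related
  to zero, which the step from \<open>z'\<close> to \<open>y\<close> kills by \<open>eN\<close>. The
  case of equal points gives independence of the partner.\<close>

lemma transfer_mono:
  assumes m: "m \<in> carrier (Ob M a)" and z: "a \<le> z" "z \<le> z'" "z' \<in> down \<rho> r y"
    and n: "(Tr M a z m, n) \<in> G z" "(Tr M a z' m, n') \<in> G z'"
  shows "Tr N z y n = Tr N z' y n'"
proof -
  interpret A: vectorspace K "Ob M z'" by (rule Rep_vectorspace[OF M])
  interpret B: vectorspace K "Ob N z'" by (rule Rep_vectorspace[OF N])
  interpret Y: vectorspace K "Ob N y" by (rule Rep_vectorspace[OF N])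
  note cl = lin_rel_left[OF corr_lin_rel[OF G]] lin_rel_right[OF corr_lin_rel[OF G]]
  let ?n = "Tr N z z' n"
  have "(Tr M a z' m, ?n) \<in> G z'"
    using corr_Tr[OF G z(2) n(1)] by (simp add: Rep_Tr_comp[OF M z(1,2) m])
  from lin_rel_minus[OF A.vectorspace_axioms B.vectorspace_axioms corr_lin_rel[OF G] this n(2)]
  have "(\<zero>\<^bsub>Ob M z'\<^esub>, ?n \<ominus>\<^bsub>Ob N z'\<^esub> n') \<in> G z'"
    using cl(1)[OF n(2)] by (simp add: A.M.minus_eq A.M.r_neg)
  then have 0: "Tr N z' y (?n \<ominus>\<^bsub>Ob N z'\<^esub> n') = \<zero>\<^bsub>Ob N y\<^esub>"
    using erodes_null[OF eN, of y z'] z(3) by (simp add: up_iff_down)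
  have nc: "?n \<in> carrier (Ob N z')" "n' \<in> carrier (Ob N z')"
    using Tr_closed[OF N z(2) cl(2)[OF n(1)]] cl(2)[OF n(2)] by auto
  have "?n = (?n \<ominus>\<^bsub>Ob N z'\<^esub> n') \<oplus>\<^bsub>Ob N z'\<^esub> n'" using nc by (simp add: B.M.minus_eq B.M.a_assoc B.M.l_neg)
  then have "Tr N z' y ?n = Tr N z' y (?n \<ominus>\<^bsub>Ob N z'\<^esub> n') \<oplus>\<^bsub>Ob N y\<^esub> Tr N z' y n'"
    using LinearCombinations.module_hom_add[OF Rep_Tr[OF N down_le[OF z(3)]] _ nc(2), of "?n \<ominus>\<^bsub>Ob N z'\<^esub> n'"] nc
    by (simp add: B.M.minus_eq)
  also have "\<dots> = Tr N z' y n'" using 0 Tr_closed[OF N down_le[OF z(3)] nc(2)] by simp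
  finally show ?thesis using Rep_Tr_comp[OF N z(2) down_le[OF z(3)] cl(2)[OF n(1)]] by simp
qed

text \<open>The connected intersections property enters here: along a zigzag of comparable intermediate
  points the transferred vector does not change.\<close>

lemma transfer_indep:
  assumes m: "m \<in> carrier (Ob M a)"
    and z: "z \<in> down \<rho> r y \<inter> up \<rho> r a" "z' \<in> down \<rho> r y \<inter> up \<rho> r a"
    and n: "(Tr M a z m, n) \<in> G z" "(Tr M a z' m, n') \<in> G z'"
  shows "Tr N z y n = Tr N z' y n'"
proof -
  let ?S = "down \<rho> r y \<inter> up \<rho> r a"
  have "zigzag_connected ?S" using CIP r z(1) unfolding CIP_def by blast
  then have "(z, z') \<in> {(u, v). u \<in> ?S \<and> v \<in> ?S \<and> (u \<le> v \<or> v \<le> u)}\<^sup>*"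
    using z unfolding zigzag_connected_def by blast
  \<comment> \<open>Quantifying over the partner at the endpoint lets the induction choose a fresh
    partner \<open>k\<close> at each intermediate point; \<open>eM\<close> guarantees that one
    exists.\<close>
  then have "\<forall>n'. (Tr M a z' m, n') \<in> G z' \<longrightarrow> Tr N z y n = Tr N z' y n'"
  proof (induction rule: rtrancl_induct)
    case base
    then show ?case using transfer_mono[OF m, of z z y n] z(1) n(1) by (auto dest: up_le)
  next
    case (step u v)
    then have u: "u \<in> down \<rho> r y" "u \<in> up \<rho> r a" and v: "v \<in> down \<rho> r y" "v \<in> up \<rho> r a"
      and uv: "u \<le> v \<or> v \<le> u" by auto
    have "a \<in> down \<rho> r u" using u(2) by (simp add: up_iff_down)
    then obtain k where k: "(Tr M a u m, k) \<in> G u" using erodes_Domain[OF eM _ m] by blast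
    then have "Tr N z y n = Tr N u y k" using step.IH by blast
    moreover have "Tr N u y k = Tr N v y l" if l: "(Tr M a v m, l) \<in> G v" for l
      using uv transfer_mono[OF m up_le[OF u(2)] _ v(1) k l] transfer_mono[OF m up_le[OF v(2)] _ u(1) l k]
      by auto
    ultimately show ?case by auto
  qed
  then show ?thesis using n(2) by blast
qed

lemma corr_transfer_unique:
  assumes "m \<in> carrier (Ob M a)" "corr_transfer \<rho> r M N G a m y w" "corr_transfer \<rho> r M N G a m y w'"
  shows "w = w'"
  using assms(2,3) transfer_indep[OF assms(1)] unfolding corr_transfer_def by blast

lemma corr_transfer_ex:
  assumes m: "m \<in> carrier (Ob M a)" and z: "z \<in> down \<rho> r y" "z \<in> up \<rho> r a"
  obtains n where "(Tr M a z m, n) \<in> G z" "corr_transfer \<rho> r M N G a m y (Tr N z y n)"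
proof -
  have "Tr M a z m \<in> Domain (G z)" using erodes_Domain[OF eM _ m] z(2) by (simp add: up_iff_down)
  then show thesis using that z unfolding corr_transfer_def by blast
qed

text \<open>The level \<open>t\<close> of the target \<open>Rfun\<close> is independent of the
  erosion level \<open>r\<close>; it only has to be large enough for intermediate points to
  exist.\<close>

definition transfer_map :: "real \<Rightarrow> 'p \<Rightarrow> 'v \<Rightarrow> 'p \<Rightarrow> 'w" where
  "transfer_map t a m = (\<lambda>y\<in>up \<rho> t a. THE w. corr_transfer \<rho> r M N G a m y w)"

lemma transfer_map_eq:
  assumes "m \<in> carrier (Ob M a)" "y \<in> up \<rho> t a" "corr_transfer \<rho> r M N G a m y w"
  shows "transfer_map t a m y = w"
  unfolding transfer_map_def using assms corr_transfer_unique[OF assms(1)] by (simp add: the_equality)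

text \<open>The value may be computed with any intermediate point and any partner, so later proofs
  pick whichever are convenient.\<close>

lemma transfer_map_at:
  assumes "m \<in> carrier (Ob M a)" "y \<in> up \<rho> t a" "z \<in> down \<rho> r y" "z \<in> up \<rho> r a" "(Tr M a z m, n) \<in> G z"
  shows "transfer_map t a m y = Tr N z y n"
  by (rule transfer_map_eq[OF assms(1,2)]) (use assms(3-5) in \<open>auto simp: corr_transfer_def\<close>)

text \<open>In each condition one intermediate point serves both sides: it stays admissible when
  \<open>y\<close> moves up or \<open>a\<close> moves down, and sums and multiples of partners are
  partners.\<close>

lemma transfer_map_hom:
  assumes mid: "\<And>a y. y \<in> up \<rho> t a \<Longrightarrow> \<exists>z. z \<in> down \<rho> r y \<and> z \<in> up \<rho> r a"
  shows "transfer_map t \<in> rep_hom K M (Rfun \<rho> t N)"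
proof -
  have witness: "\<exists>z n. z \<in> down \<rho> r y \<and> z \<in> up \<rho> r a \<and> (Tr M a z m, n) \<in> G z \<and> n \<in> carrier (Ob N z)"
    if m: "m \<in> carrier (Ob M a)" and y: "y \<in> up \<rho> t a" for a m y
  proof -
    obtain z where z: "z \<in> down \<rho> r y" "z \<in> up \<rho> r a" using mid[OF y] by blast
    obtain n where "(Tr M a z m, n) \<in> G z" by (rule corr_transfer_ex[OF m z])
    then show ?thesis using z lin_rel_right[OF corr_lin_rel[OF G]] by blast
  qed
  show ?thesis
  proof (rule Rfun_homI[OF _ _ _ _ _ _ M])
    fix a m y assume m: "m \<in> carrier (Ob M a)" and y: "y \<in> up \<rho> t a"
    obtain z n where z: "z \<in> down \<rho> r y" "z \<in> up \<rho> r a" and n: "(Tr M a z m, n) \<in> G z" "n \<in> carrier (Ob N z)"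
      using witness[OF m y] by blast
    show "transfer_map t a m y \<in> carrier (Ob N y)"
      unfolding transfer_map_at[OF m y z n(1)] by (rule Tr_closed[OF N down_le[OF z(1)] n(2)])
    {
      fix y' assume y': "y' \<in> up \<rho> t a" and le: "y \<le> y'"
      show "Tr N y y' (transfer_map t a m y) = transfer_map t a m y'"
        unfolding transfer_map_at[OF m y z n(1)] transfer_map_at[OF m y' down_mono[OF \<rho> z(1) le] z(2) n(1)]
        by (rule Rep_Tr_comp[OF N down_le[OF z(1)] le n(2)])
    }
    {
      fix m' assume m': "m' \<in> carrier (Ob M a)"
      interpret A: vectorspace K "Ob M a" by (rule Rep_vectorspace[OF M])
      obtain n' where n': "(Tr M a z m', n') \<in> G z" by (rule corr_transfer_ex[OF m' z])
      have n'c: "n' \<in> carrier (Ob N z)" by (rule lin_rel_right[OF corr_lin_rel[OF G] n'])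
      have "(Tr M a z (m \<oplus>\<^bsub>Ob M a\<^esub> m'), n \<oplus>\<^bsub>Ob N z\<^esub> n') \<in> G z"
        unfolding LinearCombinations.module_hom_add[OF Rep_Tr[OF M up_le[OF z(2)]] m m']
        by (rule lin_rel_add[OF corr_lin_rel[OF G] n(1) n'])
      from transfer_map_at[OF A.M.a_closed[OF m m'] y z this]
      show "transfer_map t a (m \<oplus>\<^bsub>Ob M a\<^esub> m') y = transfer_map t a m y \<oplus>\<^bsub>Ob N y\<^esub> transfer_map t a m' y"
        unfolding transfer_map_at[OF m y z n(1)] transfer_map_at[OF m' y z n']
          LinearCombinations.module_hom_add[OF Rep_Tr[OF N down_le[OF z(1)]] n(2) n'c] .
    }
    {
      fix c assume c: "c \<in> carrier K"
      interpret A: vectorspace K "Ob M a" by (rule Rep_vectorspace[OF M])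
      have "(Tr M a z (c \<odot>\<^bsub>Ob M a\<^esub> m), c \<odot>\<^bsub>Ob N z\<^esub> n) \<in> G z"
        unfolding LinearCombinations.module_hom_smult[OF Rep_Tr[OF M up_le[OF z(2)]] c m]
        by (rule lin_rel_smult[OF corr_lin_rel[OF G] n(1) c])
      from transfer_map_at[OF A.smult_closed[OF c m] y z this]
      show "transfer_map t a (c \<odot>\<^bsub>Ob M a\<^esub> m) y = c \<odot>\<^bsub>Ob N y\<^esub> transfer_map t a m y"
        unfolding transfer_map_at[OF m y z n(1)]
          LinearCombinations.module_hom_smult[OF Rep_Tr[OF N down_le[OF z(1)]] c n(2)] .
    }
  next
    fix a m assume "m \<in> carrier (Ob M a)"
    show "transfer_map t a m \<in> extensional (up \<rho> t a)" by (simp add: transfer_map_def)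
  next
    fix a b m y assume ab: "a \<le> b" and m: "m \<in> carrier (Ob M a)" and y: "y \<in> up \<rho> t b"
    have m': "Tr M a b m \<in> carrier (Ob M b)" by (rule Tr_closed[OF M ab m])
    obtain z n where z: "z \<in> down \<rho> r y" "z \<in> up \<rho> r b" and n: "(Tr M b z (Tr M a b m), n) \<in> G z"
      using witness[OF m' y] by blast
    have "(Tr M a z m, n) \<in> G z" using n by (simp add: Rep_Tr_comp[OF M ab up_le[OF z(2)] m])
    from transfer_map_at[OF m up_mono[OF \<rho> y ab] z(1) up_mono[OF \<rho> z(2) ab] this]
    show "transfer_map t b (Tr M a b m) y = transfer_map t a m y"
      unfolding transfer_map_at[OF m' y z n] by simp
  qed
qed

end

lemma eroding_corr_converse:
  "eroding_corr K \<rho> r M N G \<Longrightarrow> eroding_corr K \<rho> r N M (\<lambda>a. (G a)\<inverse>)"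
  by (simp add: eroding_corr_def corr_converse)

text \<open>On a generator from \<open>x\<close>, the transfer \<open>p\<close> passes through
  \<open>z\<close> between \<open>x\<close> and \<open>a\<close>, and \<open>q\<close> through
  \<open>z'\<close> between \<open>a\<close> and \<open>y\<close>. The original vector, pushed to
  \<open>z'\<close>, is an admissible partner for the second transfer, so the round trip is the
  structure map from \<open>x\<close> to \<open>y\<close>.\<close>

lemma transfer_emap:
  assumes "eroding_corr K \<rho> r M N G" and K: "field K"
    and mid: "\<And>a y. y \<in> up \<rho> t a \<Longrightarrow> \<exists>z. z \<in> down \<rho> r y \<and> z \<in> up \<rho> r a"
  defines "p \<equiv> eroding_corr.transfer_map \<rho> r M N G t"
    and "q \<equiv> eroding_corr.transfer_map \<rho> r N M (\<lambda>a. (G a)\<inverse>) t"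
  shows "rep_hom_eq (Lfun K \<rho> t M) (emap K \<rho> t M) (rep_comp q (sharp K \<rho> t M N p))"
proof -
  interpret F: eroding_corr K \<rho> r M N G by fact
  interpret B: eroding_corr K \<rho> r N M "\<lambda>a. (G a)\<inverse>" by (rule eroding_corr_converse) fact
  note M = F.M and N = F.N and \<rho> = F.\<rho>
  have p: "p \<in> rep_hom K M (Rfun \<rho> t N)" unfolding p_def by (rule F.transfer_map_hom[OF mid])
  have q: "q \<in> rep_hom K N (Rfun \<rho> t M)" unfolding q_def by (rule B.transfer_map_hom[OF mid])
  have "emap K \<rho> t M a X = q a (sharp K \<rho> t M N p a X)" if X: "X \<in> carrier (colim K M (down \<rho> t a))" for a X
  proof (rule extensionalityI)
    show "emap K \<rho> t M a X \<in> extensional (up \<rho> t a)"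
      by (simp add: emap_def rep_comp_def etaR_def lim_desc_def)
    show "q a (sharp K \<rho> t M N p a X) \<in> extensional (up \<rho> t a)"
      by (rule Rfun_hom_extensional[OF q lhom_closed[OF sharp_hom[OF K M p N] X]])
    fix y assume y: "y \<in> up \<rho> t a"
    have "Tr M a y (etaL K \<rho> t M a X) = q a (sharp K \<rho> t M N p a X) y"
    proof (rule colim_ext[OF K M Rep_vectorspace[OF M] lhom_comp[OF Rep_Tr[OF M up_le[OF y]] etaL_hom[OF K M]]
          lhom_comp[OF Rfun_hom_at[OF q y] sharp_hom[OF K M p N]] _ X])
      fix x v assume x: "x \<in> down \<rho> t a" and v: "v \<in> carrier (Ob M x)"
      have ax: "a \<in> up \<rho> t x" using x by (simp add: up_iff_down)
      obtain z where z: "z \<in> down \<rho> r a" "z \<in> up \<rho> r x" using mid[OF ax] by blast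
      obtain z' where z': "z' \<in> down \<rho> r y" "z' \<in> up \<rho> r a" using mid[OF y] by blast
      obtain n where n: "(Tr M x z v, n) \<in> G z" by (rule F.corr_transfer_ex[OF v z])
      have nc: "n \<in> carrier (Ob N z)" by (rule lin_rel_right[OF corr_lin_rel[OF F.G] n])
      have p_eq: "p x v a = Tr N z a n" unfolding p_def by (rule F.transfer_map_at[OF v ax z n])
      have za: "z \<le> a" and az': "a \<le> z'" and xz: "x \<le> z" and z'y: "z' \<le> y"
        using down_le[OF z(1)] up_le[OF z'(2)] up_le[OF z(2)] down_le[OF z'(1)] .
      \<comment> \<open>Transporting the pair chosen at \<open>z\<close> to \<open>z'\<close> links
        the first transfer to the second.\<close>
      have "(Tr M z z' (Tr M x z v), Tr N z z' n) \<in> G z'" by (rule corr_Tr[OF F.G order_trans[OF za az'] n])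
      then have "(Tr N a z' (Tr N z a n), Tr M x z' v) \<in> (G z')\<inverse>"
        by (simp add: Rep_Tr_comp[OF N za az' nc] Rep_Tr_comp[OF M xz order_trans[OF za az'] v])
      then have "q a (Tr N z a n) y = Tr M z' y (Tr M x z' v)"
        unfolding q_def by (rule B.transfer_map_at[OF Tr_closed[OF N za nc] y z'])
      then show "Tr M a y (etaL K \<rho> t M a (colim_in K M (down \<rho> t a) x v)) =
          q a (sharp K \<rho> t M N p a (colim_in K M (down \<rho> t a) x v)) y"
        by (simp add: etaL_in[OF K M x v] sharp_in[OF K M p N x v] p_eq v
            Rep_Tr_comp[OF M down_le[OF x] up_le[OF y]]
            Rep_Tr_comp[OF M order_trans[OF xz order_trans[OF za az']] z'y])
    qed
    then show "emap K \<rho> t M a X y = q a (sharp K \<rho> t M N p a X) y"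
      using y by (simp add: emap_def rep_comp_def etaR_def lim_desc_def)
  qed
  then show ?thesis by (simp add: rep_hom_eq_def rep_comp_def)
qed

text \<open>The second interleaving identity is the first one for the converse correspondence, whose
  converse is \<open>G\<close> again. Intermediate points come from (IV) with both levels equal to
  \<open>r\<close>.\<close>

lemma EN_Int_imp_interleaved:
  assumes K: "field K" and \<rho>: "height_difference \<rho>" and M: "M \<in> Rep K" and N: "N \<in> Rep K"
    and CIP: "CIP \<rho>" and c: "cond_IV \<rho> c" "0 \<le> c" and r: "0 \<le> r"
    and EN: "EN K \<rho> r M \<inter> EN K \<rho> r N \<noteq> {}"
  shows "height_interleaved K \<rho> (r + r + c) M N"
proof -
  obtain G where "corr K M N G" "erodes \<rho> r M N G" "erodes \<rho> r N M (\<lambda>a. (G a)\<inverse>)"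
    using EN unfolding EN_Int_iff[OF K M N] by blast
  then have G: "eroding_corr K \<rho> r M N G" using M N \<rho> CIP r by (simp add: eroding_corr_def)
  note H = eroding_corr_converse[OF G]
  have mid: "\<exists>z. z \<in> down \<rho> r y \<and> z \<in> up \<rho> r a" if "y \<in> up \<rho> (r + r + c) a" for a y
    using cond_IV_interpolate[OF c r r, of a y] that unfolding up_iff_down by blast
  show ?thesis
    unfolding height_interleaved_def
    using eroding_corr.transfer_map_hom[OF G mid] eroding_corr.transfer_map_hom[OF H mid]
      transfer_emap[OF G K mid] transfer_emap[OF H K mid]
    by (auto intro!: bexI)
qed

section \<open>Distances\<close>

text \<open>For finite \<open>e\<close> the bound moves across by truncated subtraction; for
  infinite \<open>e\<close> it is trivial. The set may be empty, its infimum then being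
  infinite.\<close>

lemma le_Inf_add:
  fixes d e :: ennreal
  assumes "\<And>x. x \<in> A \<Longrightarrow> d \<le> x + e"
  shows "d \<le> Inf A + e"
proof (cases "e = top_class.top")
  case False
  have "d - e \<le> Inf A"
    using assms False by (intro Inf_greatest) (simp add: ennreal_minus_le_iff add.commute)
  then show ?thesis using False by (simp add: ennreal_minus_le_iff add.commute)
qed simp

lemma le_Inf_add3:
  fixes d :: ennreal
  assumes "\<And>x y z. x \<in> A \<Longrightarrow> y \<in> B \<Longrightarrow> z \<in> C \<Longrightarrow> d \<le> x + y + z"
  shows "d \<le> Inf A + Inf B + Inf C"
proof -
  have 1: "d \<le> Inf C + (x + y)" if "x \<in> A" "y \<in> B" for x y
  proof (rule le_Inf_add)
    fix z assume "z \<in> C"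
    from assms[OF that this] show "d \<le> z + (x + y)" by (simp add: ac_simps)
  qed
  have 2: "d \<le> Inf B + (Inf C + x)" if "x \<in> A" for x
  proof (rule le_Inf_add)
    fix y assume "y \<in> B"
    from 1[OF that this] show "d \<le> y + (Inf C + x)" by (simp add: ac_simps)
  qed
  have "d \<le> Inf A + (Inf B + Inf C)"
  proof (rule le_Inf_add)
    fix x assume "x \<in> A"
    from 2[OF this] show "d \<le> x + (Inf B + Inf C)" by (simp add: ac_simps)
  qed
  then show ?thesis by (simp add: ac_simps)
qed

lemma d_EN_le: "0 \<le> r \<Longrightarrow> EN K \<rho> r M \<inter> EN K \<rho> r N \<noteq> {} \<Longrightarrow> d_EN K \<rho> M N \<le> ennreal r"
  unfolding d_EN_def by (rule Inf_lower) blast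

lemma d_height_le: "0 \<le> r \<Longrightarrow> height_interleaved K \<rho> r M N \<Longrightarrow> d_height K \<rho> M N \<le> ennreal r"
  unfolding d_height_def by (rule Inf_lower) blast

lemma d_EN_le_d_height:
  assumes "field K" "height_difference \<rho>" "M \<in> Rep K" "N \<in> Rep K"
  shows "d_EN K \<rho> M N \<le> d_height K \<rho> M N"
  unfolding d_EN_def d_height_def
  using interleaved_imp_EN_Int[OF assms] by (intro Inf_superset_mono) blast

lemma d_EN_triangle:
  assumes "field K" "M \<in> Rep K" "X \<in> Rep K" "N \<in> Rep K"
  shows "d_EN K \<rho> M N \<le> d_EN K \<rho> M X + d_EN K \<rho> X N + c_const \<rho>"
  unfolding d_EN_def[of K \<rho> M X] d_EN_def[of K \<rho> X N] c_const_def
proof (rule le_Inf_add3, clarify)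
  fix r s c assume *: "0 \<le> r" "0 \<le> s" "0 \<le> c" "cond_IV \<rho> c"
    "EN K \<rho> r M \<inter> EN K \<rho> r X \<noteq> {}" "EN K \<rho> s X \<inter> EN K \<rho> s N \<noteq> {}"
  have "d_EN K \<rho> M N \<le> ennreal (r + s + c)"
    by (rule d_EN_le[OF _ EN_Int_trans[OF assms *(4,3,1,2,5,6)]]) (use * in simp)
  then show "d_EN K \<rho> M N \<le> ennreal r + ennreal s + ennreal c" using * by simp
qed

lemma d_height_le_d_EN:
  assumes K: "field K" and \<rho>: "height_difference \<rho>" and M: "M \<in> Rep K" and N: "N \<in> Rep K" and CIP: "CIP \<rho>"
  shows "d_height K \<rho> M N \<le> 2 * d_EN K \<rho> M N + c_const \<rho>"
proof -
  have "d_height K \<rho> M N \<le> d_EN K \<rho> M N + d_EN K \<rho> M N + c_const \<rho>"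
    unfolding d_EN_def c_const_def
  proof (rule le_Inf_add3, clarify)
    fix r s c assume *: "0 \<le> r" "0 \<le> s" "0 \<le> c" "cond_IV \<rho> c"
      "EN K \<rho> r M \<inter> EN K \<rho> r N \<noteq> {}" "EN K \<rho> s M \<inter> EN K \<rho> s N \<noteq> {}"
    \<comment> \<open>The two copies of the distance supply independent levels \<open>r\<close> and
      \<open>s\<close>. The smaller one is again admissible, and its double is at most
      \<open>r + s\<close>.\<close>
    define u where "u = min r s"
    have u: "0 \<le> u" "EN K \<rho> u M \<inter> EN K \<rho> u N \<noteq> {}" using * by (auto simp: u_def min_def)
    have "d_height K \<rho> M N \<le> ennreal (u + u + c)"
      by (rule d_height_le[OF _ EN_Int_imp_interleaved[OF K \<rho> M N CIP *(4,3) u]]) (use * u in simp)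
    also have "\<dots> \<le> ennreal (r + s + c)" by (rule ennreal_leI) (simp add: u_def min_def)
    finally show "d_height K \<rho> M N \<le> ennreal r + ennreal s + ennreal c" using * by simp
  qed
  then show ?thesis by (simp add: mult_2)
qed

lemma d_EN_ext_pseudo_distance:
  assumes K: "field K" and c: "c_const \<rho> = 0"
  shows "ext_pseudo_distance_on (Rep K :: ('k, 'p::order, 'v) rep set) (d_EN K \<rho>)"
proof -
  have "d_EN K \<rho> M M = 0" if "M \<in> Rep K" for M :: "('k, 'p, 'v) rep"
  proof -
    have "d_EN K \<rho> M M \<le> ennreal 0"
      by (rule d_EN_le[OF order_refl EN_Int_refl[OF K that]])
    then show ?thesis by simp
  qed
  moreover have "d_EN K \<rho> M N = d_EN K \<rho> N M" for M N :: "('k, 'p, 'v) rep"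
    by (simp add: d_EN_def Int_commute)
  moreover have "d_EN K \<rho> M N \<le> d_EN K \<rho> M X + d_EN K \<rho> X N"
    if "M \<in> Rep K" "X \<in> Rep K" "N \<in> Rep K" for M X N :: "('k, 'p, 'v) rep"
    using d_EN_triangle[OF K that, of \<rho>] c by simp
  ultimately show ?thesis unfolding ext_pseudo_distance_on_def by blast
qed

theorem theorem6p8:
  fixes K :: "('k, 'm) ring_scheme" and \<rho> :: "'p::order \<Rightarrow> 'p \<Rightarrow> ennreal"
  assumes "field K" and "height_difference \<rho>"
  shows
    "(\<forall>M\<in>(Rep K :: ('k, 'p, 'v) rep set). \<forall>N\<in>Rep K.
        (\<forall>r\<ge>0. height_interleaved K \<rho> r M N \<longrightarrow> (\<exists>Q. Q \<in> EN K \<rho> r M \<inter> EN K \<rho> r N)) \<and>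
        d_EN K \<rho> M N \<le> d_height K \<rho> M N) \<and>
     (CIP \<rho> \<longrightarrow>
        (\<forall>M\<in>(Rep K :: ('k, 'p, 'v) rep set). \<forall>X\<in>Rep K. \<forall>N\<in>Rep K.
           d_EN K \<rho> M N \<le> d_EN K \<rho> M X + d_EN K \<rho> X N + c_const \<rho>) \<and>
        (\<forall>M\<in>(Rep K :: ('k, 'p, 'v) rep set). \<forall>N\<in>Rep K.
           d_EN K \<rho> M N \<le> d_height K \<rho> M N \<and>
           d_height K \<rho> M N \<le> 2 * d_EN K \<rho> M N + c_const \<rho>) \<and>
        (c_const \<rho> = 0 \<longrightarrow>
           ext_pseudo_distance_on (Rep K :: ('k, 'p, 'v) rep set) (d_EN K \<rho>) \<and>
           (\<forall>M\<in>(Rep K :: ('k, 'p, 'v) rep set). \<forall>N\<in>Rep K.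
              d_EN K \<rho> M N \<le> d_height K \<rho> M N \<and>
              d_height K \<rho> M N \<le> 2 * d_EN K \<rho> M N)))"
proof (intro conjI impI ballI allI)
  fix M N :: "('k, 'p, 'v) rep" and r :: real
  assume "M \<in> Rep K" "N \<in> Rep K" "height_interleaved K \<rho> r M N"
  then show "\<exists>Q. Q \<in> EN K \<rho> r M \<inter> EN K \<rho> r N"
    using interleaved_imp_EN_Int[OF assms] by blast
next
  fix M N :: "('k, 'p, 'v) rep"
  assume "CIP \<rho>" "c_const \<rho> = 0" "M \<in> Rep K" "N \<in> Rep K"
  then show "d_height K \<rho> M N \<le> 2 * d_EN K \<rho> M N"
    using d_height_le_d_EN[OF assms] by fastforce
qed (blast intro: d_EN_le_d_height[OF assms] d_EN_triangle[OF assms(1)] d_height_le_d_EN[OF assms]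
      d_EN_ext_pseudo_distance[OF assms(1)])+

end
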